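(* Let $\mathcal A=\mathbb{C}A_n/I_D$ for a Dyck path $D$ of length $n$. The maps $\varphi^\circ:\mathbb{C}[U^\circ_{\mathcal A}]\to R^\circ_{\mathcal A}$ and $\varphi:\mathbb{C}[U_{\mathcal A}]\to R_{\mathcal A}$ given by $u_X\mapsto f_X$ ($X\in\mathcal I_{\mathcal A}$) are ring isomorphisms. In other words, they yield parametrizations of the very affine variety $U_{\mathcal A}^\circ$ and the affine variety $U_{\mathcal A}$.
   Context: **Dyck paths and algebras.** A Dyck path $D$ of length $n$ is a lattice path from $(1,0)$ to $(n+1,n)$ with up steps $(i,j)\to(i,j+1)$ and down steps $(i,j)\to(i+1,j)$, all of whose vertices satisfy $j\ge i-1$. Its up steps are labelled in order $(1),\dots,(n)$ and its down steps in order $(\Sigma 1),\dots,(\Sigma n)$; the up step $(i)$ goes from $(j_i,i-1)$ to $(j_i,i)$ and the down step $(\Sigma i)$ goes from $(i,k_i)$ to $(i+1,k_i)$. A point $(i,j)$, $1\le i\le j\le n$, is on or below $D$ iff $j\le k_i$. $\mathbb{C}A_n$ is the path algebra of $1\leftarrow2\leftarrow\cdots\leftarrow n$ with arrows $\alpha_i:i+1\to i$. $I_D$ is the two-sided ideal generated by the paths $\alpha_b\alpha_{b-1}\cdots\alpha_{a-1}$ (from $b+1$ to $a-1$) for all valleys $(a,b)$ of $D$ (vertices preceded by a down step and followed by an up step). **Index set.** $\mathcal I_{\mathcal A}$ consists of the $2n$ steps $(i),(\Sigma i)$ of $D$ together with the diamonds below $D$: a diamond is labelled by its top corner $(i,j)$,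 $1\le i<j\le n$ (its other corners are $(i,j-1),(i+1,j),(i+1,j-1)$), and it is below $D$ iff $(i,j)$ is on or below $D$. **Compatibility** of $X,Y\in\mathcal I_{\mathcal A}$: (a) $(i,j)$ and $(k,l)$ are compatible iff the intervals $[i,j],[k,l]$ are comparable under inclusion or disjoint; (b) $(i,j)$ and $(k)$ are compatible iff $k<i$ or $j\le k$; (c) $(i,j)$ and $(\Sigma k)$ are compatible iff $k\le i$ or $j<k$; (d) $(i)$ and $(\Sigma j)$ are compatible iff $i<j$ or the down step $(\Sigma j)$ comes before the up step $(i)$ in $D$; (e) two up steps are always compatible, and two down steps are always compatible. **Configuration spaces.** $U_{\mathcal A}\subset\mathbb{C}^{\mathcal I_{\mathcal A}}$ is the affine variety cut out by the $u$-equations $u_X+\prod_{Y\text{ incompatible with }X}u_Y=1$, $X\in\mathcal I_{\mathcal A}$, and $U_{\mathcal A}^\circ\subset(\mathbb{C}^* )^{\mathcal I_{\mathcal A}}$ is the very affine variety defined by the same equations. The coordinate rings are $\mathbb{C}[U_{\mathcal A}]=\mathbb{C}[u_X]/(u\text{-equations})$ and $\mathbb{C}[U^\circ_{\mathcal A}]=\mathbb{C}[u_X^{\pm1}]/(u\text{-equations})$, $X\in\mathcal I_{\mathcal A}$. **$F$-polynomials and $f_X$.** For $1\le i\le j\le n$, $F_{i,j}=1+y_i+y_iy_{i+1}+\cdots+y_iy_{i+1}\cdots y_j\in\mathbb{C}[y_1,\dots,y_n]$; by convention $F_{k,l}=1$ if $k=0$, $l=n+1$ or $k>l$. Define elements of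 the rational function field $\mathbb{C}(y)=\mathbb{C}(y_1,\dots,y_n)$: $$f_{i,j}=\frac{F_{i,j}F_{i+1,j-1}}{F_{i+1,j}F_{i,j-1}}\ \text{ for a diamond }(i,j)\text{ below }D,\qquad f_i=\frac{F_{j_i,i-1}}{F_{j_i,i}},\qquad f_{\Sigma i}=y_i\frac{F_{i+1,k_i}}{F_{i,k_i}}\ \ (1\le i\le n).$$ $R_{\mathcal A}$ (resp. $R^\circ_{\mathcal A}$) is the $\mathbb{C}$-subalgebra of $\mathbb{C}(y)$ generated by all $f_X$ (resp. all $f_X^{\pm1}$), $X\in\mathcal I_{\mathcal A}$. *)

theory Defs
  imports
    "HOL-Library.Poly_Mapping"
    "HOL-Library.FuncSet"
    "HOL-Computational_Algebra.Fraction_Field"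
    "HOL-Algebra.QuotRing"
    "HOL-Algebra.Generated_Rings"
begin

section \<open>Dyck paths\<close>

datatype step = U_step | D_step

text \<open>A lattice path is the list of its steps; it starts at the point \<open>(1, 0)\<close>, and
  \<open>vertex D t\<close> is the point reached after \<open>t\<close> steps.\<close>

definition vertex :: "step list \<Rightarrow> nat \<Rightarrow> nat \<times> nat" where
  "vertex D t = (1 + count_list (take t D) D_step, count_list (take t D) U_step)"

definition dyck_path :: "nat \<Rightarrow> step list \<Rightarrow> bool" where
  "dyck_path n D \<longleftrightarrow>
     vertex D (length D) = (n + 1, n) \<and>
     (\<forall>t\<le>length D. case vertex D t of (i, j) \<Rightarrow> int j \<ge> int i - 1)"

text \<open>Positions in the list of the up step \<open>(i)\<close>, which starts at height \<open>i - 1\<close>, and of the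
  down step \<open>(\<Sigma> i)\<close>, which starts at abscissa \<open>i\<close>. On a Dyck path of length \<open>n\<close> they
  exist and are unique for \<open>1 \<le> i \<le> n\<close>.\<close>

definition up_pos :: "step list \<Rightarrow> nat \<Rightarrow> nat" where
  "up_pos D i = (THE t. t < length D \<and> D ! t = U_step \<and> int (snd (vertex D t)) = int i - 1)"

definition down_pos :: "step list \<Rightarrow> nat \<Rightarrow> nat" where
  "down_pos D i = (THE t. t < length D \<and> D ! t = D_step \<and> fst (vertex D t) = i)"

definition j_coord :: "step list \<Rightarrow> nat \<Rightarrow> nat" where
  "j_coord D i = fst (vertex D (up_pos D i))"

definition k_coord :: "step list \<Rightarrow> nat \<Rightarrow> nat" where
  "k_coord D i = snd (vertex D (down_pos D i))"

definition on_or_below :: "step list \<Rightarrow> nat \<Rightarrow> nat \<Rightarrow> bool" where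
  "on_or_below D i j \<longleftrightarrow> j \<le> k_coord D i"


section \<open>Index set and compatibility\<close>

text \<open>\<open>Up i\<close> is the up step \<open>(i)\<close>, \<open>Down i\<close> the down step \<open>(\<Sigma> i)\<close>, and
  \<open>Diam i j\<close> the diamond with top corner \<open>(i, j)\<close>.\<close>

datatype idx = Up nat | Down nat | Diam nat nat

definition index_set :: "nat \<Rightarrow> step list \<Rightarrow> idx set" where
  "index_set n D =
     {Up i | i. 1 \<le> i \<and> i \<le> n} \<union> {Down i | i. 1 \<le> i \<and> i \<le> n} \<union>
     {Diam i j | i j. 1 \<le> i \<and> i < j \<and> j \<le> n \<and> on_or_below D i j}"

fun compatible :: "step list \<Rightarrow> idx \<Rightarrow> idx \<Rightarrow> bool" where
  "compatible D (Diam i j) (Diam k l) \<longleftrightarrow>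
     {i..j} \<subseteq> {k..l} \<or> {k..l} \<subseteq> {i..j} \<or> {i..j} \<inter> {k..l} = {}"
| "compatible D (Diam i j) (Up k) \<longleftrightarrow> k < i \<or> j \<le> k"
| "compatible D (Up k) (Diam i j) \<longleftrightarrow> k < i \<or> j \<le> k"
| "compatible D (Diam i j) (Down k) \<longleftrightarrow> k \<le> i \<or> j < k"
| "compatible D (Down k) (Diam i j) \<longleftrightarrow> k \<le> i \<or> j < k"
| "compatible D (Up i) (Down j) \<longleftrightarrow> i < j \<or> down_pos D j < up_pos D i"
| "compatible D (Down j) (Up i) \<longleftrightarrow> i < j \<or> down_pos D j < up_pos D i"
| "compatible D (Up i) (Up j) \<longleftrightarrow> True"
| "compatible D (Down i) (Down j) \<longleftrightarrow> True"

definition incompatibles :: "nat \<Rightarrow> step list \<Rightarrow> idx \<Rightarrow> idx set" where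
  "incompatibles n D X = {Y \<in> index_set n D. \<not> compatible D X Y}"


section \<open>Commutative complex algebras\<close>

text \<open>A commutative complex algebra is given by a ring together with its structure map from
  the complex numbers.\<close>

definition ring_on :: "'a::comm_ring_1 set \<Rightarrow> 'a ring" where
  "ring_on S = \<lparr>carrier = S, mult = (*), one = 1, zero = 0, add = (+)\<rparr>"

definition alg_hom ::
  "'a ring \<Rightarrow> (complex \<Rightarrow> 'a) \<Rightarrow> 'b ring \<Rightarrow> (complex \<Rightarrow> 'b) \<Rightarrow> ('a \<Rightarrow> 'b) set" where
  "alg_hom A \<iota> B \<kappa> = {h \<in> ring_hom A B. \<forall>c. h (\<iota> c) = \<kappa> c}"

definition alg_iso ::
  "'a ring \<Rightarrow> (complex \<Rightarrow> 'a) \<Rightarrow> 'b ring \<Rightarrow> (complex \<Rightarrow> 'b) \<Rightarrow> ('a \<Rightarrow> 'b) set" where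
  "alg_iso A \<iota> B \<kappa> = {h \<in> ring_iso A B. \<forall>c. h (\<iota> c) = \<kappa> c}"


section \<open>Configuration spaces and their coordinate rings\<close>

text \<open>Polynomials (exponent type \<open>nat\<close>) and Laurent polynomials (exponent type \<open>int\<close>)
  are finitely supported functions from exponent vectors to coefficients. The following
  constants cover both; in \<open>poly_ring V\<close> only variables from \<open>V\<close> may occur.\<close>

type_synonym ('x, 'e) gpoly = "('x \<Rightarrow>\<^sub>0 'e) \<Rightarrow>\<^sub>0 complex"

definition poly_const :: "complex \<Rightarrow> ('x, 'e::comm_semiring_1) gpoly" where
  "poly_const c = Poly_Mapping.single 0 c"

definition poly_var :: "'x \<Rightarrow> ('x, 'e::comm_semiring_1) gpoly" where
  "poly_var X = Poly_Mapping.single (Poly_Mapping.single X 1) 1"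

definition poly_ring :: "'x set \<Rightarrow> ('x, 'e::comm_semiring_1) gpoly ring" where
  "poly_ring V = ring_on {p. \<forall>m \<in> Poly_Mapping.keys p. Poly_Mapping.keys m \<subseteq> V}"

definition u_eqn :: "nat \<Rightarrow> step list \<Rightarrow> idx \<Rightarrow> (idx, 'e::comm_semiring_1) gpoly" where
  "u_eqn n D X = poly_var X + (\<Prod>Y \<in> incompatibles n D X. poly_var Y) - 1"

definition u_ideal :: "nat \<Rightarrow> step list \<Rightarrow> (idx, 'e::comm_semiring_1) gpoly set" where
  "u_ideal n D = genideal (poly_ring (index_set n D)) (u_eqn n D ` index_set n D)"

definition coset_of :: "nat \<Rightarrow> step list \<Rightarrow>
    (idx, 'e::comm_semiring_1) gpoly \<Rightarrow> (idx, 'e) gpoly set" where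
  "coset_of n D p = u_ideal n D +>\<^bsub>poly_ring (index_set n D)\<^esub> p"

text \<open>The coordinate rings of \<open>U\<close> and of the very affine variety \<open>U\<^sup>\<circ>\<close>.\<close>

definition coord_ring :: "nat \<Rightarrow> step list \<Rightarrow> (idx, nat) gpoly set ring" where
  "coord_ring n D = poly_ring (index_set n D) Quot u_ideal n D"

definition coord_ring_open :: "nat \<Rightarrow> step list \<Rightarrow> (idx, int) gpoly set ring" where
  "coord_ring_open n D = poly_ring (index_set n D) Quot u_ideal n D"

text \<open>The varieties as sets of complex points.\<close>

definition U_var :: "nat \<Rightarrow> step list \<Rightarrow> (idx \<Rightarrow> complex) set" where
  "U_var n D = {u \<in> index_set n D \<rightarrow>\<^sub>E UNIV.
     \<forall>X \<in> index_set n D. u X + (\<Prod>Y \<in> incompatibles n D X. u Y) = 1}"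

definition U_var_open :: "nat \<Rightarrow> step list \<Rightarrow> (idx \<Rightarrow> complex) set" where
  "U_var_open n D = {u \<in> index_set n D \<rightarrow>\<^sub>E (UNIV - {0}).
     \<forall>X \<in> index_set n D. u X + (\<Prod>Y \<in> incompatibles n D X. u Y) = 1}"


section \<open>F-polynomials and the algebras R\<close>

text \<open>Rational functions in countably many variables \<open>y\<^sub>0, y\<^sub>1, \<dots>\<close>; only
  \<open>y\<^sub>1, \<dots>, y\<^sub>n\<close> occur below, so all constructions take place in the subfield
  generated by these.\<close>

type_synonym ratfun = "(nat, nat) gpoly fract"

definition rat_const :: "complex \<Rightarrow> ratfun" where
  "rat_const c = Fraction_Field.Fract (poly_const c) 1"

definition y_var :: "nat \<Rightarrow> ratfun" where
  "y_var i = Fraction_Field.Fract (poly_var i) 1"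

definition F_poly :: "nat \<Rightarrow> nat \<Rightarrow> nat \<Rightarrow> ratfun" where
  "F_poly n k l =
     (if k = 0 \<or> l = n + 1 \<or> k > l then 1 else 1 + (\<Sum>m = k..l. \<Prod>r = k..m. y_var r))"

fun f_elem :: "nat \<Rightarrow> step list \<Rightarrow> idx \<Rightarrow> ratfun" where
  "f_elem n D (Diam i j) =
     (F_poly n i j * F_poly n (i + 1) (j - 1)) / (F_poly n (i + 1) j * F_poly n i (j - 1))"
| "f_elem n D (Up i) = F_poly n (j_coord D i) (i - 1) / F_poly n (j_coord D i) i"
| "f_elem n D (Down i) = y_var i * (F_poly n (i + 1) (k_coord D i) / F_poly n i (k_coord D i))"

text \<open>The subring generated by all constants and a set \<open>S\<close> is the complex subalgebra
  generated by \<open>S\<close>.\<close>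

definition subalg_gen :: "ratfun set \<Rightarrow> ratfun ring" where
  "subalg_gen S = ring_on (generate_ring (ring_on UNIV) (range rat_const \<union> S))"

definition R_alg :: "nat \<Rightarrow> step list \<Rightarrow> ratfun ring" where
  "R_alg n D = subalg_gen (f_elem n D ` index_set n D)"

definition R_alg_open :: "nat \<Rightarrow> step list \<Rightarrow> ratfun ring" where
  "R_alg_open n D = subalg_gen
     (f_elem n D ` index_set n D \<union> (\<lambda>X. inverse (f_elem n D X)) ` index_set n D)"


section \<open>Parametrizations\<close>

text \<open>\<open>C_points A \<iota>\<close> are the complex points of the spectrum of the algebra \<open>A\<close>, i.e. the
  algebra homomorphisms to the complex numbers; functions are made extensional so that they
  are determined by their values on the carrier.\<close>

definition C_points :: "'a ring \<Rightarrow> (complex \<Rightarrow> 'a) \<Rightarrow> ('a \<Rightarrow> complex) set" where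
  "C_points A \<iota> = alg_hom A \<iota> (ring_on UNIV) id \<inter> extensional (carrier A)"

text \<open>\<open>u X \<mapsto> f X\<close> defines an isomorphism of algebras: there is a unique algebra homomorphism
  with these values, and it is bijective.\<close>

definition defines_iso ::
  "'a ring \<Rightarrow> (complex \<Rightarrow> 'a) \<Rightarrow> 'b ring \<Rightarrow> (complex \<Rightarrow> 'b) \<Rightarrow>
   'x set \<Rightarrow> ('x \<Rightarrow> 'a) \<Rightarrow> ('x \<Rightarrow> 'b) \<Rightarrow> bool" where
  "defines_iso A \<iota> B \<kappa> V u f \<longleftrightarrow>
     (\<exists>\<phi> \<in> alg_iso A \<iota> B \<kappa>. (\<forall>X\<in>V. \<phi> (u X) = f X) \<and>
       (\<forall>\<psi> \<in> alg_hom A \<iota> B \<kappa>. (\<forall>X\<in>V. \<psi> (u X) = f X) \<longrightarrow> (\<forall>a \<in> carrier A. \<psi> a = \<phi> a)))"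

end

theory Submission
  imports Defs "HOL-Computational_Algebra.Polynomial_Factorial"
begin

text \<open>
  The theorem is proved by letting the Dyck path grow, one peak or one diamond at a time, and by
  following what happens to the \<open>u\<close>-equations.

  Suppose that \<open>D\<close> arises from \<open>D'\<close> by turning a valley into the peak \<open>(i, n)\<close>. Only one index is
  new, the diamond \<open>(i, n)\<close>, and the compatibilities change in such a way that
  \<open>u'\<^sub>(\<^sub>n\<^sub>) = u\<^sub>(\<^sub>n\<^sub>) u\<^sub>i\<^sub>n\<close> and \<open>u'\<^sub>(\<^sub>\<Sigma>\<^sub>i\<^sub>) = u\<^sub>(\<^sub>\<Sigma>\<^sub>i\<^sub>) u\<^sub>i\<^sub>n\<close>, with all other coordinates
  unchanged, map solutions for \<open>D\<close> to solutions for \<open>D'\<close>. Write \<open>p\<close> and \<open>q\<close> for these two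
  products, \<open>w\<close> for \<open>u\<^sub>i\<^sub>n\<close> and \<open>s\<close> for \<open>u\<^sub>(\<^sub>n\<^sub>)\<close>. Given the equations for \<open>D'\<close>, the three
  equations at the new peak are equivalent to \<open>w = p + q - p q\<close>, \<open>u\<^sub>(\<^sub>\<Sigma>\<^sub>i\<^sub>) = 1 - s (1 - q)\<close> and
  \<open>s w = p\<close>. So the coordinate ring for \<open>D\<close> is obtained from the one for \<open>D'\<close> by adjoining one
  element \<open>s\<close> with the single relation \<open>s w = p\<close>: a chart of the blow-up of the locus \<open>p = q = 0\<close>. The elements \<open>f\<close> obey the
  same rules, because of the recursion \<open>F\<^sub>i\<^sub>j = 1 + y\<^sub>i F\<^sub>i\<^sub>+\<^sub>1\<^sub>,\<^sub>j\<close>; in particular they satisfy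
  the \<open>u\<close>-equations.

  The heart of the matter is that no further relation holds between the elements \<open>f\<close>
  (\<open>separated_adjoin_quotient\<close>). If \<open>R'\<close> is the ring generated by the \<open>f\<close> for \<open>D'\<close>, this amounts
  to: \<open>a p\<close> divisible by \<open>w\<close> in \<open>R'\<close> implies \<open>a\<close> divisible by \<open>w\<close>. That would be delicate for an
  arbitrary order of the diamonds. Here they are added row by row, and within the row of height
  \<open>n\<close> from right to left. If \<open>R\<^sub>0\<close> is the ring before this row was begun, then \<open>R' = R\<^sub>0 + p R'\<close>
  and \<open>R\<^sub>0 \<inter> p R' = 0\<close>: setting \<open>p\<close> to zero, which is letting \<open>y\<^sub>n\<close> go to infinity, retracts \<open>R'\<close>
  onto \<open>R\<^sub>0\<close>. As \<open>q\<close> is a nonzero element of \<open>R\<^sub>0\<close>, the divisibility statement is immediate; and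
  the retraction persists with \<open>R'[s]\<close> and \<open>s\<close> in place of \<open>R'\<close> and \<open>p\<close> (\<open>split_off_adjoin\<close>). A
  row begins with a peak at the right end of the path, which adjoins \<open>s = 1 / (1 + y\<^sub>n)\<close>,
  transcendental over \<open>R\<^sub>0\<close>.

  Polynomials and Laurent polynomials are treated together. The induction is carried out for an
  arbitrary commutative ring \<open>S\<close> with an ideal \<open>J\<close> and an arbitrary solution \<open>z\<close> of the equations
  modulo \<open>J\<close>: the subring of pairs generated by the \<open>(f\<^sub>X, z\<^sub>X)\<close> contains \<open>(0, a)\<close> only for
  \<open>a \<in> J\<close> (\<open>presented\<close>). Taking for \<open>S\<close> a ring of polynomials, for \<open>J\<close> the ideal of the
  \<open>u\<close>-equations and for \<open>z\<close> the variables shows that the kernel of \<open>u\<^sub>X \<mapsto> f\<^sub>X\<close> is that ideal; a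
  Laurent polynomial becomes a polynomial on multiplication with a unit. Surjectivity is built
  into the definition of the target rings, and complex points are determined by the values on the
  generators.
\<close>


section \<open>Subalgebras and subalgebras of pairs\<close>

text \<open>The ring of the elements \<open>f\<close> lies in \<open>'k\<close>, the coordinate ring is \<open>'s\<close> modulo \<open>J\<close>. Working
  with an ideal instead of a quotient ring keeps the coordinate ring inside a type.\<close>

locale algebra_pair =
  fixes cK :: "complex \<Rightarrow> 'k::field" and cS :: "complex \<Rightarrow> 's::comm_ring_1" and J :: "'s set"
  assumes cK_0: "cK 0 = 0" and cK_1: "cK 1 = 1"
    and cK_add: "cK (a + b) = cK a + cK b" and cK_mult: "cK (a * b) = cK a * cK b"
    and cS_0: "cS 0 = 0" and cS_1: "cS 1 = 1"
    and cS_add: "cS (a + b) = cS a + cS b" and cS_mult: "cS (a * b) = cS a * cS b"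
    and J_0: "0 \<in> J" and J_add: "j \<in> J \<Longrightarrow> j' \<in> J \<Longrightarrow> j + j' \<in> J"
    and J_mult: "j \<in> J \<Longrightarrow> s * j \<in> J"
begin

lemma J_uminus: "a \<in> J \<Longrightarrow> - a \<in> J"
  using J_mult[of a "-1"] by simp

lemma J_diff: "a \<in> J \<Longrightarrow> b \<in> J \<Longrightarrow> a - b \<in> J"
  using J_add[of a "-b"] J_uminus by simp

lemma J_sum: "(\<And>i. i \<in> I \<Longrightarrow> g i \<in> J) \<Longrightarrow> sum g I \<in> J"
  by (induction I rule: infinite_finite_induct) (auto simp: J_0 J_add)

lemma cK_m1: "cK (-1) = -1" and cS_m1: "cS (-1) = -1"
proof -
  have "cK (-1) + cK 1 = cK 0" by (subst cK_add[symmetric]) simp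
  then show "cK (-1) = -1" by (simp add: cK_0 cK_1 eq_neg_iff_add_eq_0)
  have "cS (-1) + cS 1 = cS 0" by (subst cS_add[symmetric]) simp
  then show "cS (-1) = -1" by (simp add: cS_0 cS_1 eq_neg_iff_add_eq_0)
qed

definition subalgebra :: "'k set \<Rightarrow> bool" where
  "subalgebra R \<longleftrightarrow> range cK \<subseteq> R \<and> (\<forall>x\<in>R. \<forall>y\<in>R. x + y \<in> R \<and> x * y \<in> R)"

text \<open>A subalgebra of \<open>'k \<times> ('s / J)\<close>, written as a relation on representatives.\<close>

definition subalgebra_mod :: "('k \<Rightarrow> 's \<Rightarrow> bool) \<Rightarrow> bool" where
  "subalgebra_mod G \<longleftrightarrow> (\<forall>c. G (cK c) (cS c)) \<and>
     (\<forall>x a y b. G x a \<longrightarrow> G y b \<longrightarrow> G (x + y) (a + b) \<and> G (x * y) (a * b)) \<and>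
     (\<forall>x a b. G x a \<longrightarrow> a - b \<in> J \<longrightarrow> G x b)"

text \<open>For a subalgebra of pairs: it is the graph of a homomorphism from its domain to \<open>'s / J\<close>.\<close>

definition separated :: "('k \<Rightarrow> 's \<Rightarrow> bool) \<Rightarrow> bool" where
  "separated G \<longleftrightarrow> (\<forall>a. G 0 a \<longrightarrow> a \<in> J)"

inductive_set alg :: "'x set \<Rightarrow> ('x \<Rightarrow> 'k) \<Rightarrow> 'k set" for V f where
  alg_const: "cK c \<in> alg V f"
| alg_gen: "X \<in> V \<Longrightarrow> f X \<in> alg V f"
| alg_add: "x \<in> alg V f \<Longrightarrow> y \<in> alg V f \<Longrightarrow> x + y \<in> alg V f"
| alg_mult: "x \<in> alg V f \<Longrightarrow> y \<in> alg V f \<Longrightarrow> x * y \<in> alg V f"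

text \<open>The subalgebra of pairs generated by the \<open>(f X, z X)\<close>. It is separated iff every polynomial
  relation between the \<open>f X\<close> holds modulo \<open>J\<close> between the \<open>z X\<close>.\<close>

inductive joint :: "'x set \<Rightarrow> ('x \<Rightarrow> 'k) \<Rightarrow> ('x \<Rightarrow> 's) \<Rightarrow> 'k \<Rightarrow> 's \<Rightarrow> bool" for V f z where
  joint_const: "joint V f z (cK c) (cS c)"
| joint_gen: "X \<in> V \<Longrightarrow> joint V f z (f X) (z X)"
| joint_add: "joint V f z x a \<Longrightarrow> joint V f z y b \<Longrightarrow> joint V f z (x + y) (a + b)"
| joint_mult: "joint V f z x a \<Longrightarrow> joint V f z y b \<Longrightarrow> joint V f z (x * y) (a * b)"
| joint_shift: "joint V f z x a \<Longrightarrow> a - b \<in> J \<Longrightarrow> joint V f z x b"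

lemma subalgebra_alg: "subalgebra (alg V f)"
  by (auto simp: subalgebra_def intro: alg.intros)

lemma subalgebra_mod_joint: "subalgebra_mod (joint V f z)"
  unfolding subalgebra_mod_def by (blast intro: joint.intros)

lemma alg_least:
  assumes "subalgebra R" "\<And>X. X \<in> V \<Longrightarrow> f X \<in> R"
  shows "alg V f \<subseteq> R"
proof
  fix x assume "x \<in> alg V f"
  then show "x \<in> R" by induction (use assms in \<open>auto simp: subalgebra_def\<close>)
qed

lemma joint_least:
  assumes "subalgebra_mod G" "\<And>X. X \<in> V \<Longrightarrow> G (f X) (z X)" "joint V f z x a"
  shows "G x a"
  using assms(3) by induction (use assms(1,2) in \<open>auto simp: subalgebra_mod_def\<close>)

lemma joint_dom: "(\<exists>a. joint V f z x a) \<longleftrightarrow> x \<in> alg V f"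
proof
  assume "\<exists>a. joint V f z x a"
  then obtain a where "joint V f z x a" ..
  then show "x \<in> alg V f" by induction (auto intro: alg.intros)
next
  assume "x \<in> alg V f"
  then show "\<exists>a. joint V f z x a" by induction (blast intro: joint.intros)+
qed

context
  fixes R assumes R: "subalgebra R"
begin

lemma subalgebra_const: "cK c \<in> R" and subalgebra_add: "x \<in> R \<Longrightarrow> y \<in> R \<Longrightarrow> x + y \<in> R"
  and subalgebra_mult: "x \<in> R \<Longrightarrow> y \<in> R \<Longrightarrow> x * y \<in> R"
  using R by (auto simp: subalgebra_def)

lemma subalgebra_0: "0 \<in> R" and subalgebra_1: "1 \<in> R"
  using subalgebra_const[of 0] subalgebra_const[of 1] by (auto simp: cK_0 cK_1)

lemma subalgebra_uminus: "x \<in> R \<Longrightarrow> - x \<in> R"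
  using subalgebra_mult[OF subalgebra_const[of "-1"], of x] by (simp add: cK_m1)

lemma subalgebra_diff: "x \<in> R \<Longrightarrow> y \<in> R \<Longrightarrow> x - y \<in> R"
  using subalgebra_add[of x "-y"] subalgebra_uminus by simp

lemma subalgebra_power: "x \<in> R \<Longrightarrow> x ^ m \<in> R"
  by (induction m) (auto simp: subalgebra_1 subalgebra_mult)

lemma subalgebra_sum: "(\<And>i. i \<in> I \<Longrightarrow> g i \<in> R) \<Longrightarrow> sum g I \<in> R"
  by (induction I rule: infinite_finite_induct) (auto simp: subalgebra_0 subalgebra_add)

end

lemmas subalgebra_rules = subalgebra_const subalgebra_add subalgebra_mult subalgebra_0 subalgebra_1
  subalgebra_uminus subalgebra_diff subalgebra_power subalgebra_sum

context
  fixes G assumes G: "subalgebra_mod G"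
begin

lemma mod_const: "G (cK c) (cS c)"
  and mod_add: "G x a \<Longrightarrow> G y b \<Longrightarrow> G (x + y) (a + b)"
  and mod_mult: "G x a \<Longrightarrow> G y b \<Longrightarrow> G (x * y) (a * b)"
  and mod_shift: "G x a \<Longrightarrow> a - b \<in> J \<Longrightarrow> G x b"
  using G unfolding subalgebra_mod_def by blast+

lemma mod_0: "G 0 0" and mod_1: "G 1 1"
  using mod_const[of 0] mod_const[of 1] by (auto simp: cK_0 cK_1 cS_0 cS_1)

lemma mod_uminus: "G x a \<Longrightarrow> G (- x) (- a)"
  using mod_mult[OF mod_const[of "-1"], of x a] by (simp add: cK_m1 cS_m1)

lemma mod_diff: "G x a \<Longrightarrow> G y b \<Longrightarrow> G (x - y) (a - b)"
  using mod_add[of x a "-y" "-b"] mod_uminus[of y b] by simp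

lemma mod_sum: "(\<And>i. i \<in> I \<Longrightarrow> G (g i) (h i)) \<Longrightarrow> G (sum g I) (sum h I)"
  by (induction I rule: infinite_finite_induct) (auto simp: mod_0 mod_add)

end


section \<open>Adjoining one element\<close>

definition adjoin :: "'k set \<Rightarrow> 'k \<Rightarrow> 'k set" where
  "adjoin R s = {poly a s | a. \<forall>i. coeff a i \<in> R}"

definition adjoin_mod :: "('k \<Rightarrow> 's \<Rightarrow> bool) \<Rightarrow> 'k \<Rightarrow> 's \<Rightarrow> 'k \<Rightarrow> 's \<Rightarrow> bool" where
  "adjoin_mod G s \<zeta> x b \<longleftrightarrow>
     (\<exists>a \<alpha>. (\<forall>i. G (coeff a i) (coeff \<alpha> i)) \<and> x = poly a s \<and> poly \<alpha> \<zeta> - b \<in> J)"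

lemma adjoin_base: assumes "subalgebra R" "r \<in> R" shows "r \<in> adjoin R s"
proof -
  have "\<forall>i. coeff [:r:] i \<in> R" using assms by (auto simp: coeff_pCons subalgebra_0 split: nat.split)
  then show ?thesis unfolding adjoin_def by (intro CollectI exI[of _ "[:r:]"]) auto
qed

lemma adjoin_self: assumes "subalgebra R" shows "s \<in> adjoin R s"
proof -
  have "\<forall>i. coeff [:0, 1:] i \<in> R"
    using assms by (auto simp: coeff_pCons subalgebra_0 subalgebra_1 split: nat.split)
  then show ?thesis unfolding adjoin_def by (intro CollectI exI[of _ "[:0,1:]"]) auto
qed

lemma subalgebra_adjoin: assumes R: "subalgebra R" shows "subalgebra (adjoin R s)"
  unfolding subalgebra_def
proof (intro conjI ballI)
  show "range cK \<subseteq> adjoin R s" using adjoin_base[OF R] subalgebra_const[OF R] by blast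
  fix x y assume "x \<in> adjoin R s" "y \<in> adjoin R s"
  then obtain a b where ab: "\<forall>i. coeff a i \<in> R" "x = poly a s" "\<forall>i. coeff b i \<in> R" "y = poly b s"
    unfolding adjoin_def by auto
  have "\<forall>i. coeff (a + b) i \<in> R" "\<forall>i. coeff (a * b) i \<in> R"
    using ab R by (auto simp: coeff_mult intro!: subalgebra_rules)
  then have "poly (a + b) s \<in> adjoin R s" "poly (a * b) s \<in> adjoin R s"
    unfolding adjoin_def by blast+
  then show "x + y \<in> adjoin R s" "x * y \<in> adjoin R s" using ab by simp_all
qed

lemma adjoin_least: assumes "subalgebra T" "R \<subseteq> T" "s \<in> T" shows "adjoin R s \<subseteq> T"
  using assms unfolding adjoin_def by (auto simp: poly_altdef intro!: subalgebra_rules)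

lemma adjoin_mod_base:
  assumes "subalgebra_mod G" "G x a" shows "adjoin_mod G s \<zeta> x a"
proof -
  have "\<forall>i. G (coeff [:x:] i) (coeff [:a:] i)"
    using assms by (auto simp: coeff_pCons mod_0 split: nat.split)
  then show ?thesis unfolding adjoin_mod_def
    by (intro exI[of _ "[:x:]"] exI[of _ "[:a:]"]) (auto simp: J_0)
qed

lemma adjoin_mod_self:
  assumes "subalgebra_mod G" shows "adjoin_mod G s \<zeta> s \<zeta>"
proof -
  have "\<forall>i. G (coeff [:0,1:] i) (coeff [:0,1:] i)"
    using assms by (auto simp: coeff_pCons mod_0 mod_1 split: nat.split)
  then show ?thesis unfolding adjoin_mod_def
    by (intro exI[of _ "[:0,1:]"]) (auto simp: J_0)
qed

lemma subalgebra_mod_adjoin: assumes G: "subalgebra_mod G" shows "subalgebra_mod (adjoin_mod G s \<zeta>)"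
  unfolding subalgebra_mod_def
proof (intro conjI allI impI)
  show "adjoin_mod G s \<zeta> (cK c) (cS c)" for c by (intro adjoin_mod_base G mod_const)
  fix x a assume xa: "adjoin_mod G s \<zeta> x a"
  then obtain p \<pi> where p: "\<forall>i. G (coeff p i) (coeff \<pi> i)" "x = poly p s" "poly \<pi> \<zeta> - a \<in> J"
    unfolding adjoin_mod_def by auto
  show "adjoin_mod G s \<zeta> x b" if "a - b \<in> J" for b
    unfolding adjoin_mod_def using p J_add[OF p(3) that] by auto
  fix y b assume "adjoin_mod G s \<zeta> y b"
  then obtain q \<kappa> where q: "\<forall>i. G (coeff q i) (coeff \<kappa> i)" "y = poly q s" "poly \<kappa> \<zeta> - b \<in> J"
    unfolding adjoin_mod_def by auto
  have "\<forall>i. G (coeff (p + q) i) (coeff (\<pi> + \<kappa>) i)" "\<forall>i. G (coeff (p * q) i) (coeff (\<pi> * \<kappa>) i)"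
    using p q by (auto simp: coeff_mult intro!: mod_add[OF G] mod_mult[OF G] mod_sum[OF G])
  moreover have "poly (\<pi> + \<kappa>) \<zeta> - (a + b) \<in> J"
    using J_add[OF p(3) q(3)] by (simp add: algebra_simps)
  moreover have "poly (\<pi> * \<kappa>) \<zeta> - a * b = poly \<kappa> \<zeta> * (poly \<pi> \<zeta> - a) + a * (poly \<kappa> \<zeta> - b)"
    by (simp add: algebra_simps)
  then have "poly (\<pi> * \<kappa>) \<zeta> - a * b \<in> J" using p(3) q(3) by (simp add: J_add J_mult)
  ultimately have "adjoin_mod G s \<zeta> (poly (p + q) s) (a + b)" "adjoin_mod G s \<zeta> (poly (p * q) s)
    (a * b)"
    unfolding adjoin_mod_def by blast+
  then show "adjoin_mod G s \<zeta> (x + y) (a + b)" "adjoin_mod G s \<zeta> (x * y) (a * b)"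
    using p(2) q(2) by simp_all
qed

definition transcendental :: "'k set \<Rightarrow> 'k \<Rightarrow> bool" where
  "transcendental R s \<longleftrightarrow> (\<forall>a. (\<forall>i. coeff a i \<in> R) \<longrightarrow> poly a s = 0 \<longrightarrow> a = 0)"

text \<open>The only polynomial relation for \<open>s\<close> is the trivial one, so any value \<open>\<zeta>\<close> may be prescribed.\<close>

lemma separated_adjoin_transcendental:
  assumes G: "subalgebra_mod G" "separated G" and tr: "transcendental R s"
    and dom: "\<And>x a. G x a \<Longrightarrow> x \<in> R"
  shows "separated (adjoin_mod G s \<zeta>)"
  unfolding separated_def
proof (intro allI impI)
  fix b assume "adjoin_mod G s \<zeta> 0 b"
  then obtain p \<pi> where p: "\<forall>i. G (coeff p i) (coeff \<pi> i)" "0 = poly p s" "poly \<pi> \<zeta> - b \<in> J"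
    unfolding adjoin_mod_def by auto
  have "p = 0" using tr p dom unfolding transcendental_def by metis
  then have "coeff \<pi> i \<in> J" for i using p(1) G(2) unfolding separated_def by auto
  then have "poly \<pi> \<zeta> \<in> J"
    by (auto simp: poly_altdef mult.commute[of "coeff _ _"] intro!: J_sum J_mult)
  from J_diff[OF this p(3)] show "b \<in> J" by simp
qed

text \<open>\<open>R\<close> is the direct sum of \<open>R0\<close> and the principal ideal of \<open>p\<close>, so \<open>R0\<close> is isomorphic to
  \<open>R / (p)\<close>.\<close>

definition split_off :: "'k set \<Rightarrow> 'k set \<Rightarrow> 'k \<Rightarrow> bool" where
  "split_off R0 R p \<longleftrightarrow> R0 \<subseteq> R \<and> (\<forall>x\<in>R. \<exists>r\<in>R0. \<exists>c\<in>R. x = r + p * c) \<and>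
     (\<forall>c\<in>R. p * c \<in> R0 \<longrightarrow> p * c = 0)"

lemma split_off_transcendental:
  assumes R: "subalgebra R" and tr: "transcendental R s"
  shows "split_off R (adjoin R s) s"
  unfolding split_off_def
proof (intro conjI ballI impI subsetI)
  show "r \<in> adjoin R s" if "r \<in> R" for r using adjoin_base[OF R that] .
next
  fix x assume "x \<in> adjoin R s"
  then obtain a where a: "\<forall>i. coeff a i \<in> R" "x = poly a s" unfolding adjoin_def by auto
  obtain r b where rb: "a = pCons r b" by (cases a)
  then have "r \<in> R" "\<forall>i. coeff b i \<in> R"
    using a(1)[rule_format, of 0] a(1)[rule_format, of "Suc i" for i] by auto
  then show "\<exists>r\<in>R. \<exists>c\<in>adjoin R s. x = r + s * c"
    using a(2) rb by (intro bexI[of _ r] bexI[of _ "poly b s"]) (auto simp: adjoin_def)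
next
  fix c assume "c \<in> adjoin R s" and sc: "s * c \<in> R"
  then obtain a where a: "\<forall>i. coeff a i \<in> R" "c = poly a s" unfolding adjoin_def by auto
  let ?a = "pCons (- (s * c)) a"
  have "\<forall>i. coeff ?a i \<in> R" using a(1) sc R by (auto simp: coeff_pCons subalgebra_uminus split:
    nat.split)
  moreover have "poly ?a s = 0" using a by simp
  ultimately have "?a = 0" using tr unfolding transcendental_def by blast
  then show "s * c = 0" by simp
qed

text \<open>The situation of a new diamond. Modulo \<open>p\<close> the element \<open>w\<close> equals \<open>q\<close>, and \<open>R / (p)\<close> is the
  domain \<open>R0\<close>, in which \<open>q\<close> is not zero. Hence \<open>w\<close> is not a zero
  divisor modulo \<open>p\<close>.\<close>

context
  fixes R0 R :: "'k set" and p q w s :: 'k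
  assumes R0: "subalgebra R0" and R: "subalgebra R" and so: "split_off R0 R p"
    and p: "p \<in> R" "p \<noteq> 0" and q: "q \<in> R0" "q \<noteq> 0"
    and w: "w = p + q - p * q" "w \<noteq> 0" and s: "s = p / w"
begin

lemma q_R: "q \<in> R" using q so by (auto simp: split_off_def)
lemma w_R: "w \<in> R" using R p q_R unfolding w(1) by (intro subalgebra_rules)

text \<open>Reducing \<open>a p = b w\<close> modulo \<open>p\<close> gives \<open>b q = 0\<close> in \<open>R / (p)\<close>; hence \<open>p\<close> divides \<open>b\<close> and may
  be cancelled.\<close>

lemma w_coprime_p1: assumes "a \<in> R" "b \<in> R" "a * p = b * w" shows "\<exists>c\<in>R. a = w * c"
proof -
  obtain r c where rc: "r \<in> R0" "c \<in> R" "b = r + p * c" using so assms by (auto simp: split_off_def)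
  have "p * (a - b * (1 - q) - c * q) = r * q"
    using assms(3) rc(3) unfolding w(1) by (simp add: algebra_simps)
  moreover have "a - b * (1 - q) - c * q \<in> R" using assms rc R q_R
    by (intro subalgebra_rules)
  moreover have "r * q \<in> R0" using rc q R0 by (intro subalgebra_rules)
  ultimately have "r * q = 0" using so unfolding split_off_def by metis
  then have "r = 0" using q by simp
  then have "a = w * c" using assms(3) rc(3) p by simp
  then show ?thesis using rc by auto
qed

lemma w_coprime_p: assumes "a \<in> R" "b \<in> R" "a * p ^ m = b * w" shows "\<exists>c\<in>R. a = w * c"
  using assms
proof (induction m arbitrary: b)
  case 0 then show ?case by (auto simp: mult.commute)
next
  case (Suc m)
  have "a * p ^ m \<in> R" using Suc.prems R p by (intro subalgebra_rules) auto
  moreover have "(a * p ^ m) * p = b * w" using Suc.prems by (simp add: mult_ac)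
  ultimately obtain c where "c \<in> R" "a * p ^ m = w * c" using w_coprime_p1 Suc.prems(2) by metis
  then show ?case using Suc.IH[of c] Suc.prems by (simp add: mult.commute)
qed

lemma scaled_poly_mem:
  assumes "\<forall>i. coeff a i \<in> R" "degree a \<le> d"
  shows "w ^ d * poly a s \<in> R"
proof -
  have "poly a s = (\<Sum>i\<le>d. coeff a i * s ^ i)"
    unfolding poly_altdef by (rule sum.mono_neutral_left) (use assms(2) in \<open>auto simp: coeff_eq_0\<close>)
  then have "w ^ d * poly a s = (\<Sum>i\<le>d. w ^ d * (coeff a i * s ^ i))"
    by (simp add: sum_distrib_left)
  also have "\<dots> = (\<Sum>i\<le>d. coeff a i * (p ^ i * w ^ (d - i)))"
  proof (rule sum.cong[OF refl])
    fix i assume "i \<in> {..d}"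
    then have "w ^ d = w ^ i * w ^ (d - i)" by (simp flip: power_add)
    then show "w ^ d * (coeff a i * s ^ i) = coeff a i * (p ^ i * w ^ (d - i))"
      using w(2) unfolding s by (simp add: field_simps)
  qed
  finally show ?thesis using assms R p w_R by (auto intro!: subalgebra_rules)
qed

text \<open>Since \<open>p = s w\<close>, the summand \<open>p R\<close> is absorbed by \<open>s R[s]\<close>. For the intersection, clearing
  the denominators of \<open>s c = r\<close> turns it into a congruence \<open>q\<^sup>m r = 0\<close> modulo \<open>p\<close>.\<close>

lemma split_off_adjoin: "split_off R0 (adjoin R s) s"
  unfolding split_off_def
proof (intro conjI ballI impI)
  show "R0 \<subseteq> adjoin R s" using so adjoin_base[OF R] unfolding split_off_def by blast
next
  fix x assume "x \<in> adjoin R s"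
  then obtain a where a: "\<forall>i. coeff a i \<in> R" "x = poly a s" unfolding adjoin_def by auto
  obtain r b where rb: "a = pCons r b" by (cases a)
  then have "r \<in> R" and b: "\<forall>i. coeff b i \<in> R"
    using a(1)[rule_format, of 0] a(1)[rule_format, of "Suc i" for i] by auto
  then obtain r0 c where c: "r0 \<in> R0" "c \<in> R" "r = r0 + p * c" using so unfolding split_off_def by
    blast
  have "x = r0 + s * (w * c + poly b s)" using a(2) rb c w(2) by (simp add: s algebra_simps)
  moreover have "w * c + poly b s \<in> adjoin R s"
    using b c w_R R adjoin_base[OF R] subalgebra_adjoin[OF R]
    by (intro subalgebra_rules) (auto simp: adjoin_def)
  ultimately show "\<exists>r\<in>R0. \<exists>c\<in>adjoin R s. x = r + s * c" using c by blast
next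
  fix c assume "c \<in> adjoin R s" and sc: "s * c \<in> R0"
  then obtain a where a: "\<forall>i. coeff a i \<in> R" "c = poly a s" unfolding adjoin_def by auto
  define d where "d = degree a"
  define r where "r = s * c"
  have 1: "w ^ Suc d * r = p * (w ^ d * poly a s)" using w by (simp add: r_def a s)
  \<comment> \<open>\<open>w\<close> is congruent to \<open>q\<close> modulo \<open>p\<close>\<close>
  have wd: "\<exists>e\<in>R. w ^ m = q ^ m + p * e" for m
  proof (induction m)
    case (Suc m)
    then obtain e where e: "e \<in> R" "w ^ m = q ^ m + p * e" by blast
    have "w ^ Suc m = q ^ Suc m + p * (q * e + w ^ m * (1 - q))"
      unfolding power_Suc e(2) using e(2) unfolding w(1) by (simp add: algebra_simps)
    moreover have "q * e + w ^ m * (1 - q) \<in> R" using e q_R w_R R by (intro subalgebra_rules)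
    ultimately show ?case by blast
  qed (use subalgebra_0[OF R] in auto)
  obtain e where e: "e \<in> R" "w ^ Suc d = q ^ Suc d + p * e" using wd by blast
  have "p * (A - e * r) = Q * r" if "(Q + p * e) * r = p * A" for A Q
    using that by (simp add: algebra_simps)
  from this[OF 1[unfolded e(2)]] have "p * (w ^ d * poly a s - e * r) = q ^ Suc d * r" .
  moreover have "q ^ Suc d * r \<in> R0" using q sc R0 by (intro subalgebra_rules) (auto simp: r_def)
  moreover have "r \<in> R" using sc so unfolding r_def split_off_def by blast
  then have "w ^ d * poly a s - e * r \<in> R" using a e
    by (intro subalgebra_diff[OF R scaled_poly_mem] subalgebra_mult[OF R]) (auto simp: d_def)
  ultimately have "q ^ Suc d * r = 0" using so unfolding split_off_def by metis
  then show "s * c = 0" using q by (simp add: r_def)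
qed

text \<open>The relation \<open>s w = p\<close> generates all polynomial relations for \<open>s\<close>. In a relation of degree
  \<open>d + 1\<close> with leading coefficient \<open>x\<close>, clearing denominators shows that \<open>x p\<^sup>d\<^sup>+\<^sup>1\<close> is divisible
  by \<open>w\<close>, hence so is \<open>x\<close>; then \<open>x s\<^sup>d\<^sup>+\<^sup>1 = (x / w) p s\<^sup>d\<close> lowers the degree. The same reduction
  is valid for \<open>\<zeta>\<close> modulo \<open>J\<close>.\<close>

lemma separated_adjoin_quotient:
  assumes G: "subalgebra_mod G" "separated G" and dom: "\<And>x. (\<exists>a. G x a) \<longleftrightarrow> x \<in> R"
    and \<pi>: "G p \<pi>" and \<omega>: "G w \<omega>" and \<zeta>: "\<omega> * \<zeta> - \<pi> \<in> J"
  shows "separated (adjoin_mod G s \<zeta>)"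
proof -
  have main: "poly \<alpha> \<zeta> \<in> J" if "\<forall>i. G (coeff a i) (coeff \<alpha> i)" "poly a s = 0"
    "degree a \<le> d" "degree \<alpha> \<le> d" for a \<alpha> d
    using that
  proof (induction d arbitrary: a \<alpha>)
    case 0
    then obtain x b where "a = [:x:]" "\<alpha> = [:b:]" by (metis degree_eq_zeroE le_zero_eq)
    then show ?case using 0 G(2) unfolding separated_def
      by (auto simp: coeff_pCons split: nat.splits)
  next
    case (Suc d)
    define x where "x = coeff a (Suc d)"
    define \<xi> where "\<xi> = coeff \<alpha> (Suc d)"
    have aR: "\<forall>i. coeff a i \<in> R" using Suc.prems(1) dom by blast
    define t where "t = a - monom x (Suc d)"
    have t: "degree t \<le> d" "\<forall>i. coeff t i \<in> R"
    proof -
      show "degree t \<le> d" unfolding t_def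
        by (rule degree_le) (use Suc.prems(3) in \<open>auto simp: x_def coeff_eq_0\<close>)
      show "\<forall>i. coeff t i \<in> R" unfolding t_def using aR R by (auto simp: x_def intro!:
        subalgebra_rules)
    qed
    have "poly a s = poly t s + x * s ^ Suc d" by (simp add: t_def poly_monom)
    then have "x * s ^ Suc d = - poly t s" using Suc.prems(2) by (simp add: add_eq_0_iff)
    then have "w ^ Suc d * (x * s ^ Suc d) = - (w ^ d * poly t s) * w" by simp
    moreover have "w ^ Suc d * (x * s ^ Suc d) = x * p ^ Suc d"
      using w by (simp add: s power_divide)
    ultimately obtain c where c: "c \<in> R" "x = w * c"
      using w_coprime_p[of x "- (w ^ d * poly t s)" "Suc d"] aR scaled_poly_mem[OF t(2,1)] R
      by (auto simp: x_def intro!: subalgebra_uminus)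
    then obtain \<gamma> where \<gamma>: "G c \<gamma>" using dom by blast
    have "G (x - w * c) (\<xi> - \<omega> * \<gamma>)" using Suc.prems(1) \<omega> \<gamma>
      by (auto simp: x_def \<xi>_def intro!: mod_diff[OF G(1)] mod_mult[OF G(1)])
    then have xi: "\<xi> - \<omega> * \<gamma> \<in> J" using c G(2) by (simp add: separated_def)
    \<comment> \<open>one step of the reduction, in \<open>'k\<close> and in \<open>'s\<close> at the same time\<close>
    define a' where "a' = t + monom (p * c) d"
    define \<alpha>' where "\<alpha>' = \<alpha> - monom \<xi> (Suc d) + monom (\<pi> * \<gamma>) d"
    have "poly \<alpha>' \<zeta> \<in> J"
    proof (rule Suc.IH)
      show "\<forall>i. G (coeff a' i) (coeff \<alpha>' i)"
      proof
        fix i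
        have p_c: "G (p * c) (\<pi> * \<gamma>)" by (intro mod_mult[OF G(1)] \<pi> \<gamma>)
        have "G (coeff (t + monom (p * c) d) i) (coeff (\<alpha> - monom \<xi> (Suc d) + monom (\<pi> * \<gamma>) d) i)"
          using Suc.prems(1) \<pi> \<gamma> p_c unfolding t_def
          by (auto simp: x_def \<xi>_def mod_0[OF G(1)] intro!: mod_diff[OF G(1)] mod_add[OF G(1)])
        then show "G (coeff a' i) (coeff \<alpha>' i)" by (simp add: a'_def \<alpha>'_def)
      qed
      show "poly a' s = 0" using Suc.prems(2) c w
        by (simp add: a'_def t_def poly_monom s)
      show "degree a' \<le> d" unfolding a'_def by (intro degree_add_le t degree_monom_le)
      have "degree (\<alpha> - monom \<xi> (Suc d)) \<le> d"
        by (rule degree_le) (use Suc.prems(4) in \<open>auto simp: \<xi>_def coeff_eq_0\<close>)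
      then show "degree \<alpha>' \<le> d" unfolding \<alpha>'_def by (intro degree_add_le degree_monom_le)
    qed
    moreover have "poly \<alpha> \<zeta> = poly \<alpha>' \<zeta> + (\<zeta> ^ Suc d * (\<xi> - \<omega> * \<gamma>) + \<gamma> * \<zeta> ^ d * (\<omega> * \<zeta> - \<pi>))"
      by (simp add: \<alpha>'_def poly_monom algebra_simps)
    ultimately show ?case using xi \<zeta> by (simp add: J_add J_mult)
  qed
  show ?thesis unfolding separated_def
  proof (intro allI impI)
    fix b assume "adjoin_mod G s \<zeta> 0 b"
    then obtain a \<alpha> where a: "\<forall>i. G (coeff a i) (coeff \<alpha> i)" "0 = poly a s" "poly \<alpha> \<zeta> - b \<in> J"
      unfolding adjoin_mod_def by auto
    have "poly \<alpha> \<zeta> \<in> J" using main[OF a(1), of "max (degree a) (degree \<alpha>)"] a(2) by simp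
    from J_diff[OF this a(3)] show "b \<in> J" by simp
  qed
qed

end

end


section \<open>The index set in terms of column heights\<close>

text \<open>A Dyck path is encoded by the heights \<open>k i\<close> of its down steps. The value \<open>0\<close> outside of
  \<open>{1..n}\<close> makes the encoding unique and excludes diamonds there without a separate condition.\<close>

definition admissible :: "nat \<Rightarrow> (nat \<Rightarrow> nat) \<Rightarrow> bool" where
  "admissible n k \<longleftrightarrow> (\<forall>i\<in>{1..n}. i \<le> k i \<and> k i \<le> n) \<and>
     (\<forall>i j. 1 \<le> i \<longrightarrow> i \<le> j \<longrightarrow> j \<le> n \<longrightarrow> k i \<le> k j) \<and> (\<forall>i. i \<notin> {1..n} \<longrightarrow> k i = 0)"

text \<open>Incompatibility in terms of heights: the up step \<open>(a)\<close> comes before the down step \<open>(\<Sigma> b)\<close> iff \<open>a \<le> k b\<close>.\<close>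

fun clash :: "(nat \<Rightarrow> nat) \<Rightarrow> idx \<Rightarrow> idx \<Rightarrow> bool" where
  "clash k (Diam i j) (Diam a b) \<longleftrightarrow> (i < a \<and> a \<le> j \<and> j < b) \<or> (a < i \<and> i \<le> b \<and> b < j)"
| "clash k (Diam i j) (Up a) \<longleftrightarrow> i \<le> a \<and> a < j"
| "clash k (Up a) (Diam i j) \<longleftrightarrow> i \<le> a \<and> a < j"
| "clash k (Diam i j) (Down a) \<longleftrightarrow> i < a \<and> a \<le> j"
| "clash k (Down a) (Diam i j) \<longleftrightarrow> i < a \<and> a \<le> j"
| "clash k (Up a) (Down b) \<longleftrightarrow> b \<le> a \<and> a \<le> k b"
| "clash k (Down b) (Up a) \<longleftrightarrow> b \<le> a \<and> a \<le> k b"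
| "clash k (Up a) (Up b) \<longleftrightarrow> False"
| "clash k (Down a) (Down b) \<longleftrightarrow> False"

definition idxs :: "nat \<Rightarrow> (nat \<Rightarrow> nat) \<Rightarrow> idx set" where
  "idxs n k = Up ` {1..n} \<union> Down ` {1..n} \<union> {Diam i j | i j. 1 \<le> i \<and> i < j \<and> j \<le> k i}"

definition clashing :: "nat \<Rightarrow> (nat \<Rightarrow> nat) \<Rightarrow> idx \<Rightarrow> idx set" where
  "clashing n k X = {Y \<in> idxs n k. clash k X Y}"

definition u_relations :: "'s::comm_ring_1 set \<Rightarrow> nat \<Rightarrow> (nat \<Rightarrow> nat) \<Rightarrow> (idx \<Rightarrow> 's) \<Rightarrow> bool" where
  "u_relations J n k z \<longleftrightarrow> (\<forall>X\<in>idxs n k. z X + prod z (clashing n k X) - 1 \<in> J)"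

lemma idxs_simps [simp]:
  "Up a \<in> idxs n k \<longleftrightarrow> 1 \<le> a \<and> a \<le> n" "Down a \<in> idxs n k \<longleftrightarrow> 1 \<le> a \<and> a \<le> n"
  "Diam a b \<in> idxs n k \<longleftrightarrow> 1 \<le> a \<and> a < b \<and> b \<le> k a"
  by (auto simp: idxs_def)

lemma idx_set_eqI:
  assumes "\<And>a. Up a \<in> A \<longleftrightarrow> Up a \<in> B" "\<And>a. Down a \<in> A \<longleftrightarrow> Down a \<in> B"
    "\<And>a b. Diam a b \<in> A \<longleftrightarrow> Diam a b \<in> B"
  shows "A = B"
proof (rule Set.set_eqI)
  show "X \<in> A \<longleftrightarrow> X \<in> B" for X using assms by (cases X) auto
qed

lemma admissible_le: "admissible n k \<Longrightarrow> k i \<le> n"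
  unfolding admissible_def by (metis zero_le)

lemma admissible_range: "admissible n k \<Longrightarrow> 0 < k i \<Longrightarrow> 1 \<le> i \<and> i \<le> n"
  unfolding admissible_def by (metis atLeastAtMost_iff less_irrefl)

lemma admissible_mono: "admissible n k \<Longrightarrow> 1 \<le> i \<Longrightarrow> i \<le> j \<Longrightarrow> j \<le> n \<Longrightarrow> k i \<le> k j"
  unfolding admissible_def by blast

lemma admissible_ge: "admissible n k \<Longrightarrow> 1 \<le> i \<Longrightarrow> i \<le> n \<Longrightarrow> i \<le> k i"
  unfolding admissible_def by simp

lemma finite_idxs: assumes "admissible n k" shows "finite (idxs n k)"
proof -
  have "{Diam i j | i j. 1 \<le> i \<and> i < j \<and> j \<le> k i} \<subseteq> (\<lambda>(i, j). Diam i j) ` ({1..n} \<times> {1..n})"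
  proof clarify
    fix i j assume ij: "1 \<le> i" "i < j" "j \<le> k i"
    then have "i \<in> {1..n}" "k i \<le> n"
      using admissible_range[OF assms, of i] admissible_le[OF assms, of i] by auto
    then show "Diam i j \<in> (\<lambda>(i, j). Diam i j) ` ({1..n} \<times> {1..n})"
      using ij by (intro image_eqI[of _ _ "(i, j)"]) auto
  qed
  from finite_subset[OF this] show ?thesis unfolding idxs_def by simp
qed

lemma finite_clashing: "admissible n k \<Longrightarrow> finite (clashing n k X)"
  by (simp add: clashing_def finite_idxs)


section \<open>Adding a diamond\<close>

text \<open>The valley of \<open>k'\<close> at \<open>(i + 1, n - 1)\<close> becomes the peak \<open>(i, n)\<close> of \<open>k\<close>. Both paths have
  length \<open>n\<close>, so this is the top row, and only the columns from \<open>i\<close> on reach it.\<close>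

locale add_diamond =
  fixes n i :: nat and k' k :: "nat \<Rightarrow> nat"
  assumes adm': "admissible n k'" and adm: "admissible n k"
    and k: "k = k'(i := n)" and k'_i: "k' i = n - 1" and i: "1 \<le> i" "i < n"
begin

text \<open>The coordinates for \<open>k'\<close> as monomials in those for \<open>k\<close>.\<close>

definition merge :: "(idx \<Rightarrow> 'b::comm_monoid_mult) \<Rightarrow> idx \<Rightarrow> 'b" where
  "merge z X = (if X = Up n \<or> X = Down i then z X * z (Diam i n) else z X)"

lemma k_simps: "k i = n" "a \<noteq> i \<Longrightarrow> k a = k' a" by (simp_all add: k)

lemma k'_eq_n_iff: "n \<le> k' a \<longleftrightarrow> i < a \<and> a \<le> n"
proof
  assume "n \<le> k' a"
  then have "k' a = n" "a \<noteq> i" "1 \<le> a" "a \<le> n"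
    using admissible_le[OF adm', of a] k'_i i admissible_range[OF adm', of a] by auto
  then show "i < a \<and> a \<le> n" using admissible_mono[OF adm', of a i] k'_i i by (cases "a \<le> i") auto
next
  assume "i < a \<and> a \<le> n"
  then show "n \<le> k' a" using admissible_mono[OF adm, of i a] i by (auto simp: k)
qed

lemma idxs_k: "idxs n k = insert (Diam i n) (idxs n k')"
  by (rule idx_set_eqI) (use i k'_i in \<open>auto simp: k\<close>)

lemma new_notin: "Diam i n \<notin> idxs n k'" using k'_i i by simp

lemma clash_k:
  "\<not> (X = Up n \<and> Y = Down i) \<Longrightarrow> \<not> (Y = Up n \<and> X = Down i) \<Longrightarrow> X \<in> idxs n k' \<Longrightarrow> Y \<in> idxs n k' \<Longrightarrow>
    clash k X Y = clash k' X Y"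
  using i k'_i by (cases X; cases Y) (auto simp: k)

lemma not_clash_corner: "\<not> clash k' (Up n) (Down i)" "\<not> clash k' (Down i) (Up n)"
  using i k'_i by auto

text \<open>This is why the product over the incompatible indices does not change for the other
  coordinates: the new factor \<open>z (Diam i n)\<close> appears for \<open>k\<close> exactly where one of the two factors
  changed by \<open>merge\<close> appears for \<open>k'\<close>, and these never appear together.\<close>

lemma clash_new:
  assumes X: "X \<in> idxs n k'" "X \<noteq> Up n" "X \<noteq> Down i"
  shows "clash k X (Diam i n) \<longleftrightarrow> clash k' X (Up n) \<or> clash k' X (Down i)"
    and "\<not> (clash k' X (Up n) \<and> clash k' X (Down i))"
proof -
  have "clash k X (Diam i n) \<longleftrightarrow> clash k' X (Up n) \<or> clash k' X (Down i)
     \<and> \<not> (clash k' X (Up n) \<and> clash k' X (Down i))"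
  proof (cases X)
    case (Up a)
    then show ?thesis using X i k'_i by auto
  next
    case (Down a)
    then show ?thesis using X i k'_i k'_eq_n_iff[of a] by auto
  next
    case (Diam a b)
    then have "b \<le> n" using X admissible_le[OF adm', of a] by auto
    moreover have "\<not> n \<le> k' a" if "a < i" using that k'_eq_n_iff[of a] by auto
    ultimately show ?thesis using X i k'_i Diam by auto
  qed
  moreover have "\<not> (clash k' X (Up n) \<and> clash k' X (Down i))"
  proof (cases X)
    case (Diam a b)
    then have "b \<le> n" using X admissible_le[OF adm', of a] by auto
    then show ?thesis using Diam by auto
  qed auto
  ultimately show "clash k X (Diam i n) \<longleftrightarrow> clash k' X (Up n) \<or> clash k' X (Down i)"
    and "\<not> (clash k' X (Up n) \<and> clash k' X (Down i))" by blast+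
qed

lemma corner_in: "Up n \<in> idxs n k'" "Down i \<in> idxs n k'" using i by auto

lemma prod_merge:
  assumes "finite B" "\<not> (Up n \<in> B \<and> Down i \<in> B)"
  shows "prod (merge z) B = prod z B * (if Up n \<in> B \<or> Down i \<in> B then z (Diam i n) else 1)"
proof -
  have "merge z = (\<lambda>X. z X * ((if X = Up n then z (Diam i n) else 1) * (if X = Down i then z (Diam
    i n) else 1)))"
    by (auto simp: merge_def)
  then have "prod (merge z) B = prod z B * ((if Up n \<in> B then z (Diam i n) else 1) * (if Down i \<in>
    B then z (Diam i n) else 1))"
    using assms(1) by (simp add: prod.distrib)
  then show ?thesis using assms(2) by auto
qed

lemma prod_clashing_other:
  assumes X: "X \<in> idxs n k'" "X \<noteq> Up n" "X \<noteq> Down i"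
  shows "prod z (clashing n k X) = prod (merge z) (clashing n k' X)"
proof -
  have "clashing n k X = (if clash k X (Diam i n) then insert (Diam i n) (clashing n k' X) else
    clashing n k' X)"
  proof -
    have "clash k X Y = clash k' X Y" if "Y \<in> idxs n k'" for Y
      using clash_k[OF _ _ X(1) that] X(2,3) by blast
    then show ?thesis unfolding clashing_def idxs_k by (auto simp del: idxs_simps)
  qed
  moreover have "Diam i n \<notin> clashing n k' X" using new_notin by (simp add: clashing_def del:
    idxs_simps)
  moreover have "(Up n \<in> clashing n k' X \<or> Down i \<in> clashing n k' X) \<longleftrightarrow> clash k X (Diam i n)"
    "\<not> (Up n \<in> clashing n k' X \<and> Down i \<in> clashing n k' X)"
    using clash_new[OF X] corner_in by (auto simp: clashing_def)
  ultimately show ?thesis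
    using finite_clashing[OF adm', of X] by (simp add: prod_merge mult.commute)
qed

lemma clashing_Up: "clashing n k (Up n) = insert (Down i) (clashing n k' (Up n))"
  and clashing_Down: "clashing n k (Down i) = insert (Up n) (clashing n k' (Down i))"
proof -
  have "clash k (Up n) Y = clash k' (Up n) Y" if "Y \<in> idxs n k'" "Y \<noteq> Down i" for Y
    using clash_k[OF _ _ corner_in(1) that(1)] that(2) by blast
  moreover have "\<not> clash k (Up n) (Diam i n)" "clash k (Up n) (Down i)" using i by (auto simp: k)
  ultimately show "clashing n k (Up n) = insert (Down i) (clashing n k' (Up n))"
    unfolding clashing_def idxs_k using corner_in not_clash_corner by (auto simp del: idxs_simps
      clash.simps)
  have "clash k (Down i) Y = clash k' (Down i) Y" if "Y \<in> idxs n k'" "Y \<noteq> Up n" for Y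
    using clash_k[OF _ _ corner_in(2) that(1)] that(2) by blast
  moreover have "\<not> clash k (Down i) (Diam i n)" "clash k (Down i) (Up n)" using i by (auto simp: k)
  ultimately show "clashing n k (Down i) = insert (Up n) (clashing n k' (Down i))"
    unfolding clashing_def idxs_k using corner_in not_clash_corner by (auto simp del: idxs_simps
      clash.simps)
qed

lemma clashing_Up': "clashing n k' (Up n) = Down ` {i<..n}"
proof (rule idx_set_eqI)
  show "Down a \<in> clashing n k' (Up n) \<longleftrightarrow> Down a \<in> Down ` {i<..n}" for a
    using k'_eq_n_iff[of a] i by (auto simp: clashing_def)
  show "Diam a b \<in> clashing n k' (Up n) \<longleftrightarrow> Diam a b \<in> Down ` {i<..n}" for a b
    using admissible_le[OF adm', of a] by (auto simp: clashing_def)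
qed (auto simp: clashing_def)

lemma not_Up_in: "Up n \<notin> clashing n k' (Down i)" "Up n \<notin> clashing n k' (Up n)"
  and not_Down_in: "Down i \<notin> clashing n k' (Up n)" "Down i \<notin> clashing n k' (Down i)"
  using not_clash_corner by (auto simp: clashing_def)

lemma clashing_new:
  "clashing n k (Diam i n) = clashing n k' (Up n) \<union> clashing n k' (Down i)"
  "clashing n k' (Up n) \<inter> clashing n k' (Down i) = {}"
proof -
  show "clashing n k (Diam i n) = clashing n k' (Up n) \<union> clashing n k' (Down i)"
    unfolding clashing_Up'
  proof (rule idx_set_eqI)
    show "Up a \<in> clashing n k (Diam i n) \<longleftrightarrow> Up a \<in> Down ` {i<..n} \<union> clashing n k' (Down i)" for a
      using i k'_i by (auto simp: clashing_def)
    show "Down a \<in> clashing n k (Diam i n) \<longleftrightarrow> Down a \<in> Down ` {i<..n} \<union> clashing n k' (Down i)" for a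
      using i by (auto simp: clashing_def)
    show "Diam a b \<in> clashing n k (Diam i n) \<longleftrightarrow> Diam a b \<in> Down ` {i<..n} \<union> clashing n k' (Down i)"
      for a b
    proof -
      have "b \<le> n" if "b \<le> k a" using that admissible_le[OF adm, of a] by simp
      moreover have "b < n" if "a < i" "b \<le> k' a" using that k'_eq_n_iff[of a] by auto
      ultimately show ?thesis using i by (auto simp: clashing_def k split: if_splits)
    qed
  qed
  show "clashing n k' (Up n) \<inter> clashing n k' (Down i) = {}"
    unfolding clashing_Up' by (auto simp: clashing_def)
qed

lemma prod_clashing_corner:
  fixes z :: "idx \<Rightarrow> 'b::comm_monoid_mult"
  defines "P \<equiv> prod (merge z) (clashing n k' (Up n))" and "Q \<equiv> prod (merge z) (clashing n k' (Down
    i))"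
  shows "prod z (clashing n k (Up n)) = z (Down i) * P" "prod z (clashing n k (Down i)) = z (Up n)
    * Q"
    "prod z (clashing n k (Diam i n)) = P * Q"
proof -
  have "P = prod z (clashing n k' (Up n))" "Q = prod z (clashing n k' (Down i))"
    unfolding P_def Q_def using not_Up_in not_Down_in finite_clashing[OF adm']
    by (simp_all add: prod_merge)
  then show "prod z (clashing n k (Up n)) = z (Down i) * P" "prod z (clashing n k (Down i)) = z
    (Up n) * Q"
    "prod z (clashing n k (Diam i n)) = P * Q"
    using not_Up_in not_Down_in finite_clashing[OF adm'] unfolding clashing_Up clashing_Down
      clashing_new(1)
    by (simp_all add: prod.union_disjoint[OF _ _ clashing_new(2)])
qed

lemma merge_simps: "merge z (Up n) = z (Up n) * z (Diam i n)" "merge z (Down i) = z (Down i) * z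
  (Diam i n)"
  "X \<noteq> Up n \<Longrightarrow> X \<noteq> Down i \<Longrightarrow> merge z X = z X"
  by (auto simp: merge_def)

text \<open>This is applied to the elements \<open>f\<close>. In a field the coordinates at the corner are recovered
  from \<open>merge z\<close> on division by \<open>z (Diam i n)\<close>.\<close>

lemma u_relations_of_merge:
  fixes z :: "idx \<Rightarrow> 'b::field"
  assumes rel: "u_relations {0} n k' (merge z)" and w: "z (Diam i n) \<noteq> 0"
    "z (Diam i n) = merge z (Up n) + merge z (Down i) - merge z (Up n) * merge z (Down i)"
  shows "u_relations {0} n k z"
  unfolding u_relations_def
proof
  fix X assume X: "X \<in> idxs n k"
  define P where "P = prod (merge z) (clashing n k' (Up n))"
  define Q where "Q = prod (merge z) (clashing n k' (Down i))"
  note PQ = prod_clashing_corner[of z, folded P_def Q_def]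
  let ?w = "z (Diam i n)"
  have P: "P = 1 - z (Up n) * ?w" and Q: "Q = 1 - z (Down i) * ?w"
    using rel[unfolded u_relations_def, rule_format, OF corner_in(1)]
      rel[unfolded u_relations_def, rule_format, OF corner_in(2)]
    unfolding P_def Q_def by (simp_all add: merge_simps algebra_simps)
  have w': "1 = z (Up n) + z (Down i) - z (Up n) * z (Down i) * ?w"
  proof -
    have "?w * 1 = ?w * (z (Up n) + z (Down i) - z (Up n) * z (Down i) * ?w)"
      using w(2) unfolding merge_simps by (simp add: algebra_simps)
    then show ?thesis using mult_left_cancel[OF w(1)] by blast
  qed
  consider "X = Diam i n" | "X = Up n" | "X = Down i" | "X \<in> idxs n k'" "X \<noteq> Up n" "X \<noteq> Down i"
    using X idxs_k by auto
  then show "z X + prod z (clashing n k X) - 1 \<in> {0}"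
  proof cases
    case 1
    have "?w + P * Q = 1" unfolding P Q using w(2) by (simp add: merge_simps algebra_simps)
    then show ?thesis using PQ 1 by simp
  next
    case 2
    have "z (Up n) + z (Down i) * P = 1" unfolding P using w' by (simp add: algebra_simps)
    then show ?thesis using PQ 2 by simp
  next
    case 3
    have "z (Down i) + z (Up n) * Q = 1" unfolding Q using w' by (simp add: algebra_simps)
    then show ?thesis using PQ 3 by simp
  next
    case 4
    have "X \<noteq> Diam i n" using 4 new_notin by blast
    then have "z X = merge z X" using 4 by (simp add: merge_simps)
    then show ?thesis using 4 rel prod_clashing_other[of X z] by (auto simp: u_relations_def)
  qed
qed

end

context algebra_pair begin

text \<open>With \<open>x = z (Up n)\<close>, \<open>t = z (Down i)\<close> and \<open>w = z (Diam i n)\<close> the equations at the corner are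
  \<open>x + t P = 1\<close>, \<open>t + x Q = 1\<close> and \<open>w + P Q = 1\<close>. They imply \<open>x w = 1 - P\<close> and \<open>t w = 1 - Q\<close>,
  which are the equations of \<open>k'\<close> at the corner; at all other indices nothing changes.\<close>

lemma u_relations_merge:
  assumes "add_diamond n i k' k" and rel: "u_relations J n k z"
  shows "u_relations J n k' (add_diamond.merge n i z)"
    and "z (Diam i n) - (add_diamond.merge n i z (Up n) + add_diamond.merge n i z (Down i)
      - add_diamond.merge n i z (Up n) * add_diamond.merge n i z (Down i)) \<in> J"
    and "z (Down i) - (1 - z (Up n) * (1 - add_diamond.merge n i z (Down i))) \<in> J"
proof -
  interpret add_diamond n i k' k by fact
  define P where "P = prod (merge z) (clashing n k' (Up n))"
  define Q where "Q = prod (merge z) (clashing n k' (Down i))"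
  note PQ = prod_clashing_corner[of z, folded P_def Q_def]
  define x where "x = z (Up n)"
  define t where "t = z (Down i)"
  define w where "w = z (Diam i n)"
  have in_k: "Up n \<in> idxs n k" "Down i \<in> idxs n k" "Diam i n \<in> idxs n k" using idxs_k corner_in by
    auto
  have J1: "x + t * P - 1 \<in> J" and J2: "t + x * Q - 1 \<in> J" and J3: "w + P * Q - 1 \<in> J"
    using rel[unfolded u_relations_def, rule_format, OF in_k(1)] rel[unfolded u_relations_def,
      rule_format, OF in_k(2)]
      rel[unfolded u_relations_def, rule_format, OF in_k(3)] PQ by (auto simp: x_def t_def w_def)
  have "x * w + P - 1 = x * (w + P * Q - 1) - P * (t + x * Q - 1) + (x + t * P - 1)"
    by (simp add: algebra_simps)
  then have p: "x * w + P - 1 \<in> J" by (simp only:) (intro J_add J_diff J_mult J1 J2 J3)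
  have "t * w + Q - 1 = t * (w + P * Q - 1) - Q * (x + t * P - 1) + (t + x * Q - 1)"
    by (simp add: algebra_simps)
  then have q: "t * w + Q - 1 \<in> J" by (simp only:) (intro J_add J_diff J_mult J1 J2 J3)
  show "u_relations J n k' (merge z)"
    unfolding u_relations_def
  proof
    fix X assume X: "X \<in> idxs n k'"
    consider "X = Up n" | "X = Down i" | "X \<noteq> Up n" "X \<noteq> Down i" by auto
    then show "merge z X + prod (merge z) (clashing n k' X) - 1 \<in> J"
    proof cases
      case 1 then show ?thesis using p by (simp add: merge_simps x_def w_def P_def)
    next
      case 2 then show ?thesis using q by (simp add: merge_simps t_def w_def Q_def)
    next
      case 3
      then show ?thesis using rel X idxs_k prod_clashing_other[OF X, of z]
        by (auto simp: u_relations_def merge_simps)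
    qed
  qed
  have "w - (x * w + t * w - x * w * (t * w)) = (w + P * Q - 1) - (Q + t * w - 1) * P - (1 - t *
    w) * (x * w + P - 1)"
    by (simp add: algebra_simps)
  also have "\<dots> = (w + P * Q - 1) - P * (t * w + Q - 1) - (1 - t * w) * (x * w + P - 1)"
    by (simp add: algebra_simps)
  also have "\<dots> \<in> J" by (rule J_diff[OF J_diff[OF J3 J_mult[OF q]] J_mult[OF p]])
  finally show "z (Diam i n) - (merge z (Up n) + merge z (Down i) - merge z (Up n) * merge z (Down
    i)) \<in> J"
    by (simp add: merge_simps x_def t_def w_def)
  have "t - (1 - x * (1 - t * w)) = (t + x * Q - 1) - x * (t * w + Q - 1)" by (simp add:
    algebra_simps)
  also have "\<dots> \<in> J" by (rule J_diff[OF J2 J_mult[OF q]])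
  finally show "z (Down i) - (1 - z (Up n) * (1 - merge z (Down i))) \<in> J"
    by (simp add: merge_simps x_def t_def w_def)
qed

end


section \<open>Adding a peak\<close>

text \<open>The new up and down step at the end of the path are incompatible with each other and with
  nothing else.\<close>

lemma idxs_add_peak:
  assumes "admissible n k"
  shows "idxs (Suc n) (k(Suc n := Suc n)) = insert (Up (Suc n)) (insert (Down (Suc n)) (idxs n k))"
proof (rule idx_set_eqI)
  have "k (Suc n) = 0" using admissible_range[OF assms, of "Suc n"] by auto
  then show "Diam a b \<in> idxs (Suc n) (k(Suc n := Suc n)) \<longleftrightarrow>
    Diam a b \<in> insert (Up (Suc n)) (insert (Down (Suc n)) (idxs n k))" for a b by auto
qed auto

lemma clashing_add_peak:
  assumes "admissible n k"
  shows "clashing (Suc n) (k(Suc n := Suc n)) (Up (Suc n)) = {Down (Suc n)}"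
    and "clashing (Suc n) (k(Suc n := Suc n)) (Down (Suc n)) = {Up (Suc n)}"
    and "X \<in> idxs n k \<Longrightarrow> clashing (Suc n) (k(Suc n := Suc n)) X = clashing n k X"
proof -
  let ?k = "k(Suc n := Suc n)"
  have kn: "k a \<le> n" for a using admissible_le[OF assms] .
  have kb: "b \<le> n" "b < Suc n" if "b \<le> k a" for a b using kn[of a] that by auto
  have ka: "a \<le> n" if "0 < k a" for a using admissible_range[OF assms that] by simp
  have kS: "k (Suc n) = 0" using ka[of "Suc n"] by auto
  have "clash ?k (Up (Suc n)) Y \<longleftrightarrow> Y = Down (Suc n)"
    "clash ?k (Down (Suc n)) Y \<longleftrightarrow> Y = Up (Suc n)" if Y: "Y \<in> idxs (Suc n) ?k" for Y
  proof -
    consider a where "Y = Up a" "a \<le> Suc n" | a where "Y = Down a" "a \<le> Suc n" | a b where "Y =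
      Diam a b" "b \<le> n"
      using Y kb by (cases Y) (auto simp: idxs_add_peak[OF assms])
    then have "(clash ?k (Up (Suc n)) Y \<longleftrightarrow> Y = Down (Suc n)) \<and>
      (clash ?k (Down (Suc n)) Y \<longleftrightarrow> Y = Up (Suc n))"
    proof cases
      case (2 a)
      then show ?thesis using kn[of a] by auto
    qed auto
    then show "clash ?k (Up (Suc n)) Y \<longleftrightarrow> Y = Down (Suc n)"
      "clash ?k (Down (Suc n)) Y \<longleftrightarrow> Y = Up (Suc n)" by blast+
  qed
  then show "clashing (Suc n) ?k (Up (Suc n)) = {Down (Suc n)}" "clashing (Suc n) ?k (Down (Suc
    n)) = {Up (Suc n)}"
    by (auto simp: clashing_def)
  assume X: "X \<in> idxs n k"
  have 1: "\<not> clash ?k X (Up (Suc n))" "\<not> clash ?k X (Down (Suc n))"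
  proof -
    consider a where "X = Up a" "a \<le> n" | a where "X = Down a" "a \<le> n" | a b where "X = Diam a b"
      "b \<le> n"
      using X kb by (cases X) auto
    then have "\<not> clash ?k X (Up (Suc n)) \<and> \<not> clash ?k X (Down (Suc n))"
    proof cases
      case (2 a)
      then show ?thesis using kn[of a] by auto
    qed auto
    then show "\<not> clash ?k X (Up (Suc n))" "\<not> clash ?k X (Down (Suc n))" by blast+
  qed
  have 2: "clash ?k X Y \<longleftrightarrow> clash k X Y" if "Y \<in> idxs n k" for Y
    using X that by (cases X; cases Y) auto
  show "clashing (Suc n) ?k X = clashing n k X"
    unfolding clashing_def idxs_add_peak[OF assms] using 1 2 by (auto simp del: idxs_simps)
qed


section \<open>The elements f over a field\<close>

definition F_val :: "(nat \<Rightarrow> 'b::field) \<Rightarrow> nat \<Rightarrow> nat \<Rightarrow> 'b" where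
  "F_val y a b = 1 + (\<Sum>m = a..b. \<Prod>r = a..m. y r)"

text \<open>The up step \<open>(a)\<close> lies in the first column of height at least \<open>a\<close>.\<close>

definition j_of :: "(nat \<Rightarrow> nat) \<Rightarrow> nat \<Rightarrow> nat" where
  "j_of k a = (LEAST b. a \<le> k b)"

fun f_val :: "(nat \<Rightarrow> 'b::field) \<Rightarrow> (nat \<Rightarrow> nat) \<Rightarrow> idx \<Rightarrow> 'b" where
  "f_val y k (Diam i j) = (F_val y i j * F_val y (i + 1) (j - 1)) / (F_val y (i + 1) j * F_val y i
    (j - 1))"
| "f_val y k (Up i) = F_val y (j_of k i) (i - 1) / F_val y (j_of k i) i"
| "f_val y k (Down i) = y i * (F_val y (i + 1) (k i) / F_val y i (k i))"

lemma F_empty [simp]: "b < a \<Longrightarrow> F_val y a b = 1" by (simp add: F_val_def)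

text \<open>The recursion from which the \<open>u\<close>-equations follow.\<close>

lemma F_left: assumes "a \<le> b" shows "F_val y a b = 1 + y a * F_val y (Suc a) b"
proof -
  have "(\<Sum>m = a..b. \<Prod>r = a..m. y r) = y a + (\<Sum>m = Suc a..b. \<Prod>r = a..m. y r)"
    using assms by (simp add: sum.atLeast_Suc_atMost)
  also have "(\<Sum>m = Suc a..b. \<Prod>r = a..m. y r) = (\<Sum>m = Suc a..b. y a * (\<Prod>r = Suc a..m. y r))"
    by (rule sum.cong[OF refl]) (simp add: prod.atLeast_Suc_atMost)
  finally show ?thesis by (simp add: F_val_def sum_distrib_left distrib_left)
qed

lemma (in add_diamond) j_of_k:
  "a < n \<Longrightarrow> j_of k a = j_of k' a" "j_of k n = i" "j_of k' n = Suc i"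
proof -
  show "j_of k a = j_of k' a" if "a < n"
  proof -
    have "a \<le> k b \<longleftrightarrow> a \<le> k' b" for b using that k'_i by (auto simp: k)
    then show ?thesis by (simp add: j_of_def)
  qed
  have "n \<le> k b \<longleftrightarrow> i \<le> b \<and> b \<le> n" for b using i k'_eq_n_iff[of b] by (cases "b = i") (auto simp: k)
  then show "j_of k n = i" unfolding j_of_def using i by (intro Least_equality) auto
  show "j_of k' n = Suc i" unfolding j_of_def k'_eq_n_iff using i by (intro Least_equality) auto
qed

context add_diamond
begin

context
  fixes y :: "nat \<Rightarrow> 'b::field"
  assumes F_nz: "\<And>a b. F_val y a b \<noteq> 0"
begin

lemma merge_f:
  assumes X: "X \<in> idxs n k'" shows "merge (f_val y k) X = f_val y k' X"
proof -
  consider "X = Up n" | "X = Down i" | "X \<noteq> Up n" "X \<noteq> Down i" by auto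
  then show ?thesis
  proof cases
    case 1 then show ?thesis using F_nz by (simp add: merge_simps j_of_k)
  next
    case 2 then show ?thesis using F_nz by (simp add: merge_simps k_simps k'_i)
  next
    case 3 then show ?thesis using X by (cases X) (auto simp: merge_simps k_simps j_of_k)
  qed
qed

text \<open>After clearing denominators this is the identity
  \<open>F\<^sub>i\<^sub>,\<^sub>n = F\<^sub>i\<^sub>,\<^sub>n\<^sub>-\<^sub>1 + y\<^sub>i F\<^sub>i\<^sub>+\<^sub>1\<^sub>,\<^sub>n - y\<^sub>i F\<^sub>i\<^sub>+\<^sub>1\<^sub>,\<^sub>n\<^sub>-\<^sub>1\<close>.\<close>

lemma f_new: "f_val y k (Diam i n) = f_val y k' (Up n) + f_val y k' (Down i) - f_val y k' (Up n) *
  f_val y k' (Down i)"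
proof -
  define A where "A = F_val y (Suc i) n"
  define B where "B = F_val y (Suc i) (n - 1)"
  have "F_val y i n = 1 + y i * A" using i by (simp add: A_def F_left)
  moreover have C: "F_val y i (n - 1) = 1 + y i * B" using i by (simp add: B_def F_left)
  moreover have "A \<noteq> 0" "1 + y i * B \<noteq> 0" using F_nz C by (metis A_def, metis)
  moreover have "F_val y (Suc i) (n - Suc 0) = B" "F_val y i (n - Suc 0) = 1 + y i * B"
    using C by (simp_all add: B_def)
  moreover have "(1 + c * A) * B / (A * D) = B / A + c * (B / D) - B / A * (c * (B / D))"
    if "A \<noteq> 0" "D \<noteq> 0" "D = 1 + c * B" for c D
  proof -
    have "(1 + c * A) * B = B * D + c * B * A - B * (c * B)" using that(3) by (simp add:
      algebra_simps)
    moreover have "(B * D + c * B * A - B * (c * B)) / (A * D) = B / A + c * (B / D) - B / A * (c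
      * (B / D))"
      using that(1,2) by (simp add: field_simps)
    ultimately show ?thesis by simp
  qed
  ultimately show ?thesis using F_nz[of i "n - 1"]
    by (simp add: j_of_k k'_i flip: A_def)
qed

end

end

lemma f_add_peak:
  assumes "admissible n k" "X \<in> idxs n k"
  shows "f_val y (k(Suc n := Suc n)) X = f_val y k X"
proof (cases X)
  case (Up a)
  then have a: "1 \<le> a" "a \<le> n" using assms by auto
  have "j_of (k(Suc n := Suc n)) a = j_of k a"
    unfolding j_of_def
  proof (rule Least_equality)
    have "a \<le> k a" using admissible_ge[OF assms(1)] a by simp
    then have *: "a \<le> k (j_of k a)" "j_of k a \<le> a" unfolding j_of_def by (rule LeastI, rule
      Least_le)
    then show "a \<le> (k(Suc n := Suc n)) (LEAST b. a \<le> k b)" using a by (auto simp: j_of_def)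
    fix b assume "a \<le> (k(Suc n := Suc n)) b"
    then show "(LEAST b. a \<le> k b) \<le> b"
      using * a by (cases "b = Suc n") (auto simp: j_of_def intro: Least_le)
  qed
  then show ?thesis using Up by simp
next
  case (Down a)
  then show ?thesis using assms by auto
qed auto


section \<open>Evaluation of polynomials\<close>

lemma poly_mapping_as_sum: "p = (\<Sum>m\<in>Poly_Mapping.keys p. Poly_Mapping.single m
  (Poly_Mapping.lookup p m))"
  by (rule poly_mapping_eqI)
     (simp add: lookup_sum lookup_single when_def in_keys_iff sum.delta')

text \<open>\<open>g x e\<close> is the value of the variable \<open>x\<close> raised to the exponent \<open>e\<close>. Prescribing all powers
  covers nonnegative exponents as well as integer exponents, where the value must be a unit.\<close>

locale power_system =
  fixes g :: "'x \<Rightarrow> 'e::comm_semiring_1 \<Rightarrow> 'b::comm_ring_1" and c :: "complex \<Rightarrow> 'b"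
  assumes g_0: "g x 0 = 1" and g_add: "g x (a + b) = g x a * g x b"
    and c_0: "c 0 = 0" and c_1: "c 1 = 1"
    and c_add: "c (u + v) = c u + c v" and c_mult: "c (u * v) = c u * c v"
begin

definition mono_eval :: "('x \<Rightarrow>\<^sub>0 'e) \<Rightarrow> 'b" where
  "mono_eval m = (\<Prod>x\<in>Poly_Mapping.keys m. g x (Poly_Mapping.lookup m x))"

definition eval_poly :: "('x, 'e) gpoly \<Rightarrow> 'b" where
  "eval_poly p = (\<Sum>m\<in>Poly_Mapping.keys p. c (Poly_Mapping.lookup p m) * mono_eval m)"

lemma mono_eval_superset:
  "finite A \<Longrightarrow> Poly_Mapping.keys m \<subseteq> A \<Longrightarrow> mono_eval m = (\<Prod>x\<in>A. g x (Poly_Mapping.lookup m x))"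
  unfolding mono_eval_def by (rule prod.mono_neutral_left) (auto simp: in_keys_iff g_0)

lemma mono_eval_0: "mono_eval 0 = 1" by (simp add: mono_eval_def)

lemma mono_eval_add: "mono_eval (m + m') = mono_eval m * mono_eval m'"
proof -
  let ?A = "Poly_Mapping.keys m \<union> Poly_Mapping.keys m'"
  have "Poly_Mapping.keys (m + m') \<subseteq> ?A" by (rule Poly_Mapping.keys_add)
  then show ?thesis
    by (simp add: mono_eval_superset[of ?A] lookup_add g_add prod.distrib)
qed

lemma mono_eval_single: "mono_eval (Poly_Mapping.single x e) = g x e"
  by (cases "e = 0") (simp_all add: mono_eval_def g_0)

lemma eval_superset:
  "finite A \<Longrightarrow> Poly_Mapping.keys p \<subseteq> A \<Longrightarrow>
    eval_poly p = (\<Sum>m\<in>A. c (Poly_Mapping.lookup p m) * mono_eval m)"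
  unfolding eval_poly_def by (rule sum.mono_neutral_left) (auto simp: in_keys_iff c_0)

lemma eval_0: "eval_poly 0 = 0" by (simp add: eval_poly_def)

lemma eval_add: "eval_poly (p + q) = eval_poly p + eval_poly q"
proof -
  let ?A = "Poly_Mapping.keys p \<union> Poly_Mapping.keys q"
  have "Poly_Mapping.keys (p + q) \<subseteq> ?A" by (rule Poly_Mapping.keys_add)
  then show ?thesis
    by (simp add: eval_superset[of ?A] lookup_add c_add distrib_right sum.distrib)
qed

lemma eval_sum: "eval_poly (sum h A) = (\<Sum>x\<in>A. eval_poly (h x))"
  by (induction A rule: infinite_finite_induct) (auto simp: eval_0 eval_add)

lemma eval_single: "eval_poly (Poly_Mapping.single m a) = c a * mono_eval m"
  by (cases "a = 0") (simp_all add: eval_poly_def c_0)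

lemma eval_mult: "eval_poly (p * q) = eval_poly p * eval_poly q"
proof -
  have "p * q = (\<Sum>m\<in>Poly_Mapping.keys p. \<Sum>m'\<in>Poly_Mapping.keys q.
     Poly_Mapping.single (m + m') (Poly_Mapping.lookup p m * Poly_Mapping.lookup q m'))"
    by (subst poly_mapping_as_sum[of p], subst poly_mapping_as_sum[of q]) (simp add: sum_product
      mult_single)
  then have "eval_poly (p * q) = (\<Sum>m\<in>Poly_Mapping.keys p. \<Sum>m'\<in>Poly_Mapping.keys q.
     (c (Poly_Mapping.lookup p m) * mono_eval m) * (c (Poly_Mapping.lookup q m') * mono_eval m'))"
    by (simp add: eval_sum eval_single c_mult mono_eval_add mult_ac)
  then show ?thesis by (simp add: sum_product eval_poly_def)
qed

lemma eval_const: "eval_poly (poly_const a) = c a"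
  by (simp add: poly_const_def eval_single mono_eval_0)

lemma eval_var: "eval_poly (poly_var x) = g x 1"
  by (simp add: poly_var_def eval_single mono_eval_single c_1)

lemma eval_1: "eval_poly 1 = 1"
  using eval_const[of 1] by (simp add: poly_const_def c_1)

lemma eval_prod: "eval_poly (prod h A) = (\<Prod>x\<in>A. eval_poly (h x))"
  by (induction A rule: infinite_finite_induct) (auto simp: eval_1 eval_mult)

lemma eval_diff: "eval_poly (p - q) = eval_poly p - eval_poly q"
  using eval_add[of "p - q" q] by simp

end


section \<open>The field of rational functions\<close>

lemma poly_const_0: "poly_const 0 = 0" and poly_const_1: "poly_const 1 = 1"
  and poly_const_add: "poly_const (a + b) = poly_const a + poly_const b"
  and poly_const_mult: "poly_const (a * b) = poly_const a * poly_const b"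
  by (simp_all add: poly_const_def single_add mult_single)

lemma poly_const_eq_iff: "poly_const a = poly_const b \<longleftrightarrow> a = b"
  unfolding poly_const_def by (metis lookup_single_eq)

lemma rat_const_fract: "rat_const a = to_fract (poly_const a)"
  and y_var_fract: "y_var i = to_fract (poly_var i)"
  by (simp_all add: rat_const_def y_var_def to_fract_def)

lemma rat_const_hom: "rat_const 0 = 0" "rat_const 1 = 1"
  "rat_const (a + b) = rat_const a + rat_const b" "rat_const (a * b) = rat_const a * rat_const b"
  by (simp_all add: rat_const_fract poly_const_0 poly_const_1 poly_const_add poly_const_mult)

lemma rat_const_eq_0_iff: "rat_const a = 0 \<longleftrightarrow> a = 0"
  using poly_const_eq_iff[of a 0] by (simp add: rat_const_fract poly_const_0)

lemma to_fract_sum: "to_fract (sum h A) = (\<Sum>x\<in>A. to_fract (h x))"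
  by (induction A rule: infinite_finite_induct) auto

lemma to_fract_prod: "to_fract (prod h A) = (\<Prod>x\<in>A. to_fract (h x))"
  by (induction A rule: infinite_finite_induct) auto

definition F_num :: "nat \<Rightarrow> nat \<Rightarrow> (nat, nat) gpoly" where
  "F_num a b = 1 + (\<Sum>m = a..b. \<Prod>r = a..m. poly_var r)"

lemma F_fract: "F_val y_var a b = to_fract (F_num a b)"
  by (simp add: F_val_def F_num_def to_fract_sum to_fract_prod y_var_fract)

text \<open>The constant term is \<open>1\<close>.\<close>

lemma F_num_nonzero: "F_num a b \<noteq> 0"
proof
  assume eq: "F_num a b = 0"
  interpret power_system "\<lambda>(x::nat) (e::nat). (0::complex) ^ e" "\<lambda>a. a"
    by standard (auto simp: power_add)
  have "eval_poly (F_num a b) = 1"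
    by (auto simp: F_num_def eval_add eval_sum eval_prod eval_1 eval_var intro!: sum.neutral)
  then show False using eq by (simp add: eval_0)
qed

lemma F_nonzero: "F_val y_var a b \<noteq> 0" by (simp add: F_fract F_num_nonzero)

lemma y_var_nonzero: "y_var i \<noteq> 0"
proof -
  have "poly_var i \<noteq> (0 :: (nat, nat) gpoly)"
    unfolding poly_var_def by (metis lookup_single_eq lookup_zero zero_neq_one)
  then show ?thesis by (simp add: y_var_fract)
qed

lemma f_nonzero: "f_val y_var k X \<noteq> 0"
  by (cases X) (simp_all add: F_nonzero y_var_nonzero)

definition subst_var :: "nat \<Rightarrow> complex \<Rightarrow> (nat, nat) gpoly \<Rightarrow> (nat, nat) gpoly" where
  "subst_var j l = power_system.eval_poly (\<lambda>i e. if i = j then poly_const l ^ e else poly_var i ^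
    e) poly_const"

lemma subst_var_hom:
  "subst_var j l (p + q) = subst_var j l p + subst_var j l q"
  "subst_var j l (p * q) = subst_var j l p * subst_var j l q"
  "subst_var j l (poly_const a) = poly_const a"
  "subst_var j l (poly_var i) = (if i = j then poly_const l else poly_var i)"
  "subst_var j l 0 = 0" "subst_var j l 1 = 1"
proof -
  interpret power_system "\<lambda>i (e::nat). if i = j then poly_const l ^ e else poly_var i ^ e"
    "poly_const :: complex \<Rightarrow> (nat, nat) gpoly"
    by standard (auto simp: power_add poly_const_0 poly_const_1 poly_const_add poly_const_mult)
  show "subst_var j l (p + q) = subst_var j l p + subst_var j l q"
  "subst_var j l (p * q) = subst_var j l p * subst_var j l q"
  "subst_var j l (poly_const a) = poly_const a"
  "subst_var j l (poly_var i) = (if i = j then poly_const l else poly_var i)"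
  "subst_var j l 0 = 0" "subst_var j l 1 = 1"
    unfolding subst_var_def by (simp_all add: eval_add eval_mult eval_const eval_var eval_0 eval_1)
qed

text \<open>Polynomials that do not involve the variable \<open>j\<close>, characterized by substitution so that
  closure under the ring operations is immediate.\<close>

definition free_of :: "nat \<Rightarrow> (nat, nat) gpoly set" where
  "free_of j = {p. \<forall>l. subst_var j l p = p}"

lemma free_of_rules:
  "p \<in> free_of j \<Longrightarrow> q \<in> free_of j \<Longrightarrow> p + q \<in> free_of j"
  "p \<in> free_of j \<Longrightarrow> q \<in> free_of j \<Longrightarrow> p * q \<in> free_of j"
  "poly_const a \<in> free_of j" "i \<noteq> j \<Longrightarrow> poly_var i \<in> free_of j" "0 \<in> free_of j" "1 \<in> free_of j"
  by (simp_all add: free_of_def subst_var_hom)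

lemma free_of_sum: "(\<And>x. x \<in> A \<Longrightarrow> h x \<in> free_of j) \<Longrightarrow> sum h A \<in> free_of j"
  by (induction A rule: infinite_finite_induct) (auto simp: free_of_rules)

lemma free_of_prod: "(\<And>x. x \<in> A \<Longrightarrow> h x \<in> free_of j) \<Longrightarrow> prod h A \<in> free_of j"
  by (induction A rule: infinite_finite_induct) (auto simp: free_of_rules)

definition fract_free_of :: "nat \<Rightarrow> ratfun set" where
  "fract_free_of j = {to_fract p / to_fract q | p q. p \<in> free_of j \<and> q \<in> free_of j \<and> q \<noteq> 0}"

lemma fract_free_ofI: "p \<in> free_of j \<Longrightarrow> q \<in> free_of j \<Longrightarrow> q \<noteq> 0 \<Longrightarrow> to_fract p / to_fract q \<in>
  fract_free_of j"
  unfolding fract_free_of_def by blast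

lemma fract_free_of_rules:
  assumes "x \<in> fract_free_of j" "y \<in> fract_free_of j"
  shows "x + y \<in> fract_free_of j" "x * y \<in> fract_free_of j" "x / y \<in> fract_free_of j"
proof -
  obtain p q r s where *: "p \<in> free_of j" "q \<in> free_of j" "q \<noteq> 0" "r \<in> free_of j" "s \<in> free_of j"
    "s \<noteq> 0"
    "x = to_fract p / to_fract q" "y = to_fract r / to_fract s"
    using assms unfolding fract_free_of_def by blast
  have "x + y = to_fract (p * s + r * q) / to_fract (q * s)" using * by (simp add: field_simps)
  also have "\<dots> \<in> fract_free_of j" using * by (intro fract_free_ofI free_of_rules) auto
  finally show "x + y \<in> fract_free_of j" .
  have "x * y = to_fract (p * r) / to_fract (q * s)" using * by simp
  also have "\<dots> \<in> fract_free_of j" using * by (intro fract_free_ofI free_of_rules) auto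
  finally show "x * y \<in> fract_free_of j" .
  show "x / y \<in> fract_free_of j"
  proof (cases "r = 0")
    case True
    then show ?thesis using * fract_free_ofI[of 0 j 1] by (simp add: free_of_rules)
  next
    case False
    have "x / y = to_fract (p * s) / to_fract (q * r)" using * False by simp
    also have "\<dots> \<in> fract_free_of j" using * False by (intro fract_free_ofI free_of_rules) auto
    finally show ?thesis .
  qed
qed

lemma fract_free_of_base: "p \<in> free_of j \<Longrightarrow> to_fract p \<in> fract_free_of j"
  using fract_free_ofI[of p j 1] by (simp add: free_of_rules)

lemma f_fract_free_of:
  assumes "admissible n k" "X \<in> idxs n k" "n < j"
  shows "f_val y_var k X \<in> fract_free_of j"
proof -
  have F: "F_val y_var a b \<in> fract_free_of j" if "b \<le> n" for a b
  proof -
    have "F_num a b \<in> free_of j"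
      unfolding F_num_def using that assms(3) by (auto intro!: free_of_rules free_of_sum
        free_of_prod)
    then show ?thesis unfolding F_fract by (rule fract_free_of_base)
  qed
  have y: "y_var a \<in> fract_free_of j" if "a \<le> n" for a
    unfolding y_var_fract using that assms(3) by (auto intro!: fract_free_of_base free_of_rules)
  have k: "b \<le> n" if "b \<le> k a" for a b using that admissible_le[OF assms(1), of a] by simp
  show ?thesis
  proof (cases X)
    case (Diam a b)
    then have "b \<le> n" using assms(2) k by auto
    then show ?thesis unfolding Diam f_val.simps by (intro fract_free_of_rules F) auto
  qed (use assms(2) F y admissible_le[OF assms(1)] in \<open>auto intro!: fract_free_of_rules\<close>)
qed

lemma common_denominator:
  assumes "\<forall>i. coeff a i \<in> fract_free_of j"
  shows "\<exists>B A. B \<in> free_of j \<and> B \<noteq> 0 \<and> (\<forall>i. coeff A i \<in> free_of j) \<and>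
    smult (to_fract B) a = fract_poly A"
  using assms
proof (induction a)
  case 0
  then show ?case by (intro exI[of _ 1] exI[of _ 0]) (simp add: free_of_rules)
next
  case (pCons x a)
  have x: "x \<in> fract_free_of j" and a: "\<forall>i. coeff a i \<in> fract_free_of j"
    using pCons.prems[rule_format, of 0] pCons.prems[rule_format, of "Suc i" for i] by auto
  obtain B A where BA: "B \<in> free_of j" "B \<noteq> 0" "\<forall>i. coeff A i \<in> free_of j"
    "smult (to_fract B) a = fract_poly A" using pCons.IH[OF a] by blast
  obtain p q where pq: "p \<in> free_of j" "q \<in> free_of j" "q \<noteq> 0" "x = to_fract p / to_fract q"
    using x unfolding fract_free_of_def by blast
  have "smult (to_fract (B * q)) (pCons x a) = pCons (to_fract (B * p)) (smult (to_fract q) (smult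
    (to_fract B) a))"
    using pq by (simp add: mult.commute)
  also have "\<dots> = fract_poly (pCons (B * p) (smult q A))"
    unfolding BA(4) by (simp add: map_poly_pCons fract_poly_smult)
  finally show ?case using BA pq
    by (intro exI[of _ "B * q"] exI[of _ "pCons (B * p) (smult q A)"])
       (auto simp: coeff_pCons intro!: free_of_rules split: nat.split)
qed

lemma subst_var_poly:
  assumes "\<forall>i. coeff A i \<in> free_of j"
  shows "subst_var j l (poly A v) = poly A (subst_var j l v)"
  using assms
proof (induction A)
  case (pCons x A)
  have x: "x \<in> free_of j" and a: "\<forall>i. coeff A i \<in> free_of j"
    using pCons.prems[rule_format, of 0] pCons.prems[rule_format, of "Suc i" for i] by auto
  then show ?case using pCons.IH by (simp add: subst_var_hom free_of_def)
qed (simp add: subst_var_hom)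

lemma to_fract_poly: "to_fract (poly A v) = poly (fract_poly A) (to_fract v)"
  by (induction A) (simp_all add: map_poly_pCons)

text \<open>Clear denominators and reverse the polynomial: then \<open>1 + y\<^sub>j\<close> is a root of a polynomial over
  the polynomials free of \<open>y\<^sub>j\<close>. Substituting constants for \<open>y\<^sub>j\<close> produces infinitely many roots.\<close>

lemma inverse_one_plus_y_transcendental:
  assumes a: "\<forall>i. coeff a i \<in> fract_free_of j" and root: "poly a (1 / (1 + y_var j)) = 0"
  shows "a = 0"
proof -
  obtain B A where BA: "B \<in> free_of j" "B \<noteq> 0" "\<forall>i. coeff A i \<in> free_of j"
    "smult (to_fract B) a = fract_poly A" using common_denominator[OF a] by blast
  define v :: "(nat, nat) gpoly" where "v = 1 + poly_var j"
  have v: "1 + y_var j = to_fract v" by (simp add: v_def y_var_fract)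
  have "subst_var j 0 v = 1" by (simp add: v_def subst_var_hom poly_const_0)
  then have "v \<noteq> 0" by (metis subst_var_hom(5) zero_neq_one)
  have "poly (fract_poly A) (inverse (to_fract v)) = 0"
    using root unfolding BA(4)[symmetric] v by (simp add: divide_inverse)
  then have "poly (reflect_poly (fract_poly A)) (to_fract v) = 0"
    using \<open>v \<noteq> 0\<close> by (simp add: poly_reflect_poly_nz)
  moreover have "reflect_poly (fract_poly A) = fract_poly (reflect_poly A)"
    by (rule poly_eqI) (simp add: coeff_reflect_poly coeff_map_poly degree_map_poly)
  ultimately have 0: "poly (reflect_poly A) v = 0" by (metis to_fract_poly to_fract_eq_0_iff)
  \<comment> \<open>substitute \<open>l\<close> for \<open>y\<^sub>j\<close>; the coefficients do not change\<close>
  have "poly (reflect_poly A) (poly_const (1 + l)) = 0" for l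
  proof -
    have "\<forall>i. coeff (reflect_poly A) i \<in> free_of j" using BA(3) by (simp add: coeff_reflect_poly
      free_of_rules)
    from subst_var_poly[OF this, of l v] have "poly (reflect_poly A) (subst_var j l v) = 0"
      unfolding 0 subst_var_hom(5) by simp
    then show ?thesis by (simp add: v_def subst_var_hom poly_const_add poly_const_1)
  qed
  then have "poly (reflect_poly A) (poly_const l) = 0" for l
    by (metis add.commute diff_add_cancel)
  then have "range poly_const \<subseteq> {x. poly (reflect_poly A) x = 0}" by auto
  moreover have "infinite (range (poly_const :: complex \<Rightarrow> (nat, nat) gpoly))"
    using finite_imageD[of poly_const "UNIV :: complex set"] infinite_UNIV_char_0
    by (auto simp: inj_on_def poly_const_eq_iff)
  ultimately have "reflect_poly A = 0" using poly_roots_finite finite_subset by blast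
  then have "A = 0" by simp
  then show "a = 0" using BA by simp
qed


section \<open>The u-equations generate all relations\<close>

locale ratfun_pair = algebra_pair rat_const cS J for cS :: "complex \<Rightarrow> 's::comm_ring_1" and J
begin

abbreviation fy :: "(nat \<Rightarrow> nat) \<Rightarrow> idx \<Rightarrow> ratfun" where "fy \<equiv> f_val y_var"

text \<open>Every solution of the \<open>u\<close>-equations modulo \<open>J\<close> is the image of the solution given by the
  elements \<open>f\<close>, under a homomorphism on the ring generated by them. The quantification over all
  \<open>z\<close> is needed for the induction, since \<open>merge\<close> changes \<open>z\<close>.\<close>

definition presented :: "nat \<Rightarrow> (nat \<Rightarrow> nat) \<Rightarrow> bool" where
  "presented n k \<longleftrightarrow> u_relations {0} n k (fy k) \<and>
     (\<forall>z. u_relations J n k z \<longrightarrow> separated (joint (idxs n k) (fy k) z))"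

lemma separated_mono: "separated G' \<Longrightarrow> (\<And>x a. G x a \<Longrightarrow> G' x a) \<Longrightarrow> separated G"
  unfolding separated_def by blast

lemma presented_0: assumes "admissible 0 k" shows "presented 0 k"
proof -
  have idxs: "idxs 0 k = {}" using admissible_le[OF assms] by (auto simp: idxs_def)
  have "a \<in> J" if "joint {} (fy k) z 0 a" for z :: "idx \<Rightarrow> 's" and a
  proof -
    have "\<exists>u. 0 = rat_const u \<and> a - cS u \<in> J"
    proof (rule joint_least[OF _ _ that, of "\<lambda>x a. \<exists>u. x = rat_const u \<and> a - cS u \<in> J"])
      show "subalgebra_mod (\<lambda>x a. \<exists>u. x = rat_const u \<and> a - cS u \<in> J)"
        unfolding subalgebra_mod_def
      proof (intro conjI allI impI)
        fix u show "\<exists>v. rat_const u = rat_const v \<and> cS u - cS v \<in> J" using J_0 by (intro exI[of _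
          u]) simp
      next
        fix x y :: ratfun and a b
        assume "\<exists>u. x = rat_const u \<and> a - cS u \<in> J" "\<exists>u. y = rat_const u \<and> b - cS u \<in> J"
        then obtain u v where uv: "x = rat_const u" "a - cS u \<in> J" "y = rat_const v" "b - cS v \<in>
          J" by blast
        have "a + b - cS (u + v) = (a - cS u) + (b - cS v)" by (simp add: cS_add)
        also have "\<dots> \<in> J" using uv J_add by blast
        finally show "\<exists>u. x + y = rat_const u \<and> a + b - cS u \<in> J"
          using uv by (intro exI[of _ "u + v"]) (simp add: rat_const_hom)
        have "a * b - cS (u * v) = b * (a - cS u) + cS u * (b - cS v)" by (simp add: cS_mult
          algebra_simps)
        also have "\<dots> \<in> J" using uv by (intro J_add J_mult)
        finally show "\<exists>u. x * y = rat_const u \<and> a * b - cS u \<in> J"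
          using uv by (intro exI[of _ "u * v"]) (simp add: rat_const_hom)
      next
        fix x :: ratfun and a b
        assume "\<exists>u. x = rat_const u \<and> a - cS u \<in> J" "a - b \<in> J"
        then obtain u where u: "x = rat_const u" "a - cS u \<in> J" by blast
        have "b - cS u = (a - cS u) - (a - b)" by simp
        also have "\<dots> \<in> J" using u \<open>a - b \<in> J\<close> J_diff by blast
        finally show "\<exists>u. x = rat_const u \<and> b - cS u \<in> J" using u by blast
      qed
    qed auto
    then show ?thesis using rat_const_eq_0_iff cS_0 by auto
  qed
  then show ?thesis unfolding presented_def idxs separated_def by (auto simp: u_relations_def idxs)
qed

text \<open>The new up step contributes the transcendental element \<open>s = 1 / (1 + y\<^sub>n\<^sub>+\<^sub>1)\<close> and the new
  down step \<open>1 - s\<close>.\<close>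

lemma presented_add_peak:
  assumes k: "admissible n k" and pres: "presented n k"
  defines "k1 \<equiv> k(Suc n := Suc n)"
  assumes k1: "admissible (Suc n) k1"
  shows "presented (Suc n) k1"
    and "split_off (alg (idxs n k) (fy k)) (alg (idxs (Suc n) k1) (fy k1)) (fy k1 (Up (Suc n)))"
proof -
  define R0 where "R0 = alg (idxs n k) (fy k)"
  define s where "s = 1 / (1 + y_var (Suc n))"
  have R0: "subalgebra R0" by (simp add: R0_def subalgebra_alg)
  have nz: "1 + y_var (Suc n) \<noteq> 0" using F_nonzero[of "Suc n" "Suc n"] by (simp add: F_left)
  have "Suc n \<le> k1 b \<longleftrightarrow> b = Suc n" for b
    using admissible_le[OF k, of b] by (auto simp: k1_def)
  then have "j_of k1 (Suc n) = Suc n" unfolding j_of_def by (intro Least_equality) auto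
  then have up: "fy k1 (Up (Suc n)) = s" and down: "fy k1 (Down (Suc n)) = 1 - s"
    using nz by (simp_all add: k1_def s_def F_left field_simps)
  have other: "fy k1 X = fy k X" if "X \<in> idxs n k" for X
    unfolding k1_def using f_add_peak[OF k that] .
  note idxs1 = idxs_add_peak[OF k, folded k1_def]
  note clash1 = clashing_add_peak[OF k, folded k1_def]
  have tr: "transcendental R0 s"
    unfolding transcendental_def
  proof (intro allI impI)
    fix a assume a: "\<forall>i. coeff a i \<in> R0" and root: "poly a s = 0"
    have "R0 \<subseteq> fract_free_of (Suc n)" unfolding R0_def
    proof (rule alg_least)
      show "subalgebra (fract_free_of (Suc n))" unfolding subalgebra_def
        by (auto simp: fract_free_of_rules rat_const_fract intro!: fract_free_of_base free_of_rules)
      show "fy k X \<in> fract_free_of (Suc n)" if "X \<in> idxs n k" for X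
        using f_fract_free_of[OF k that] by simp
    qed
    then show "a = 0" using inverse_one_plus_y_transcendental[of a "Suc n"] a root by (auto simp:
      s_def)
  qed
  have alg1: "alg (idxs (Suc n) k1) (fy k1) = adjoin R0 s"
  proof
    note sub = subalgebra_adjoin[OF R0, of s]
    show "alg (idxs (Suc n) k1) (fy k1) \<subseteq> adjoin R0 s"
    proof (rule alg_least[OF sub])
      fix X assume "X \<in> idxs (Suc n) k1"
      then consider "X = Up (Suc n)" | "X = Down (Suc n)" | "X \<in> idxs n k" unfolding idxs1 by blast
      then show "fy k1 X \<in> adjoin R0 s"
      proof cases
        case 3
        then show ?thesis using adjoin_base[OF R0] by (simp add: other R0_def alg_gen)
      qed (use adjoin_self[OF R0] sub in \<open>auto simp: up down simp del: f_val.simps intro!: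
        subalgebra_rules\<close>)
    qed
    have "R0 \<subseteq> alg (idxs (Suc n) k1) (fy k1)"
      unfolding R0_def
    proof (rule alg_least[OF subalgebra_alg])
      fix X assume "X \<in> idxs n k"
      then show "fy k X \<in> alg (idxs (Suc n) k1) (fy k1)"
        using alg_gen[of X "idxs (Suc n) k1" "fy k1"] idxs1 other[of X] by auto
    qed
    moreover have "s \<in> alg (idxs (Suc n) k1) (fy k1)"
      using alg_gen[of "Up (Suc n)" "idxs (Suc n) k1" "fy k1"] unfolding idxs1 up by blast
    ultimately show "adjoin R0 s \<subseteq> alg (idxs (Suc n) k1) (fy k1)"
      by (intro adjoin_least subalgebra_alg)
  qed
  show "split_off (alg (idxs n k) (fy k)) (alg (idxs (Suc n) k1) (fy k1)) (fy k1 (Up (Suc n)))"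
    unfolding alg1 up R0_def[symmetric] by (rule split_off_transcendental[OF R0 tr])
  show "presented (Suc n) k1"
    unfolding presented_def
  proof (intro conjI allI impI)
    show "u_relations {0} (Suc n) k1 (fy k1)"
      unfolding u_relations_def
    proof
      fix X assume "X \<in> idxs (Suc n) k1"
      then consider "X = Up (Suc n)" | "X = Down (Suc n)" | "X \<in> idxs n k" unfolding idxs1 by blast
      then show "fy k1 X + prod (fy k1) (clashing (Suc n) k1 X) - 1 \<in> {0}"
      proof cases
        case 3
        have "prod (fy k1) (clashing n k X) = prod (fy k) (clashing n k X)"
          by (rule prod.cong) (auto simp: other clashing_def)
        then show ?thesis using pres 3 by (simp add: clash1 other presented_def u_relations_def)
      qed (simp_all add: clash1 up down del: f_val.simps)
    qed
    fix z :: "idx \<Rightarrow> 's" assume z: "u_relations J (Suc n) k1 z"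
    let ?G = "joint (idxs n k) (fy k) z"
    have z0: "u_relations J n k z" using z unfolding u_relations_def idxs1 by (simp add: clash1)
    then have sep: "separated ?G" using pres by (simp add: presented_def)
    show "separated (joint (idxs (Suc n) k1) (fy k1) z)"
    proof (rule separated_mono)
      show "separated (adjoin_mod ?G s (z (Up (Suc n))))"
        by (rule separated_adjoin_transcendental[OF subalgebra_mod_joint sep tr])
           (use joint_dom R0_def in blast)
      note sub = subalgebra_mod_adjoin[OF subalgebra_mod_joint, of "idxs n k" "fy k" z s "z (Up
        (Suc n))"]
      note self = adjoin_mod_self[OF subalgebra_mod_joint, of "idxs n k" "fy k" z s "z (Up (Suc
        n))"]
      show "adjoin_mod ?G s (z (Up (Suc n))) x a" if "joint (idxs (Suc n) k1) (fy k1) z x a" for x a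
      proof (rule joint_least[OF sub _ that])
        fix X assume "X \<in> idxs (Suc n) k1"
        then consider "X = Up (Suc n)" | "X = Down (Suc n)" | "X \<in> idxs n k" unfolding idxs1 by
          blast
        then show "adjoin_mod ?G s (z (Up (Suc n))) (fy k1 X) (z X)"
        proof cases
          case 1
          show ?thesis unfolding 1 up by (rule self)
        next
          case 2
          have "z (Up (Suc n)) + z (Down (Suc n)) - 1 \<in> J"
            using z unfolding u_relations_def idxs1 by (simp add: clash1)
          from J_uminus[OF this] have "(1 - z (Up (Suc n))) - z (Down (Suc n)) \<in> J" by (simp add:
            algebra_simps)
          from mod_shift[OF sub mod_diff[OF sub mod_1[OF sub] self] this] show ?thesis
            unfolding 2 down .
        next
          case 3
          then show ?thesis unfolding other[OF 3]
            by (intro adjoin_mod_base subalgebra_mod_joint joint_gen)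
        qed
      qed
    qed
  qed
qed

text \<open>The ring for \<open>k\<close> is \<open>R[s]\<close>, with \<open>R\<close> the ring for \<open>k'\<close>; an arbitrary solution \<open>z\<close> for \<open>k\<close>
  restricts to the solution \<open>merge z\<close> for \<open>k'\<close>, and \<open>z\<close> at the three indices of the corner is
  expressed through \<open>merge z\<close> and \<open>z (Up n)\<close> by the same formulas as \<open>f\<close>.\<close>

lemma presented_add_diamond:
  assumes ad: "add_diamond n i k' k" and pres: "presented n k'"
    and R0: "subalgebra R0" "split_off R0 (alg (idxs n k') (fy k')) (fy k' (Up n))" "fy k' (Down
      i) \<in> R0"
  shows "presented n k" "split_off R0 (alg (idxs n k) (fy k)) (fy k (Up n))"
proof -
  interpret add_diamond n i k' k by fact
  define R where "R = alg (idxs n k') (fy k')"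
  define p where "p = fy k' (Up n)"
  define q where "q = fy k' (Down i)"
  define w where "w = fy k (Diam i n)"
  define s where "s = fy k (Up n)"
  have mf: "merge (fy k) X = fy k' X" if "X \<in> idxs n k'" for X by (rule merge_f[OF F_nonzero that])
  have nz: "p \<noteq> 0" "q \<noteq> 0" "w \<noteq> 0" unfolding p_def q_def w_def by (rule f_nonzero)+
  have w: "w = p + q - p * q" unfolding p_def q_def w_def by (rule f_new[OF F_nonzero])
  have sw: "s * w = p" and tw: "fy k (Down i) * w = q"
    using mf[OF corner_in(1)] mf[OF corner_in(2)] by (simp_all only: merge_simps p_def q_def w_def
      s_def)
  have s: "s = p / w" using sw nz by (simp add: field_simps)
  have t: "fy k (Down i) = 1 - s * (1 - q)"
  proof -
    have "(1 - s * (1 - q)) * w = w - (s * w) * (1 - q)" by (simp add: algebra_simps)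
    also have "\<dots> = q" unfolding sw by (simp add: w algebra_simps)
    also have "\<dots> = fy k (Down i) * w" by (simp only: tw)
    finally show ?thesis using nz(3) by (metis mult_right_cancel)
  qed
  have R: "subalgebra R" by (simp add: R_def subalgebra_alg)
  have pR: "p \<in> R" unfolding p_def R_def using corner_in by (rule_tac alg_gen)
  have qR: "q \<in> R" unfolding q_def R_def using corner_in by (rule_tac alg_gen)
  have wR: "w \<in> R" unfolding w using pR qR R by (intro subalgebra_rules)
  have so: "split_off R0 R p" "q \<in> R0" using R0 by (simp_all only: R_def p_def q_def)
  note step = R0(1) R so(1) pR nz(1) so(2) nz(2) w nz(3) s
  have cases: "X = Up n \<or> X = Down i \<or> X = Diam i n \<or> (X \<in> idxs n k' \<and> X \<noteq> Up n \<and> X \<noteq> Down i)"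
    if "X \<in> idxs n k" for X using that unfolding idxs_k by blast
  have other: "fy k X = fy k' X" if "X \<in> idxs n k'" "X \<noteq> Up n" "X \<noteq> Down i" for X
    using mf[OF that(1)] merge_simps(3)[OF that(2,3), of "fy k"] by simp
  have alg_k: "alg (idxs n k) (fy k) = adjoin R s"
  proof
    note sub = subalgebra_adjoin[OF R, of s]
    note base = adjoin_base[OF R, of _ s]
    show "alg (idxs n k) (fy k) \<subseteq> adjoin R s"
    proof (rule alg_least[OF sub])
      fix X assume X: "X \<in> idxs n k"
      consider "X = Up n" | "X = Down i" | "X = Diam i n" | "X \<in> idxs n k'" "X \<noteq> Up n" "X \<noteq> Down i"
        using cases[OF X] by blast
      then show "fy k X \<in> adjoin R s"
      proof cases
        case 1 then show ?thesis using adjoin_self[OF R] s_def by simp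
      next
        case 2
        have "1 - s * (1 - q) \<in> adjoin R s" using adjoin_self[OF R] base[OF qR] sub by (intro
          subalgebra_rules)
        then show ?thesis unfolding 2 t .
      next
        case 3 then show ?thesis using base[OF wR] w_def by simp
      next
        case 4
        then show ?thesis unfolding other[OF 4] R_def by (intro adjoin_base subalgebra_alg alg_gen)
      qed
    qed
    have "R \<subseteq> alg (idxs n k) (fy k)"
      unfolding R_def
    proof (rule alg_least[OF subalgebra_alg])
      fix X assume X: "X \<in> idxs n k'"
      then have "X \<in> idxs n k" "Diam i n \<in> idxs n k" by (simp_all only: idxs_k insertI1 insertI2)
      then have "fy k X \<in> alg (idxs n k) (fy k)" "fy k X * fy k (Diam i n) \<in> alg (idxs n k) (fy k)"
        by (simp_all only: alg_gen alg_mult)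
      then have "merge (fy k) X \<in> alg (idxs n k) (fy k)" unfolding merge_def by metis
      then show "fy k' X \<in> alg (idxs n k) (fy k)" unfolding mf[OF X] .
    qed
    moreover have "s \<in> alg (idxs n k) (fy k)"
      unfolding s_def by (rule alg_gen) (use corner_in idxs_k in blast)
    ultimately show "adjoin R s \<subseteq> alg (idxs n k) (fy k)"
      by (intro adjoin_least subalgebra_alg)
  qed
  show "split_off R0 (alg (idxs n k) (fy k)) (fy k (Up n))"
    unfolding alg_k s_def[symmetric] by (rule split_off_adjoin[OF step])
  show "presented n k"
    unfolding presented_def
  proof (intro conjI allI impI)
    have "u_relations {0} n k' (merge (fy k)) \<longleftrightarrow> u_relations {0} n k' (fy k')"
    proof -
      have "prod (merge (fy k)) (clashing n k' X) = prod (fy k') (clashing n k' X)" for X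
        by (rule prod.cong[OF refl]) (rule mf, simp add: clashing_def)
      then show ?thesis unfolding u_relations_def by (intro ball_cong refl) (simp only: mf)
    qed
    then have "u_relations {0} n k' (merge (fy k))" using pres by (simp add: presented_def)
    moreover have "fy k (Diam i n) = merge (fy k) (Up n) + merge (fy k) (Down i) - merge (fy k)
      (Up n) * merge (fy k) (Down i)"
      using w unfolding mf[OF corner_in(1)] mf[OF corner_in(2)] p_def q_def w_def .
    ultimately show "u_relations {0} n k (fy k)"
      by (rule u_relations_of_merge[OF _ f_nonzero])
    fix z :: "idx \<Rightarrow> 's" assume z: "u_relations J n k z"
    note zm = u_relations_merge[OF ad z]
    define G where "G = joint (idxs n k') (fy k') (merge z)"
    have G: "subalgebra_mod G" unfolding G_def by (rule subalgebra_mod_joint)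
    have sep: "separated G" using pres zm(1) unfolding G_def by (simp add: presented_def)
    have Gp: "G p (merge z (Up n))" and Gq: "G q (merge z (Down i))"
      unfolding p_def q_def G_def by (intro joint_gen corner_in)+
    define \<omega> where "\<omega> = merge z (Up n) + merge z (Down i) - merge z (Up n) * merge z (Down i)"
    have Gw: "G w \<omega>" unfolding w \<omega>_def
      by (intro mod_diff[OF G] mod_add[OF G] mod_mult[OF G] Gp Gq)
    have wz: "\<omega> - z (Diam i n) \<in> J" using J_uminus[OF zm(2)] by (simp add: \<omega>_def)
    let ?A = "adjoin_mod G s (z (Up n))"
    show "separated (joint (idxs n k) (fy k) z)"
    proof (rule separated_mono)
      show "separated ?A"
      proof (rule separated_adjoin_quotient[OF step G sep _ Gp Gw])
        show "(\<exists>a. G x a) \<longleftrightarrow> x \<in> R" for x unfolding G_def R_def by (rule joint_dom)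
        have "\<omega> * z (Up n) - merge z (Up n) = z (Up n) * (\<omega> - z (Diam i n))"
          by (simp add: merge_simps algebra_simps)
        then show "\<omega> * z (Up n) - merge z (Up n) \<in> J" using wz by (simp add: J_mult)
      qed
      note sub = subalgebra_mod_adjoin[OF G, of s "z (Up n)"]
      note self = adjoin_mod_self[OF G, of s "z (Up n)"]
      note base = adjoin_mod_base[OF G, of _ _ s "z (Up n)"]
      show "?A x a" if "joint (idxs n k) (fy k) z x a" for x a
      proof (rule joint_least[OF sub _ that])
        fix X assume X: "X \<in> idxs n k"
        consider "X = Up n" | "X = Down i" | "X = Diam i n" | "X \<in> idxs n k'" "X \<noteq> Up n" "X \<noteq> Down
          i"
          using cases[OF X] by blast
        then show "?A (fy k X) (z X)"
        proof cases
          case 1 then show ?thesis using self s_def by simp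
        next
          case 2
          have "?A (1 - s * (1 - q)) (1 - z (Up n) * (1 - merge z (Down i)))"
            by (intro mod_diff[OF sub] mod_mult[OF sub] mod_1[OF sub] self base Gq)
          moreover have "(1 - z (Up n) * (1 - merge z (Down i))) - z (Down i) \<in> J"
            using J_uminus[OF zm(3)] by simp
          ultimately show ?thesis unfolding 2 t by (rule mod_shift[OF sub])
        next
          case 3
          have "?A w (z (Diam i n))" by (rule mod_shift[OF sub base[OF Gw] wz])
          then show ?thesis unfolding 3 w_def .
        next
          case 4
          have "G (fy k' X) (merge z X)" unfolding G_def by (intro joint_gen 4)
          then show ?thesis using base 4 by (simp add: other merge_simps)
        qed
      qed
    qed
  qed
qed

text \<open>The path \<open>k\<close> is reached from its truncation \<open>k0\<close> to the first \<open>n\<close> columns and rows through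
  the paths \<open>kk i\<close>, in which the columns from \<open>i\<close> on have full height \<open>n + 1\<close>; here \<open>i\<close> descends
  from \<open>n + 1\<close> to the first column \<open>i0\<close> where \<open>k\<close> has that height. The element \<open>q\<close> of the step at
  \<open>i\<close> is the value of \<open>f\<close> at a down step of \<open>k0\<close>, hence lies in \<open>R0\<close>.\<close>

theorem presented: "admissible n k \<Longrightarrow> presented n k"
proof (induction n arbitrary: k)
  case 0 then show ?case by (rule presented_0)
next
  case (Suc n)
  note k = Suc.prems
  define k0 where "k0 = (\<lambda>a. if a \<le> n then min (k a) n else 0)"
  \<comment> \<open>the paths between the truncation, with a peak appended, and \<open>k\<close>\<close>
  define kk where "kk = (\<lambda>i a. if i \<le> a \<and> a \<le> Suc n then Suc n else k0 a)"
  have ge: "a \<le> k a" if "1 \<le> a" "a \<le> Suc n" for a using admissible_ge[OF k] that .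
  have zero: "k a = 0" if "a \<notin> {1..Suc n}" for a using k that unfolding admissible_def by blast
  have le: "k a \<le> Suc n" for a using admissible_le[OF k] .
  have mono: "k a \<le> k b" if "1 \<le> a" "a \<le> b" "b \<le> Suc n" for a b using admissible_mono[OF k that] .
  have adm0: "admissible n k0" unfolding admissible_def
  proof (intro conjI ballI allI impI)
    fix i j assume "1 \<le> i" "i \<le> j" "j \<le> n"
    then show "k0 i \<le> k0 j" using mono[of i j] by (auto simp: k0_def)
  next
    fix i assume "i \<notin> {1..n}"
    then show "k0 i = 0" using zero[of 0] by (cases "i = 0") (auto simp: k0_def)
  qed (use ge in \<open>auto simp: k0_def\<close>)
  have adm: "admissible (Suc n) (kk i)" if "1 \<le> i" "i \<le> Suc n" for i unfolding admissible_def
  proof (intro conjI ballI allI impI)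
    fix a assume "a \<in> {1..Suc n}"
    then show "a \<le> kk i a" "kk i a \<le> Suc n" using that ge[of a] by (auto simp: kk_def k0_def)
  next
    fix a b assume ab: "1 \<le> a" "a \<le> b" "b \<le> Suc n"
    have "k0 c \<le> n" for c by (simp add: k0_def)
    then have "k0 c \<le> Suc n" for c by (meson le_SucI)
    moreover have "k0 a \<le> k0 b" if "b \<le> n" using ab that mono[of a b] by (auto simp: k0_def)
    ultimately show "kk i a \<le> kk i b" using ab that by (auto simp: kk_def)
  next
    fix a assume "a \<notin> {1..Suc n}"
    then show "kk i a = 0" using that zero[of 0] by (cases "a = 0") (auto simp: kk_def k0_def)
  qed
  define R0 where "R0 = alg (idxs n k0) (fy k0)"
  define i0 where "i0 = j_of k (Suc n)"
  have i0: "1 \<le> i0" "i0 \<le> Suc n" "k i0 = Suc n" "\<And>a. a < i0 \<Longrightarrow> k a \<le> n"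
  proof -
    have ex: "Suc n \<le> k (Suc n)" using ge[of "Suc n"] by simp
    have *: "Suc n \<le> k i0" unfolding i0_def j_of_def using ex by (rule LeastI)
    then show "k i0 = Suc n" using le[of i0] by simp
    then show "1 \<le> i0" using zero[of 0] by (cases i0) auto
    show "i0 \<le> Suc n" unfolding i0_def j_of_def using ex by (rule Least_le)
    show "k a \<le> n" if "a < i0" for a using not_less_Least that unfolding i0_def j_of_def by
      fastforce
  qed
  have "presented (Suc n) (kk i0) \<and> split_off R0 (alg (idxs (Suc n) (kk i0)) (fy (kk i0))) (fy (kk
    i0) (Up (Suc n)))"
    using i0(2)
  proof (induction rule: inc_induct)
    case base
    have "kk (Suc n) = k0(Suc n := Suc n)" by (auto simp: kk_def fun_eq_iff)
    then show ?case using presented_add_peak[OF adm0 Suc.IH[OF adm0]] adm[of "Suc n"]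
      unfolding R0_def by (metis le_add1 le_refl plus_1_eq_Suc)
  next
    case (step i)
    then have i: "1 \<le> i" "i \<le> n" using i0(1) by auto
    have k0i: "k0 i = n" using mono[of i0 i] i0 step i by (simp add: k0_def)
    have kki: "kk (Suc i) i = n" using k0i by (simp add: kk_def)
    have ad: "add_diamond (Suc n) i (kk (Suc i)) (kk i)"
    proof
      show "admissible (Suc n) (kk (Suc i))" "admissible (Suc n) (kk i)" using adm[of i] adm[of
        "Suc i"] i by auto
      show "kk i = (kk (Suc i))(i := Suc n)" using i by (auto simp: kk_def fun_eq_iff)
    qed (use kki i in auto)
    have "fy (kk (Suc i)) (Down i) = fy k0 (Down i)" using kki k0i by simp
    moreover have "fy k0 (Down i) \<in> R0" unfolding R0_def by (rule alg_gen) (use i in simp)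
    ultimately have q: "fy (kk (Suc i)) (Down i) \<in> R0" by simp
    have "subalgebra R0" by (simp add: R0_def subalgebra_alg)
    then show ?case using presented_add_diamond[OF ad _ _ _ q] step.IH by blast
  qed
  moreover have "kk i0 = k"
  proof
    fix a
    consider "i0 \<le> a \<and> a \<le> Suc n" | "a < i0" | "Suc n < a" by linarith
    then show "kk i0 a = k a"
    proof cases
      case 1
      then show ?thesis using mono[of i0 a] i0 le[of a] by (simp add: kk_def)
    next
      case 2
      then show ?thesis using i0 by (simp add: kk_def k0_def)
    next
      case 3
      then show ?thesis using zero[of a] by (simp add: kk_def k0_def)
    qed
  qed
  ultimately show ?case by simp
qed

end


section \<open>Column heights of a Dyck path\<close>

definition steps_before :: "step list \<Rightarrow> step \<Rightarrow> nat \<Rightarrow> nat" where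
  "steps_before D s t = count_list (take t D) s"

lemma steps_before_Suc:
  "t < length D \<Longrightarrow> steps_before D s (Suc t) = steps_before D s t + (if D ! t = s then 1 else 0)"
  by (simp add: steps_before_def take_Suc_conv_app_nth)

lemma steps_before_mono: assumes "t \<le> t'" shows "steps_before D s t \<le> steps_before D s t'"
proof -
  have "take t' D = take t D @ take (t' - t) (drop t D)"
    using assms by (metis le_add_diff_inverse take_add)
  then show ?thesis by (simp add: steps_before_def)
qed

text \<open>Needed for the definite descriptions in \<open>up_pos\<close> and \<open>down_pos\<close>.\<close>

lemma ex1_step:
  assumes "m < steps_before D s (length D)"
  shows "\<exists>!t. t < length D \<and> D ! t = s \<and> steps_before D s t = m"
proof (rule ex_ex1I)
  let ?P = "\<lambda>t. m < steps_before D s t"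
  define t where "t = (LEAST t. ?P t)"
  have t: "?P t" unfolding t_def by (rule LeastI[of ?P, OF assms])
  have le: "t \<le> length D" unfolding t_def by (rule Least_le[of ?P, OF assms])
  have "t \<noteq> 0" using t by (intro notI) (simp add: steps_before_def)
  then obtain r where r: "t = Suc r" by (cases t) auto
  then have "\<not> ?P r" using not_less_Least[of r ?P] unfolding t_def by simp
  then show "\<exists>t. t < length D \<and> D ! t = s \<and> steps_before D s t = m"
    using t le steps_before_Suc[of r D s] r by (intro exI[of _ r]) (auto split: if_splits)
next
  fix t t' assume *: "t < length D \<and> D ! t = s \<and> steps_before D s t = m"
    "t' < length D \<and> D ! t' = s \<and> steps_before D s t' = m"
  have "\<not> t < t'" if *: "t < length D \<and> D ! t = s \<and> steps_before D s t = m"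
    "t' < length D \<and> D ! t' = s \<and> steps_before D s t' = m" for t t'
    using * steps_before_mono[of "Suc t" t' D s] steps_before_Suc[of t D s] by auto
  from this[of t t'] this[of t' t] * show "t = t'" by linarith
qed

lemma vertex_steps: "vertex D t = (1 + steps_before D D_step t, steps_before D U_step t)"
  by (simp add: vertex_def steps_before_def)

definition heights :: "nat \<Rightarrow> step list \<Rightarrow> nat \<Rightarrow> nat" where
  "heights n D i = (if 1 \<le> i \<and> i \<le> n then k_coord D i else 0)"

context
  fixes n D assumes D: "dyck_path n D"
begin

lemma steps_total: "steps_before D s (length D) = n"
  using D by (cases s) (auto simp: dyck_path_def vertex_steps)

lemma steps_le: "steps_before D s t \<le> n"
proof (cases "t \<le> length D")
  case True then show ?thesis using steps_before_mono[OF True, of D s] steps_total by simp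
next
  case False then show ?thesis using steps_total[of s] by (simp add: steps_before_def)
qed

lemma dyck_above: "t \<le> length D \<Longrightarrow> steps_before D D_step t \<le> steps_before D U_step t"
  using D by (auto simp: dyck_path_def vertex_steps)

lemma up_pos:
  assumes "1 \<le> i" "i \<le> n"
  shows "up_pos D i < length D" "D ! up_pos D i = U_step" "steps_before D U_step (up_pos D i) = i
    - 1"
proof -
  let ?P = "\<lambda>t. t < length D \<and> D ! t = U_step \<and> steps_before D U_step t = i - 1"
  have "?P (THE t. ?P t)" by (rule theI'[of ?P], rule ex1_step) (use assms in \<open>simp add:
    steps_total\<close>)
  moreover have "up_pos D i = (THE t. ?P t)"
    unfolding up_pos_def vertex_steps by (rule arg_cong[where f = The]) (use assms in \<open>auto simp:
      fun_eq_iff\<close>)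
  ultimately show "up_pos D i < length D" "D ! up_pos D i = U_step"
    "steps_before D U_step (up_pos D i) = i - 1" by simp_all
qed

lemma down_pos:
  assumes "1 \<le> i" "i \<le> n"
  shows "down_pos D i < length D" "D ! down_pos D i = D_step" "steps_before D D_step (down_pos D
    i) = i - 1"
proof -
  let ?P = "\<lambda>t. t < length D \<and> D ! t = D_step \<and> steps_before D D_step t = i - 1"
  have "?P (THE t. ?P t)" by (rule theI'[of ?P], rule ex1_step) (use assms in \<open>simp add:
    steps_total\<close>)
  moreover have "down_pos D i = (THE t. ?P t)"
    unfolding down_pos_def vertex_steps by (rule arg_cong[where f = The]) (use assms in \<open>auto
      simp: fun_eq_iff\<close>)
  ultimately show "down_pos D i < length D" "D ! down_pos D i = D_step"
    "steps_before D D_step (down_pos D i) = i - 1" by simp_all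
qed

lemma heights_eq: "1 \<le> i \<Longrightarrow> i \<le> n \<Longrightarrow> heights n D i = steps_before D U_step (down_pos D i)"
  by (simp add: heights_def k_coord_def vertex_steps)

lemma down_pos_mono: assumes "1 \<le> i" "i \<le> j" "j \<le> n" shows "down_pos D i \<le> down_pos D j"
proof (rule ccontr)
  assume "\<not> ?thesis"
  then have "steps_before D D_step (Suc (down_pos D j)) \<le> steps_before D D_step (down_pos D i)"
    by (intro steps_before_mono) simp
  then show False using down_pos[of i] down_pos[of j] assms by (simp add: steps_before_Suc)
qed

lemma admissible_heights: "admissible n (heights n D)"
  unfolding admissible_def
proof (intro conjI ballI allI impI)
  fix i assume i: "i \<in> {1..n}"
  show "heights n D i \<le> n" using i by (simp add: heights_eq steps_le)
  have "steps_before D D_step (Suc (down_pos D i)) \<le> steps_before D U_step (Suc (down_pos D i))"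
    by (rule dyck_above) (use down_pos[of i] i in simp)
  then show "i \<le> heights n D i" using down_pos[of i] i by (simp add: steps_before_Suc heights_eq)
next
  fix i j assume "1 \<le> i" "i \<le> j" "j \<le> n"
  then show "heights n D i \<le> heights n D j"
    by (simp add: heights_eq steps_before_mono down_pos_mono)
qed (auto simp: heights_def)

lemma down_before_up:
  assumes "1 \<le> i" "i \<le> n" "1 \<le> j" "j \<le> n"
  shows "down_pos D j < up_pos D i \<longleftrightarrow> heights n D j < i"
proof
  assume "down_pos D j < up_pos D i"
  then have "steps_before D U_step (down_pos D j) \<le> steps_before D U_step (up_pos D i)"
    by (intro steps_before_mono) simp
  then show "heights n D j < i" using up_pos[of i] assms by (simp add: heights_eq)
next
  assume less: "heights n D j < i"
  show "down_pos D j < up_pos D i"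
  proof (rule ccontr)
    assume "\<not> ?thesis"
    moreover have "down_pos D j \<noteq> up_pos D i" using up_pos[of i] down_pos[of j] assms by auto
    ultimately have "steps_before D U_step (Suc (up_pos D i)) \<le> steps_before D U_step (down_pos D
      j)"
      by (intro steps_before_mono) simp
    then show False using less up_pos[of i] assms by (simp add: steps_before_Suc heights_eq)
  qed
qed

text \<open>The abscissa of \<open>(i)\<close> is one more than the number of down steps before it, and a down step
  is before \<open>(i)\<close> iff its height is less than \<open>i\<close>.\<close>

lemma j_coord_heights: assumes i: "1 \<le> i" "i \<le> n" shows "j_coord D i = j_of (heights n D) i"
proof -
  let ?b = "1 + steps_before D D_step (up_pos D i)"
  have "steps_before D D_step (up_pos D i) \<le> i - 1"
    using dyck_above[of "up_pos D i"] up_pos[OF i] by simp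
  then have b: "1 \<le> ?b" "?b \<le> n" using i by auto
  have "(LEAST b. i \<le> heights n D b) = ?b"
  proof (rule Least_equality)
    have "\<not> down_pos D ?b < up_pos D i"
    proof
      assume "down_pos D ?b < up_pos D i"
      then have "steps_before D D_step (Suc (down_pos D ?b)) \<le> steps_before D D_step (up_pos D i)"
        by (intro steps_before_mono) simp
      then show False using down_pos[OF b] by (simp add: steps_before_Suc)
    qed
    then show "i \<le> heights n D ?b" using down_before_up[OF i b] by simp
    fix c assume c: "i \<le> heights n D c"
    then have cn: "1 \<le> c" "c \<le> n" using i by (auto simp: heights_def split: if_splits)
    then have "\<not> down_pos D c < up_pos D i" using down_before_up[OF i cn] c by simp
    then have "steps_before D D_step (up_pos D i) \<le> steps_before D D_step (down_pos D c)"
      by (intro steps_before_mono) simp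
    then show "?b \<le> c" using down_pos[OF cn] cn by simp
  qed
  then show ?thesis by (simp add: j_coord_def vertex_steps j_of_def)
qed

lemma index_set_idxs: "index_set n D = idxs n (heights n D)"
proof (rule idx_set_eqI)
  fix a b
  show "Diam a b \<in> index_set n D \<longleftrightarrow> Diam a b \<in> idxs n (heights n D)"
    using admissible_le[OF admissible_heights, of a]
    by (auto simp: index_set_def on_or_below_def heights_def)
qed (auto simp: index_set_def)

lemma interval_compatible:
  assumes "i < j" "a < (b::nat)"
  shows "{i..j} \<subseteq> {a..b} \<or> {a..b} \<subseteq> {i..j} \<or> {i..j} \<inter> {a..b} = {} \<longleftrightarrow>
    \<not> (i < a \<and> a \<le> j \<and> j < b \<or> a < i \<and> i \<le> b \<and> b < j)"
proof -
  have "{i..j} \<inter> {a..b} = {} \<longleftrightarrow> j < a \<or> b < i" using assms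
  proof -
    have "{i..j} \<inter> {a..b} = {max i a..min j b}" by auto
    then show ?thesis using assms by auto
  qed
  then show ?thesis using assms by auto
qed

lemma compatible_clash:
  assumes "X \<in> index_set n D" "Y \<in> index_set n D"
  shows "compatible D X Y \<longleftrightarrow> \<not> clash (heights n D) X Y"
proof (cases X)
  case (Diam i j)
  then show ?thesis using assms interval_compatible[of i j]
    by (cases Y) (auto simp: index_set_idxs simp del: atLeastatMost_subset_iff)
next
  case (Up i)
  then show ?thesis using assms by (cases Y) (auto simp: index_set_idxs down_before_up)
next
  case (Down i)
  then show ?thesis using assms by (cases Y) (auto simp: index_set_idxs down_before_up)
qed

lemma incompatibles_clashing:
  "X \<in> index_set n D \<Longrightarrow> incompatibles n D X = clashing n (heights n D) X"
  using compatible_clash[of X] by (auto simp: incompatibles_def clashing_def index_set_idxs)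

lemma F_poly_F_val: "1 \<le> a \<Longrightarrow> b \<le> n \<Longrightarrow> F_poly n a b = F_val y_var a b"
  by (simp add: F_poly_def F_val_def)

lemma f_elem_f_val:
  assumes X: "X \<in> index_set n D" shows "f_elem n D X = f_val y_var (heights n D) X"
proof (cases X)
  case (Diam i j)
  then show ?thesis using X admissible_le[OF admissible_heights, of i] by (auto simp:
    index_set_idxs F_poly_F_val)
next
  case (Up i)
  then have i: "1 \<le> i" "i \<le> n" using X by (auto simp: index_set_idxs)
  then have "1 \<le> j_coord D i" by (simp add: j_coord_def vertex_steps)
  then show ?thesis using Up i F_poly_F_val[of "j_coord D i" i] F_poly_F_val[of "j_coord D i" "i -
    1"]
    by (simp add: j_coord_heights)
next
  case (Down i)
  then have i: "1 \<le> i" "i \<le> n" using X by (auto simp: index_set_idxs)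
  then have "k_coord D i = heights n D i" by (simp add: heights_def)
  then show ?thesis using Down i admissible_le[OF admissible_heights, of i] by (simp add:
    F_poly_F_val)
qed

end


section \<open>Rings of polynomials and Laurent polynomials\<close>

lemma cring_ring_on:
  assumes "0 \<in> S" "1 \<in> S" "\<And>x y. x \<in> S \<Longrightarrow> y \<in> S \<Longrightarrow> x + y \<in> S"
    "\<And>x y. x \<in> S \<Longrightarrow> y \<in> S \<Longrightarrow> x * y \<in> S" "\<And>x. x \<in> S \<Longrightarrow> - x \<in> S"
  shows "cring (ring_on S)"
proof (rule cringI)
  show "abelian_group (ring_on S)"
  proof (rule abelian_groupI)
    fix x assume "x \<in> carrier (ring_on S)"
    then show "\<exists>y\<in>carrier (ring_on S). y \<oplus>\<^bsub>ring_on S\<^esub> x = \<zero>\<^bsub>ring_on S\<^esub>"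
      using assms(5)[of x] by (intro bexI[of _ "- x"]) (auto simp: ring_on_def)
  qed (use assms in \<open>auto simp: ring_on_def algebra_simps\<close>)
  show "comm_monoid (ring_on S)"
    by (rule comm_monoidI) (use assms in \<open>auto simp: ring_on_def algebra_simps\<close>)
qed (auto simp: ring_on_def algebra_simps)

lemma ring_on_simps [simp]:
  "carrier (ring_on S) = S" "x \<otimes>\<^bsub>ring_on S\<^esub> y = x * y" "x \<oplus>\<^bsub>ring_on S\<^esub> y = x + y"
  "\<one>\<^bsub>ring_on S\<^esub> = 1" "\<zero>\<^bsub>ring_on S\<^esub> = 0"
  by (simp_all add: ring_on_def)

definition poly_carrier :: "'x set \<Rightarrow> ('x, 'e::comm_semiring_1) gpoly set" where
  "poly_carrier V = {p. \<forall>m \<in> Poly_Mapping.keys p. Poly_Mapping.keys m \<subseteq> V}"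

lemma poly_ring_carrier: "poly_ring V = ring_on (poly_carrier V)"
  by (simp add: poly_ring_def poly_carrier_def)

lemma poly_carrier_single:
  "Poly_Mapping.keys m \<subseteq> V \<Longrightarrow> Poly_Mapping.single m a \<in> poly_carrier V"
  by (auto simp: poly_carrier_def)

lemma poly_carrier_const: "poly_const a \<in> poly_carrier V"
  by (simp add: poly_const_def poly_carrier_single)

lemma poly_carrier_gen: "X \<in> V \<Longrightarrow> Poly_Mapping.single (Poly_Mapping.single X e) 1 \<in> poly_carrier V"
  by (rule poly_carrier_single) (auto split: if_splits)

lemma poly_carrier_var: "X \<in> V \<Longrightarrow> poly_var X \<in> poly_carrier V"
  unfolding poly_var_def by (rule poly_carrier_gen)

lemma poly_carrier_0: "0 \<in> poly_carrier V" and poly_carrier_1: "1 \<in> poly_carrier V"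
  using poly_carrier_const[of 0 V] poly_carrier_const[of 1 V]
  by (simp_all add: poly_const_0 poly_const_1)

lemma poly_carrier_add: "p \<in> poly_carrier V \<Longrightarrow> q \<in> poly_carrier V \<Longrightarrow> p + q \<in> poly_carrier V"
  unfolding poly_carrier_def using Poly_Mapping.keys_add[of p q] by blast

lemma poly_carrier_mult:
  assumes "p \<in> poly_carrier V" "q \<in> poly_carrier V" shows "p * q \<in> poly_carrier V"
  unfolding poly_carrier_def
proof (intro CollectI ballI)
  fix m assume "m \<in> Poly_Mapping.keys (p * q)"
  then obtain a b where "m = a + b" "a \<in> Poly_Mapping.keys p" "b \<in> Poly_Mapping.keys q"
    using Poly_Mapping.keys_mult[of p q] by blast
  then show "Poly_Mapping.keys m \<subseteq> V"
    using assms Poly_Mapping.keys_add[of a b] unfolding poly_carrier_def by blast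
qed

lemma poly_carrier_uminus: "p \<in> poly_carrier V \<Longrightarrow> - p \<in> poly_carrier V"
  using poly_carrier_mult[OF poly_carrier_const[of "-1" V], of p]
  by (simp add: poly_const_def single_uminus)

lemma poly_carrier_diff: "p \<in> poly_carrier V \<Longrightarrow> q \<in> poly_carrier V \<Longrightarrow> p - q \<in> poly_carrier V"
  using poly_carrier_add[of p V "- q"] poly_carrier_uminus[of q V] by simp

lemma poly_carrier_sum: "(\<And>x. x \<in> A \<Longrightarrow> h x \<in> poly_carrier V) \<Longrightarrow> sum h A \<in> poly_carrier V"
  by (induction A rule: infinite_finite_induct) (auto simp: poly_carrier_0 poly_carrier_add)

lemma poly_carrier_prod: "(\<And>x. x \<in> A \<Longrightarrow> h x \<in> poly_carrier V) \<Longrightarrow> prod h A \<in> poly_carrier V"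
  by (induction A rule: infinite_finite_induct) (auto simp: poly_carrier_1 poly_carrier_mult)

lemma poly_carrier_power: "p \<in> poly_carrier V \<Longrightarrow> p ^ d \<in> poly_carrier V"
  by (induction d) (auto simp: poly_carrier_1 poly_carrier_mult)

lemma cring_poly_ring: "cring (poly_ring V)"
  unfolding poly_ring_carrier
  by (intro cring_ring_on poly_carrier_0 poly_carrier_1 poly_carrier_add poly_carrier_mult
    poly_carrier_uminus)

lemma single_as_prod:
  "Poly_Mapping.single m (1::complex) =
    (\<Prod>x\<in>Poly_Mapping.keys m. Poly_Mapping.single (Poly_Mapping.single x (Poly_Mapping.lookup m x))
      1)"
  for m :: "'x \<Rightarrow>\<^sub>0 'e::comm_semiring_1"
proof -
  have single: "Poly_Mapping.single (a + b) (1::complex) = Poly_Mapping.single a 1 *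
    Poly_Mapping.single b 1"
    for a b :: "'x \<Rightarrow>\<^sub>0 'e" by (simp add: mult_single)
  have "Poly_Mapping.single (sum h A) (1::complex) = (\<Prod>x\<in>A. Poly_Mapping.single (h x) 1)"
    for h :: "'x \<Rightarrow> 'x \<Rightarrow>\<^sub>0 'e" and A
    by (induction A rule: infinite_finite_induct) (auto simp: single)
  then show ?thesis by (subst poly_mapping_as_sum[of m])
qed

lemma poly_carrier_induct [consumes 1, case_names const gen add mult]:
  assumes p: "p \<in> poly_carrier V"
    and const: "\<And>a. P (poly_const a)"
    and gen: "\<And>X e. X \<in> V \<Longrightarrow> P (Poly_Mapping.single (Poly_Mapping.single X e) 1)"
    and add: "\<And>p q. p \<in> poly_carrier V \<Longrightarrow> q \<in> poly_carrier V \<Longrightarrow> P p \<Longrightarrow> P q \<Longrightarrow> P (p + q)"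
    and mult: "\<And>p q. p \<in> poly_carrier V \<Longrightarrow> q \<in> poly_carrier V \<Longrightarrow> P p \<Longrightarrow> P q \<Longrightarrow> P (p * q)"
  shows "P p"
proof -
  have 0: "P 0" and 1: "P 1" using const[of 0] const[of 1] by (simp_all add: poly_const_0
    poly_const_1)
  have prod: "P (prod h A) \<and> prod h A \<in> poly_carrier V"
    if "\<And>x. x \<in> A \<Longrightarrow> P (h x) \<and> h x \<in> poly_carrier V" for h and A :: "'a set"
    using that by (induction A rule: infinite_finite_induct)
      (auto simp: 1 poly_carrier_1 poly_carrier_mult mult)
  have sum: "P (sum h A) \<and> sum h A \<in> poly_carrier V"
    if "\<And>x. x \<in> A \<Longrightarrow> P (h x) \<and> h x \<in> poly_carrier V" for h and A :: "('a \<Rightarrow>\<^sub>0 'b) set"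
    using that by (induction A rule: infinite_finite_induct)
      (auto simp: 0 poly_carrier_0 poly_carrier_add add)
  have single: "P (Poly_Mapping.single m a) \<and> Poly_Mapping.single m a \<in> poly_carrier V"
    if "Poly_Mapping.keys m \<subseteq> V" for m a
  proof -
    have "P (Poly_Mapping.single m 1)" unfolding single_as_prod[of m]
      by (rule conjunct1, rule prod) (use that in \<open>auto intro!: gen poly_carrier_gen\<close>)
    then have "P (poly_const a * Poly_Mapping.single m 1)"
      by (intro mult const poly_carrier_const poly_carrier_single that)
    then show ?thesis using that by (simp add: poly_const_def mult_single poly_carrier_single)
  qed
  have "P (\<Sum>m\<in>Poly_Mapping.keys p. Poly_Mapping.single m (Poly_Mapping.lookup p m))"
    by (rule conjunct1, rule sum, rule single) (use p in \<open>auto simp: poly_carrier_def\<close>)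
  then show "P p" by (subst poly_mapping_as_sum[of p])
qed

text \<open>Set the variables outside of \<open>V\<close> to \<open>1\<close>; being a unit, \<open>1\<close> may also replace a variable of a
  Laurent polynomial.\<close>

lemma poly_carrier_retract:
  "\<exists>\<rho> :: ('x, 'e::comm_semiring_1) gpoly \<Rightarrow> ('x, 'e) gpoly.
    (\<forall>p q. \<rho> (p + q) = \<rho> p + \<rho> q \<and> \<rho> (p * q) = \<rho> p * \<rho> q) \<and>
    (\<forall>p. \<rho> p \<in> poly_carrier V) \<and> (\<forall>p\<in>poly_carrier V. \<rho> p = p)"
proof -
  interpret power_system "\<lambda>X (e::'e). if X \<in> V then Poly_Mapping.single (Poly_Mapping.single X e)
    1 else 1"
    "poly_const :: complex \<Rightarrow> ('x, 'e) gpoly"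
    by standard (auto simp: single_add mult_single poly_const_0 poly_const_1 poly_const_add
      poly_const_mult)
  have "eval_poly p \<in> poly_carrier V" for p
    unfolding eval_poly_def mono_eval_def
    by (intro poly_carrier_sum poly_carrier_mult poly_carrier_prod poly_carrier_const)
       (auto intro: poly_carrier_gen poly_carrier_1)
  moreover have "eval_poly p = p" if "p \<in> poly_carrier V" for p
    using that by (induction rule: poly_carrier_induct)
      (auto simp: eval_const eval_add eval_mult eval_single mono_eval_single poly_const_1)
  ultimately show ?thesis using eval_add eval_mult by (intro exI[of _ eval_poly]) auto
qed


section \<open>Coordinate rings and their complex points\<close>

text \<open>Common setting for \<open>U\<close> (natural exponents) and the very affine variety (integer exponents,
  \<open>laurent\<close>). The last two assumptions express that every power of a variable is a natural power
  of it or the inverse of one, the latter only in the Laurent case, where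
  the variables are units.\<close>

locale u_coordinates =
  fixes n :: nat and D :: "step list" and laurent :: bool
    and pwK :: "ratfun \<Rightarrow> 'e::comm_semiring_1 \<Rightarrow> ratfun" and pwC :: "complex \<Rightarrow> 'e \<Rightarrow> complex"
  assumes dyck: "dyck_path n D"
    and pwK: "pwK x 0 = 1" "pwK x 1 = x" "x \<noteq> 0 \<Longrightarrow> pwK x (a + b) = pwK x a * pwK x b"
    and pwC: "pwC u 0 = 1" "pwC u 1 = u" "laurent \<longrightarrow> u \<noteq> 0 \<Longrightarrow> pwC u (a + b) = pwC u a * pwC u b"
    and gen_power: "\<exists>d. Poly_Mapping.single (Poly_Mapping.single X a) 1 = (poly_var X ^ d :: (idx,
      'e) gpoly) \<or>
      laurent \<and> Poly_Mapping.single (Poly_Mapping.single X a) 1 * poly_var X ^ d = (1 :: (idx, 'e)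
        gpoly)"
    and var_inverse: "laurent \<Longrightarrow>
      \<exists>a. Poly_Mapping.single (Poly_Mapping.single X a) 1 * poly_var X = (1 :: (idx, 'e) gpoly)"
begin

abbreviation "V \<equiv> index_set n D"
abbreviation "k \<equiv> heights n D"
abbreviation "C \<equiv> poly_carrier V :: (idx, 'e) gpoly set"
abbreviation "I \<equiv> u_ideal n D :: (idx, 'e) gpoly set"
abbreviation "R_gens \<equiv> f_elem n D ` V \<union> (if laurent then (\<lambda>X. inverse (f_elem n D X)) ` V else {})"
abbreviation "R \<equiv> subalg_gen R_gens"
abbreviation "U_points \<equiv> {u \<in> V \<rightarrow>\<^sub>E (if laurent then UNIV - {0} else (UNIV :: complex set)).
     \<forall>X \<in> V. u X + (\<Prod>Y \<in> incompatibles n D X. u Y) = 1}"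

sublocale K: power_system "\<lambda>X. pwK (if X \<in> V then f_elem n D X else 1)" rat_const
proof
  fix X a b
  have "(if X \<in> V then f_elem n D X else 1) \<noteq> 0" using f_elem_f_val[OF dyck] f_nonzero by simp
  then show "pwK (if X \<in> V then f_elem n D X else 1) (a + b) =
    pwK (if X \<in> V then f_elem n D X else 1) a * pwK (if X \<in> V then f_elem n D X else 1) b" by
      (rule pwK)
qed (auto simp: pwK rat_const_hom)

abbreviation "ev \<equiv> K.eval_poly"

lemma ev_var: "X \<in> V \<Longrightarrow> ev (poly_var X) = f_elem n D X" by (simp add: K.eval_var pwK)

lemma finite_V: "finite V" using finite_idxs[OF admissible_heights] dyck by (simp add:
  index_set_idxs)

lemma u_eqn_clashing: "X \<in> V \<Longrightarrow> u_eqn n D X = poly_var X + prod poly_var (clashing n k X) - 1"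
  by (simp add: u_eqn_def incompatibles_clashing[OF dyck])

lemma incompatibles_V: "incompatibles n D X \<subseteq> V" by (auto simp: incompatibles_def)

lemma u_eqn_C: "X \<in> V \<Longrightarrow> u_eqn n D X \<in> C"
  unfolding u_eqn_def using incompatibles_V[of X]
  by (intro poly_carrier_diff poly_carrier_add poly_carrier_var poly_carrier_prod poly_carrier_1)
    auto

text \<open>The ideal generated by the \<open>u\<close>-equations among polynomials in all variables of type \<open>idx\<close>: the
  theorem \<open>presented\<close> is about ideals of a whole type.\<close>

definition full_ideal :: "(idx, 'e) gpoly set" where
  "full_ideal = {\<Sum>X\<in>V. c X * u_eqn n D X | c. True}"

sublocale S: ratfun_pair "poly_const :: complex \<Rightarrow> (idx, 'e) gpoly" full_ideal
proof
  show "0 \<in> full_ideal" unfolding full_ideal_def by (auto intro!: exI[of _ "\<lambda>_. 0"])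
  fix p q s :: "(idx, 'e) gpoly" assume "p \<in> full_ideal"
  then obtain c where p: "p = (\<Sum>X\<in>V. c X * u_eqn n D X)" unfolding full_ideal_def by blast
  show "s * p \<in> full_ideal" unfolding full_ideal_def p
    by (auto intro!: exI[of _ "\<lambda>X. s * c X"] simp: sum_distrib_left mult.assoc)
  assume "q \<in> full_ideal"
  then obtain d where q: "q = (\<Sum>X\<in>V. d X * u_eqn n D X)" unfolding full_ideal_def by blast
  show "p + q \<in> full_ideal" unfolding full_ideal_def p q
    by (auto intro!: exI[of _ "\<lambda>X. c X + d X"] simp: sum.distrib distrib_right)
qed (auto simp: rat_const_hom poly_const_0 poly_const_1 poly_const_add poly_const_mult)

lemma u_eqn_full: assumes "X \<in> V" shows "u_eqn n D X \<in> full_ideal"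
proof -
  have "(\<Sum>Y\<in>V. (if Y = X then 1 else 0) * u_eqn n D Y) = (\<Sum>Y\<in>V. if Y = X then u_eqn n D Y else (0
    :: (idx, 'e) gpoly))"
    by (rule sum.cong) auto
  also have "\<dots> = u_eqn n D X" using assms by (simp add: finite_V)
  finally show ?thesis unfolding full_ideal_def
    by (intro CollectI exI[of _ "\<lambda>Y. if Y = X then 1 else 0"]) simp
qed

text \<open>The retraction onto the polynomials in the variables from \<open>V\<close> fixes the \<open>u\<close>-equations, so it
  moves the coefficients of a representation of \<open>p\<close> into \<open>C\<close>.\<close>

lemma full_ideal_C: assumes "p \<in> full_ideal" "p \<in> C" shows "p \<in> I"
proof -
  obtain c where c: "p = (\<Sum>X\<in>V. c X * u_eqn n D X)" using assms unfolding full_ideal_def by blast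
  obtain \<rho> :: "(idx, 'e) gpoly \<Rightarrow> (idx, 'e) gpoly" where \<rho>: "\<And>p q. \<rho> (p + q) = \<rho> p + \<rho> q"
    "\<And>p q. \<rho> (p * q) = \<rho> p * \<rho> q" "\<And>p. \<rho> p \<in> C" "\<And>p. p \<in> C \<Longrightarrow> \<rho> p = p"
    using poly_carrier_retract[of V] by blast
  have "\<rho> 0 = 0" using \<rho>(4)[OF poly_carrier_0] .
  then have "\<rho> (sum h A) = (\<Sum>x\<in>A. \<rho> (h x))" for h and A :: "idx set"
    by (induction A rule: infinite_finite_induct) (auto simp: \<rho>)
  then have p: "p = (\<Sum>X\<in>V. \<rho> (c X) * u_eqn n D X)"
    using \<rho>(4)[OF assms(2)] unfolding c by (simp add: \<rho> u_eqn_C cong: sum.cong)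
  interpret P: cring "poly_ring V :: (idx, 'e) gpoly ring" by (rule cring_poly_ring)
  have sub: "u_eqn n D ` V \<subseteq> carrier (poly_ring V :: (idx, 'e) gpoly ring)"
    using u_eqn_C by (auto simp: poly_ring_carrier)
  interpret I: ideal I "poly_ring V :: (idx, 'e) gpoly ring"
    unfolding u_ideal_def by (rule P.genideal_ideal[OF sub])
  have u: "u_eqn n D X \<in> I" if "X \<in> V" for X
    using P.genideal_self[OF sub] that unfolding u_ideal_def by blast
  have "\<rho> (c X) * u_eqn n D X \<in> I" if "X \<in> V" for X
    using I.I_l_closed[OF u[OF that], of "\<rho> (c X)"] \<rho>(3) by (simp add: poly_ring_carrier)
  then have "A \<subseteq> V \<Longrightarrow> (\<Sum>X\<in>A. \<rho> (c X) * u_eqn n D X) \<in> I" for A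
    using I.zero_closed I.a_closed
    by (induction A rule: infinite_finite_induct) (auto simp: poly_ring_carrier)
  then show ?thesis unfolding p by blast
qed

abbreviation "G \<equiv> S.joint V (f_val y_var k) poly_var"

lemma separated_G: "S.separated G"
proof -
  have "u_relations full_ideal n k poly_var"
    unfolding u_relations_def index_set_idxs[OF dyck, symmetric]
  proof
    fix X assume X: "X \<in> V"
    show "poly_var X + prod poly_var (clashing n k X) - 1 \<in> full_ideal"
      using u_eqn_full[OF X] unfolding u_eqn_clashing[OF X] .
  qed
  then show ?thesis
    using S.presented[OF admissible_heights[OF dyck]] index_set_idxs[OF dyck]
    unfolding S.presented_def by simp
qed

lemma G_mult: "G x a \<Longrightarrow> G y b \<Longrightarrow> G (x * y) (a * b)" by (rule S.joint_mult)

lemma G_var: "X \<in> V \<Longrightarrow> G (ev (poly_var X)) (poly_var X)"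
  using S.joint_gen[of X V "f_val y_var k" poly_var] by (simp add: ev_var f_elem_f_val[OF dyck])

lemma G_1: "G (ev 1) 1"
  using S.joint_const[of V "f_val y_var k" poly_var 1] by (simp add: K.eval_1 poly_const_1
    rat_const_hom)

lemma G_power: "X \<in> V \<Longrightarrow> G (ev (poly_var X ^ d)) (poly_var X ^ d)"
  by (induction d) (auto simp: G_1 K.eval_mult intro: G_mult G_var)

text \<open>The relation \<open>G\<close> contains only pairs of genuine polynomials in the variables; a Laurent
  polynomial has to be multiplied with a monomial first.\<close>

lemma clear_denominators:
  assumes "p \<in> C"
  shows "\<exists>\<mu>. \<mu> dvd 1 \<and> G (ev \<mu>) \<mu> \<and> G (ev (\<mu> * p)) (\<mu> * p)"
  using assms
proof (induction rule: poly_carrier_induct)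
  case (const a)
  show ?case using G_1 S.joint_const[of V "f_val y_var k" poly_var a] by (intro exI[of _ 1]) (simp
    add: K.eval_const)
next
  case (gen X a)
  obtain d where "Poly_Mapping.single (Poly_Mapping.single X a) 1 = (poly_var X ^ d :: (idx, 'e)
    gpoly) \<or>
      Poly_Mapping.single (Poly_Mapping.single X a) 1 * poly_var X ^ d = (1 :: (idx, 'e) gpoly)"
    using gen_power[of X a] by blast
  then show ?case
  proof
    assume "Poly_Mapping.single (Poly_Mapping.single X a) 1 = (poly_var X ^ d :: (idx, 'e) gpoly)"
    then show ?case using G_1 G_power[OF gen] by (intro exI[of _ 1]) simp
  next
    assume *: "Poly_Mapping.single (Poly_Mapping.single X a) 1 * poly_var X ^ d = (1 :: (idx, 'e)
      gpoly)"
    then have "poly_var X ^ d dvd (1 :: (idx, 'e) gpoly)" by (metis dvd_triv_right)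
    then show ?case using G_1 G_power[OF gen] * by (intro exI[of _ "poly_var X ^ d"]) (simp add:
      mult.commute)
  qed
next
  case (add p q)
  then obtain \<mu> \<nu> where *: "\<mu> dvd 1" "G (ev \<mu>) \<mu>" "G (ev (\<mu> * p)) (\<mu> * p)"
    "\<nu> dvd 1" "G (ev \<nu>) \<nu>" "G (ev (\<nu> * q)) (\<nu> * q)" by blast
  have "G (ev (\<mu> * \<nu>)) (\<mu> * \<nu>)" unfolding K.eval_mult[of \<mu> \<nu>] by (intro G_mult *)
  moreover have "G (ev \<nu> * ev (\<mu> * p) + ev \<mu> * ev (\<nu> * q)) (\<nu> * (\<mu> * p) + \<mu> * (\<nu> * q))"
    by (intro S.joint_add G_mult *)
  then have "G (ev (\<mu> * \<nu> * (p + q))) (\<mu> * \<nu> * (p + q))"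
    by (simp add: K.eval_mult K.eval_add algebra_simps)
  moreover have "\<mu> * \<nu> dvd 1" using mult_dvd_mono[OF *(1,4)] by simp
  ultimately show ?case by blast
next
  case (mult p q)
  then obtain \<mu> \<nu> where *: "\<mu> dvd 1" "G (ev \<mu>) \<mu>" "G (ev (\<mu> * p)) (\<mu> * p)"
    "\<nu> dvd 1" "G (ev \<nu>) \<nu>" "G (ev (\<nu> * q)) (\<nu> * q)" by blast
  have "G (ev (\<mu> * \<nu>)) (\<mu> * \<nu>)" unfolding K.eval_mult[of \<mu> \<nu>] by (intro G_mult *)
  moreover have "G (ev (\<mu> * p) * ev (\<nu> * q)) ((\<mu> * p) * (\<nu> * q))" by (intro G_mult *)
  then have "G (ev (\<mu> * \<nu> * (p * q))) (\<mu> * \<nu> * (p * q))"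
    by (simp add: K.eval_mult mult_ac)
  moreover have "\<mu> * \<nu> dvd 1" using mult_dvd_mono[OF *(1,4)] by simp
  ultimately show ?case by blast
qed

lemma kernel_subset: assumes "p \<in> C" "ev p = 0" shows "p \<in> I"
proof -
  obtain \<mu> where \<mu>: "\<mu> dvd 1" "G (ev (\<mu> * p)) (\<mu> * p)" using clear_denominators[OF assms(1)] by
    blast
  then have "\<mu> * p \<in> full_ideal" using separated_G assms(2) unfolding S.separated_def by (simp
    add: K.eval_mult)
  moreover obtain \<nu> where "1 = \<mu> * \<nu>" using \<mu>(1) by (elim dvdE)
  then have "p = \<nu> * (\<mu> * p)" by (metis mult.assoc mult.commute mult_1)
  ultimately have "p \<in> full_ideal" using S.J_mult by metis
  then show ?thesis using full_ideal_C assms(1) by blast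
qed

lemma f_elem_relation:
  assumes "X \<in> V" shows "f_elem n D X + (\<Prod>Y\<in>incompatibles n D X. f_elem n D Y) = 1"
proof -
  have "(\<Prod>Y\<in>incompatibles n D X. f_elem n D Y) = prod (f_val y_var k) (clashing n k X)"
    unfolding incompatibles_clashing[OF dyck assms]
    by (rule prod.cong) (auto simp: f_elem_f_val[OF dyck] clashing_def index_set_idxs[OF dyck])
  moreover have "u_relations {0} n k (f_val y_var k)"
    using S.presented[OF admissible_heights[OF dyck]] unfolding S.presented_def by simp
  ultimately show ?thesis using assms f_elem_f_val[OF dyck assms]
    by (auto simp: u_relations_def index_set_idxs[OF dyck])
qed

lemma ev_u_eqn: assumes "X \<in> V" shows "ev (u_eqn n D X) = 0"
proof -
  have "ev (u_eqn n D X) = f_elem n D X + (\<Prod>Y\<in>incompatibles n D X. f_elem n D Y) - 1"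
    unfolding u_eqn_def using assms incompatibles_V[of X]
    by (auto simp: K.eval_diff K.eval_add K.eval_prod K.eval_1 ev_var intro!: prod.cong)
  then show ?thesis using f_elem_relation[OF assms] by simp
qed

subsection \<open>Image and kernel\<close>

lemma cring_K: "cring (ring_on (UNIV :: ratfun set))" by (rule cring_ring_on) auto

lemma ainv_K: "\<ominus>\<^bsub>ring_on (UNIV :: ratfun set)\<^esub> x = - x"
proof -
  interpret K: cring "ring_on (UNIV :: ratfun set)" by (rule cring_K)
  show ?thesis using K.minus_equality[of "- x" x] by simp
qed

lemma image_ev: "ev ` C = carrier R"
proof
  let ?A = "generate_ring (ring_on UNIV) (range rat_const \<union> R_gens)"
  have A_add: "x + y \<in> ?A" and A_mult: "x * y \<in> ?A" if "x \<in> ?A" "y \<in> ?A" for x y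
    using generate_ring.eng_add[OF that] generate_ring.eng_mult[OF that] by simp_all
  have A_const: "rat_const a \<in> ?A" for a by (rule generate_ring.incl) simp
  have A_f: "f_elem n D X \<in> ?A" if "X \<in> V" for X by (rule generate_ring.incl) (use that in simp)
  have A_inv: "inverse (f_elem n D X) \<in> ?A" if "X \<in> V" laurent for X
    by (rule generate_ring.incl) (use that in simp)
  have A_power: "x ^ d \<in> ?A" if "x \<in> ?A" for x d
    using that A_const[of 1] by (induction d) (auto simp: A_mult rat_const_hom)
  have "ev p \<in> ?A" if "p \<in> C" for p using that
  proof (induction rule: poly_carrier_induct)
    case (gen X a)
    let ?m = "Poly_Mapping.single (Poly_Mapping.single X a) 1 :: (idx, 'e) gpoly"
    obtain d where d: "?m = poly_var X ^ d \<or> laurent \<and> ?m * poly_var X ^ d = 1"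
      using gen_power[of X a] by blast
    have pow: "ev (poly_var X ^ d) = f_elem n D X ^ d"
      by (induction d) (simp_all add: K.eval_1 K.eval_mult ev_var[OF gen])
    from d show ?case
    proof (elim disjE conjE)
      assume m: "?m = poly_var X ^ d"
      show ?case unfolding m pow by (rule A_power[OF A_f[OF gen]])
    next
      assume laurent and m: "?m * poly_var X ^ d = 1"
      have "f_elem n D X ^ d * ev ?m = ev (?m * poly_var X ^ d)"
        unfolding K.eval_mult pow by (rule mult.commute)
      also have "\<dots> = 1" unfolding m by (rule K.eval_1)
      finally have "ev ?m = inverse (f_elem n D X) ^ d"
        using inverse_unique[of "f_elem n D X ^ d"] by (simp add: power_inverse)
      then show ?case using A_power[OF A_inv[OF gen \<open>laurent\<close>], of d] by (simp only:)
    qed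
  qed (simp_all only: K.eval_const K.eval_add K.eval_mult A_const A_add A_mult)
  then show "ev ` C \<subseteq> carrier R" by (auto simp: subalg_gen_def)
  have "x \<in> ev ` C" if "x \<in> ?A" for x using that
  proof (induction rule: generate_ring.induct)
    case one
    then show ?case using poly_carrier_1[of V] K.eval_1 by (auto intro: image_eqI[of _ _ 1])
  next
    case (incl x)
    then consider a where "x = rat_const a" | X where "X \<in> V" "x = f_elem n D X"
      | X where "X \<in> V" "x = inverse (f_elem n D X)" laurent by (auto split: if_splits)
    then show ?case
    proof cases
      case 1
      then show ?thesis by (intro image_eqI[of _ _ "poly_const a"]) (simp_all add: K.eval_const
        poly_carrier_const)
    next
      case 2
      then show ?thesis by (intro image_eqI[of _ _ "poly_var X"]) (simp_all add: ev_var
        poly_carrier_var)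
    next
      case 3
      obtain a where "Poly_Mapping.single (Poly_Mapping.single X a) 1 * poly_var X = (1 :: (idx,
        'e) gpoly)"
        using var_inverse[OF 3(3)] by blast
      then have "ev (Poly_Mapping.single (Poly_Mapping.single X a) 1) * ev (poly_var X) = 1"
        by (simp only: K.eval_1 flip: K.eval_mult)
      then have "f_elem n D X * ev (Poly_Mapping.single (Poly_Mapping.single X a) 1) = 1"
        by (simp only: ev_var[OF 3(1)] mult.commute)
      from inverse_unique[OF this] have "ev (Poly_Mapping.single (Poly_Mapping.single X a) 1) = x"
        by (simp only: 3(2))
      then show ?thesis using poly_carrier_gen[OF 3(1), of a] by blast
    qed
  next
    case (a_inv x)
    then obtain p where p: "p \<in> C" "x = ev p" by blast
    have "- x = ev (- p)" using K.eval_diff[of 0 p] by (simp add: p K.eval_0)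
    then show ?case using poly_carrier_uminus[OF p(1)] by (simp add: ainv_K)
  next
    case (eng_add x y)
    then obtain p q where "p \<in> C" "x = ev p" "q \<in> C" "y = ev q" by blast
    then show ?case using poly_carrier_add[of p V q] by (auto simp flip: K.eval_add)
  next
    case (eng_mult x y)
    then obtain p q where "p \<in> C" "x = ev p" "q \<in> C" "y = ev q" by blast
    then show ?case using poly_carrier_mult[of p V q] by (auto simp flip: K.eval_mult)
  qed
  then show "carrier R \<subseteq> ev ` C" by (auto simp: subalg_gen_def)
qed

lemma R_ring_on: "R = ring_on (ev ` C)"
  using image_ev by (simp add: subalg_gen_def)

lemma cring_R: "cring R"
  unfolding R_ring_on
proof (rule cring_ring_on)
  show "0 \<in> ev ` C" by (rule image_eqI[of _ _ 0]) (simp_all add: K.eval_0 poly_carrier_0)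
  show "1 \<in> ev ` C" by (rule image_eqI[of _ _ 1]) (simp_all add: K.eval_1 poly_carrier_1)
  show "x + y \<in> ev ` C" "x * y \<in> ev ` C" if "x \<in> ev ` C" "y \<in> ev ` C" for x y
    using that by (auto simp flip: K.eval_add K.eval_mult intro!: imageI poly_carrier_add
      poly_carrier_mult)
  show "- x \<in> ev ` C" if x: "x \<in> ev ` C" for x
  proof -
    obtain p where p: "p \<in> C" "x = ev p" using x by blast
    have "- x = ev (- p)" using K.eval_diff[of 0 p] by (simp add: p K.eval_0)
    then show ?thesis using poly_carrier_uminus[OF p(1)] by blast
  qed
qed

lemma ev_hom: "ring_hom_ring (poly_ring V :: (idx, 'e) gpoly ring) R ev"
proof (rule ring_hom_ringI)
  show "ring (poly_ring V :: (idx, 'e) gpoly ring)" using cring_poly_ring[of V] by (rule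
    cring.axioms)
  show "ring R" using cring_R by (rule cring.axioms)
qed (auto simp: poly_ring_carrier R_ring_on K.eval_add K.eval_mult K.eval_1)

lemma kernel: "a_kernel (poly_ring V) R ev = I"
proof
  interpret P: cring "poly_ring V :: (idx, 'e) gpoly ring" by (rule cring_poly_ring)
  show "a_kernel (poly_ring V) R ev \<subseteq> I"
    using kernel_subset by (auto simp: a_kernel_def' R_ring_on poly_ring_carrier)
  show "I \<subseteq> a_kernel (poly_ring V) R ev"
    unfolding u_ideal_def
    by (rule P.genideal_minimal[OF ring_hom_ring.kernel_is_ideal[OF ev_hom]])
       (auto simp: a_kernel_def' R_ring_on poly_ring_carrier u_eqn_C ev_u_eqn)
qed

subsection \<open>Homomorphisms are determined by the variables\<close>

definition hom_on_C :: "((idx, 'e) gpoly \<Rightarrow> 'b::field) \<Rightarrow> bool" where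
  "hom_on_C h \<longleftrightarrow> h 1 = 1 \<and> (\<forall>p\<in>C. \<forall>q\<in>C. h (p + q) = h p + h q \<and> h (p * q) = h p * h q)"

text \<open>Negative powers of a variable are inverses, and homomorphisms to a field preserve these.\<close>

lemma hom_on_C_eqI:
  fixes h h' :: "(idx, 'e) gpoly \<Rightarrow> 'b::field"
  assumes h: "hom_on_C h" "hom_on_C h'" and const: "\<And>a. h (poly_const a) = h' (poly_const a)"
    and var: "\<And>X. X \<in> V \<Longrightarrow> h (poly_var X) = h' (poly_var X)" and p: "p \<in> C"
  shows "h p = h' p"
  using p
proof (induction rule: poly_carrier_induct)
  case (gen X a)
  have x: "poly_var X \<in> C" "poly_var X ^ d \<in> C" for d
    by (intro poly_carrier_power poly_carrier_var gen)+
  have pow: "g (poly_var X ^ d) = g (poly_var X) ^ d" if "hom_on_C g" for g :: "(idx, 'e) gpoly \<Rightarrow>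
    'b" and d
    using that x by (induction d) (simp_all add: hom_on_C_def)
  let ?m = "Poly_Mapping.single (Poly_Mapping.single X a) 1 :: (idx, 'e) gpoly"
  obtain d where "?m = poly_var X ^ d \<or> ?m * poly_var X ^ d = 1" using gen_power[of X a] by blast
  then show ?case
  proof
    assume "?m = poly_var X ^ d"
    then show ?case using pow[OF h(1)] pow[OF h(2)] var[OF gen] by simp
  next
    assume *: "?m * poly_var X ^ d = 1"
    have "g ?m * g (poly_var X) ^ d = 1" if "hom_on_C g" for g :: "(idx, 'e) gpoly \<Rightarrow> 'b"
    proof -
      have "g (?m * poly_var X ^ d) = g ?m * g (poly_var X ^ d)"
        using that poly_carrier_gen[OF gen] x(2)
        unfolding hom_on_C_def by blast
      then show ?thesis using that pow[OF that] * by (simp add: hom_on_C_def)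
    qed
    from this[OF h(1)] this[OF h(2)] have "h (poly_var X) ^ d * h ?m = 1" "h (poly_var X) ^ d * h'
      ?m = 1"
      using var[OF gen] by (simp_all add: mult.commute)
    from inverse_unique[OF this(1)] inverse_unique[OF this(2)] show ?case by simp
  qed
qed (use h const in \<open>auto simp: hom_on_C_def\<close>)

lemma hom_on_C_ev: "hom_on_C ev"
  by (simp add: hom_on_C_def K.eval_1 K.eval_add K.eval_mult)

theorem coord_iso:
  "defines_iso (poly_ring V Quot I) (\<lambda>a. coset_of n D (poly_const a)) R rat_const
     V (\<lambda>X. coset_of n D (poly_var X)) (f_elem n D)"
proof -
  define \<phi> where "\<phi> = (\<lambda>Y. the_elem (ev ` Y))"
  let ?P = "poly_ring V :: (idx, 'e) gpoly ring"
  let ?Q = "?P Quot I"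
  have coset: "\<phi> (coset_of n D p) = ev p" if "p \<in> C" for p :: "(idx, 'e) gpoly"
    unfolding \<phi>_def coset_of_def kernel[symmetric] using ring_hom_ring.the_elem_simp[OF ev_hom]
      that by (simp add: poly_ring_carrier)
  have iso: "\<phi> \<in> ring_iso ?Q R"
    unfolding \<phi>_def kernel[symmetric] by (rule ring_hom_ring.FactRing_iso_set[OF ev_hom]) (simp
      add: poly_ring_carrier image_ev)
  have id: "ideal I ?P" unfolding kernel[symmetric] by (rule ring_hom_ring.kernel_is_ideal[OF
    ev_hom])
  have q: "(+>\<^bsub>?P\<^esub>) I \<in> ring_hom ?P ?Q" by (rule ideal.rcos_ring_hom[OF id])
  have carrier: "\<exists>p\<in>C. Y = coset_of n D p" if "Y \<in> carrier ?Q" for Y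
    using ring_hom_ring.quot_mem[OF ev_hom, unfolded kernel, OF that] by (simp add: coset_of_def
      poly_ring_carrier)
  show ?thesis
    unfolding defines_iso_def
  proof (intro bexI[of _ \<phi>] conjI ballI impI)
    show "\<phi> \<in> alg_iso ?Q (\<lambda>a. coset_of n D (poly_const a)) R rat_const"
      using iso by (simp add: alg_iso_def coset poly_carrier_const K.eval_const)
    show "\<phi> (coset_of n D (poly_var X)) = f_elem n D X" if "X \<in> V" for X
      using that by (simp add: coset poly_carrier_var ev_var)
    fix \<psi> Y
    assume \<psi>: "\<psi> \<in> alg_hom ?Q (\<lambda>a. coset_of n D (poly_const a)) R rat_const"
      "\<forall>X\<in>V. \<psi> (coset_of n D (poly_var X)) = f_elem n D X" and Y: "Y \<in> carrier ?Q"
    obtain p where p: "p \<in> C" "Y = coset_of n D p" using carrier[OF Y] by blast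
    have hom: "\<psi> \<in> ring_hom ?Q R" using \<psi>(1) by (simp add: alg_hom_def)
    have comp: "hom_on_C (\<lambda>p. \<psi> (coset_of n D p))"
    proof -
      have "\<psi> (I +>\<^bsub>?P\<^esub> 1) = 1"
        using ring_hom_one[OF hom] ring_hom_one[OF q] by (simp add: poly_ring_carrier R_ring_on)
      moreover have "\<psi> (I +>\<^bsub>?P\<^esub> (p + q)) = \<psi> (I +>\<^bsub>?P\<^esub> p) + \<psi> (I +>\<^bsub>?P\<^esub> q)"
        "\<psi> (I +>\<^bsub>?P\<^esub> (p * q)) = \<psi> (I +>\<^bsub>?P\<^esub> p) * \<psi> (I +>\<^bsub>?P\<^esub> q)" if pq: "p \<in> C" "q \<in> C" for p q
      proof -
        have P: "p \<in> carrier ?P" "q \<in> carrier ?P" using pq by (simp_all add: poly_ring_carrier)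
        note Q = ring_hom_closed[OF q P(1)] ring_hom_closed[OF q P(2)]
        show "\<psi> (I +>\<^bsub>?P\<^esub> (p + q)) = \<psi> (I +>\<^bsub>?P\<^esub> p) + \<psi> (I +>\<^bsub>?P\<^esub> q)"
          using ring_hom_add[OF q P] ring_hom_add[OF hom Q] by (simp add: poly_ring_carrier
            R_ring_on)
        show "\<psi> (I +>\<^bsub>?P\<^esub> (p * q)) = \<psi> (I +>\<^bsub>?P\<^esub> p) * \<psi> (I +>\<^bsub>?P\<^esub> q)"
          using ring_hom_mult[OF q P] ring_hom_mult[OF hom Q] by (simp add: poly_ring_carrier
            R_ring_on)
      qed
      ultimately show ?thesis unfolding hom_on_C_def coset_of_def by blast
    qed
    have "\<psi> (coset_of n D p) = ev p"
      by (rule hom_on_C_eqI[OF comp hom_on_C_ev _ _ p(1)])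
         (use \<psi> in \<open>auto simp: alg_hom_def K.eval_const ev_var\<close>)
    then show "\<psi> Y = \<phi> Y" using p coset by simp
  qed
qed

subsection \<open>Points\<close>

lemma C_points_iff:
  "\<chi> \<in> C_points R rat_const \<longleftrightarrow> \<chi> \<in> extensional (ev ` C) \<and> \<chi> 1 = 1 \<and> (\<forall>a. \<chi> (rat_const a) = a) \<and>
     (\<forall>x\<in>ev ` C. \<forall>y\<in>ev ` C. \<chi> (x + y) = \<chi> x + \<chi> y \<and> \<chi> (x * y) = \<chi> x * \<chi> y)"
  by (auto simp: C_points_def alg_hom_def ring_hom_def R_ring_on)

lemma hom_on_C_point: "\<chi> \<in> C_points R rat_const \<Longrightarrow> hom_on_C (\<lambda>p. \<chi> (ev p))"
  by (simp add: hom_on_C_def C_points_iff K.eval_1 K.eval_add K.eval_mult)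

lemma hom_on_C_prod:
  assumes "hom_on_C h" "\<And>x. x \<in> A \<Longrightarrow> g x \<in> C"
  shows "h (prod g A) = (\<Prod>x\<in>A. h (g x))"
  using assms(2)
proof (induction A rule: infinite_finite_induct)
  case (insert x A)
  then show ?case using assms(1) poly_carrier_prod[of A g V] unfolding hom_on_C_def by simp
qed (use assms(1) in \<open>auto simp: hom_on_C_def\<close>)

text \<open>Conversely to restricting \<open>\<chi>\<close> to the generators, a point \<open>u\<close> defines an evaluation
  homomorphism on \<open>C\<close>. It kills the \<open>u\<close>-equations, hence the kernel of \<open>ev\<close>, and descends to the
  image of \<open>ev\<close>.\<close>

theorem points_bij:
  "bij_betw (\<lambda>\<chi>. \<lambda>X\<in>V. \<chi> (f_elem n D X)) (C_points R rat_const) U_points"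
proof (rule bij_betw_imageI)
  let ?\<Phi> = "\<lambda>\<chi> :: ratfun \<Rightarrow> complex. \<lambda>X\<in>V. \<chi> (f_elem n D X)"
  show "inj_on ?\<Phi> (C_points R rat_const)"
  proof (rule inj_onI)
    fix \<chi> \<chi>' assume *: "\<chi> \<in> C_points R rat_const" "\<chi>' \<in> C_points R rat_const" "?\<Phi> \<chi> = ?\<Phi> \<chi>'"
    have "\<chi> (ev p) = \<chi>' (ev p)" if "p \<in> C" for p
    proof (rule hom_on_C_eqI[OF hom_on_C_point[OF *(1)] hom_on_C_point[OF *(2)] _ _ that])
      show "\<chi> (ev (poly_const a)) = \<chi>' (ev (poly_const a))" for a
        using * by (simp add: K.eval_const C_points_iff)
      show "\<chi> (ev (poly_var X)) = \<chi>' (ev (poly_var X))" if "X \<in> V" for X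
        using fun_cong[OF *(3), of X] that by (simp add: ev_var)
    qed
    then show "\<chi> = \<chi>'" using * by (intro extensionalityI[of _ "ev ` C"]) (auto simp: C_points_iff)
  qed
  have into: "?\<Phi> \<chi> \<in> U_points" if \<chi>: "\<chi> \<in> C_points R rat_const" for \<chi>
  proof -
    note h = hom_on_C_point[OF \<chi>]
    have inC: "f_elem n D X = ev (poly_var X)" "poly_var X \<in> C" if "X \<in> V" for X
      using that by (simp_all add: ev_var poly_carrier_var)
    have "\<chi> (f_elem n D X) \<noteq> 0" if X: "X \<in> V" and L: laurent for X
    proof -
      obtain a where a: "Poly_Mapping.single (Poly_Mapping.single X a) 1 * poly_var X = (1 ::
        (idx, 'e) gpoly)"
        using var_inverse[OF L] by blast
      have "\<chi> (ev (Poly_Mapping.single (Poly_Mapping.single X a) 1 * poly_var X)) =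
        \<chi> (ev (Poly_Mapping.single (Poly_Mapping.single X a) 1)) * \<chi> (ev (poly_var X))"
        using h poly_carrier_gen[OF X] inC(2)[OF X] unfolding hom_on_C_def by blast
      then show ?thesis using h unfolding a hom_on_C_def inC(1)[OF X] by auto
    qed
    moreover have "\<chi> (f_elem n D X) + (\<Prod>Y\<in>incompatibles n D X. \<chi> (f_elem n D Y)) = 1" if X: "X \<in>
      V" for X
    proof -
      let ?Q = "prod poly_var (incompatibles n D X) :: (idx, 'e) gpoly"
      have Q: "?Q \<in> C" using incompatibles_V[of X] inC(2) by (intro poly_carrier_prod) auto
      have "\<chi> (ev ?Q) = (\<Prod>Y\<in>incompatibles n D X. \<chi> (ev (poly_var Y)))"
        by (rule hom_on_C_prod[OF h]) (use incompatibles_V[of X] inC(2) in auto)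
      also have "\<dots> = (\<Prod>Y\<in>incompatibles n D X. \<chi> (f_elem n D Y))"
        by (rule prod.cong) (use incompatibles_V[of X] inC(1) in auto)
      finally have "\<chi> (f_elem n D X) + (\<Prod>Y\<in>incompatibles n D X. \<chi> (f_elem n D Y)) = \<chi> (ev
        (poly_var X + ?Q))"
        using h Q inC(2)[OF X] inC(1)[OF X] unfolding hom_on_C_def by simp
      also have "ev (poly_var X + ?Q) = 1"
        using ev_u_eqn[OF X] unfolding u_eqn_def by (simp add: K.eval_diff K.eval_1)
      also have "\<chi> 1 = 1" using \<chi> by (simp add: C_points_iff)
      finally show ?thesis .
    qed
    then have "(\<lambda>X\<in>V. \<chi> (f_elem n D X)) X + (\<Prod>Y\<in>incompatibles n D X. (\<lambda>X\<in>V. \<chi> (f_elem n D X)) Y) =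
      1"
      if X: "X \<in> V" for X
      using X incompatibles_V[of X] by (simp add: subset_iff cong: prod.cong)
    ultimately show ?thesis by auto
  qed
  show "?\<Phi> ` C_points R rat_const = U_points"
  proof (intro equalityI subsetI)
    fix u assume "u \<in> ?\<Phi> ` C_points R rat_const"
    then show "u \<in> U_points" using into by blast
  next
    fix u assume u: "u \<in> U_points"
    interpret c: power_system "\<lambda>X. pwC (if X \<in> V then u X else 1)" "\<lambda>a. a"
    proof
      fix X a b
      have "laurent \<longrightarrow> (if X \<in> V then u X else 1) \<noteq> 0" using u by (auto simp: PiE_iff)
      then show "pwC (if X \<in> V then u X else 1) (a + b) =
        pwC (if X \<in> V then u X else 1) a * pwC (if X \<in> V then u X else 1) b" by (rule pwC)
    qed (auto simp: pwC)
    have c_var: "c.eval_poly (poly_var X) = u X" if "X \<in> V" for X using that by (simp add: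
      c.eval_var pwC)
    have c_u: "c.eval_poly (u_eqn n D X) = 0" if X: "X \<in> V" for X
    proof -
      have "c.eval_poly (u_eqn n D X) = u X + (\<Prod>Y\<in>incompatibles n D X. u Y) - 1"
        unfolding u_eqn_def using X incompatibles_V[of X]
        by (auto simp: c.eval_diff c.eval_add c.eval_prod c.eval_1 c_var intro!: prod.cong)
      then show ?thesis using u X by simp
    qed
    interpret P: cring "poly_ring V :: (idx, 'e) gpoly ring" by (rule cring_poly_ring)
    have ch: "ring_hom_ring (poly_ring V :: (idx, 'e) gpoly ring) (ring_on (UNIV :: complex set))
      c.eval_poly"
    proof (rule ring_hom_ringI)
      show "ring (poly_ring V :: (idx, 'e) gpoly ring)" using cring_poly_ring[of V] by (rule
        cring.axioms)
      have "cring (ring_on (UNIV :: complex set))" by (rule cring_ring_on) auto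
      then show "ring (ring_on (UNIV :: complex set))" by (rule cring.axioms)
    qed (auto simp: poly_ring_carrier c.eval_add c.eval_mult c.eval_1)
    have "I \<subseteq> a_kernel (poly_ring V) (ring_on UNIV) c.eval_poly"
      unfolding u_ideal_def
      by (rule P.genideal_minimal[OF ring_hom_ring.kernel_is_ideal[OF ch]])
         (auto simp: a_kernel_def' poly_ring_carrier u_eqn_C c_u)
    then have c_I: "c.eval_poly p = 0" if "p \<in> I" for p using that by (auto simp: a_kernel_def')
    have wd: "c.eval_poly p = c.eval_poly q" if "p \<in> C" "q \<in> C" "ev p = ev q" for p q
    proof -
      have "p - q \<in> I" using that by (intro kernel_subset poly_carrier_diff) (auto simp:
        K.eval_diff)
      then show ?thesis using c_I[of "p - q"] by (simp add: c.eval_diff)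
    qed
    \<comment> \<open>lift an element of the image to a polynomial and evaluate it at \<open>u\<close>\<close>
    define \<chi> where "\<chi> = (\<lambda>x\<in>ev ` C. c.eval_poly (SOME p. p \<in> C \<and> ev p = x))"
    have \<chi>: "\<chi> (ev p) = c.eval_poly p" if "p \<in> C" for p
    proof -
      define q where "q = (SOME q. q \<in> C \<and> ev q = ev p)"
      have "q \<in> C \<and> ev q = ev p" unfolding q_def by (rule someI[of _ p]) (use that in simp)
      then have "c.eval_poly q = c.eval_poly p" using wd that by blast
      moreover have "\<chi> (ev p) = c.eval_poly q"
        unfolding \<chi>_def q_def restrict_def by (rule if_P) (rule imageI[OF that])
      ultimately show ?thesis by simp
    qed
    have "\<chi> \<in> C_points R rat_const"
      unfolding C_points_iff
    proof (intro conjI allI ballI)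
      show "\<chi> \<in> extensional (ev ` C)" by (simp add: \<chi>_def)
      show "\<chi> 1 = 1" using \<chi>[OF poly_carrier_1] by (simp add: K.eval_1 c.eval_1)
      show "\<chi> (rat_const a) = a" for a using \<chi>[OF poly_carrier_const[of a]] by (simp add:
        K.eval_const c.eval_const)
      fix x y assume "x \<in> ev ` C" "y \<in> ev ` C"
      then obtain p q where "p \<in> C" "x = ev p" "q \<in> C" "y = ev q" by blast
      then show "\<chi> (x + y) = \<chi> x + \<chi> y" "\<chi> (x * y) = \<chi> x * \<chi> y"
        using \<chi>[of "p + q"] \<chi>[of "p * q"]
        by (simp_all add: \<chi> poly_carrier_add poly_carrier_mult K.eval_add K.eval_mult c.eval_add
          c.eval_mult)
    qed
    moreover have "?\<Phi> \<chi> = u"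
    proof (rule extensionalityI[of _ V])
      show "u \<in> extensional V" using u by (simp add: PiE_iff)
      show "?\<Phi> \<chi> X = u X" if "X \<in> V" for X
        using \<chi>[OF poly_carrier_var[OF that]] that by (simp add: ev_var c_var)
    qed simp
    ultimately show "u \<in> ?\<Phi> ` C_points R rat_const" by blast
  qed
qed

end

lemma single_nat_power: "Poly_Mapping.single (Poly_Mapping.single X d) 1 = poly_var X ^ d"
  for d :: nat
proof (induction d)
  case (Suc d)
  have "poly_var X ^ Suc d = Poly_Mapping.single (Poly_Mapping.single X 1) 1 * Poly_Mapping.single
    (Poly_Mapping.single X d) 1"
    by (simp add: Suc poly_var_def)
  then show ?case by (simp add: mult_single flip: single_add)
qed simp

lemma single_int_power: "Poly_Mapping.single (Poly_Mapping.single X (int d)) 1 = poly_var X ^ d"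
proof (induction d)
  case (Suc d)
  have "poly_var X ^ Suc d = Poly_Mapping.single (Poly_Mapping.single X 1) 1 * Poly_Mapping.single
    (Poly_Mapping.single X (int d)) 1"
    by (simp add: Suc poly_var_def)
  then show ?case by (simp add: mult_single flip: single_add)
qed simp

lemma u_coordinates_polynomial:
  assumes "dyck_path n D"
  shows "u_coordinates n D False (\<lambda>x (d::nat). x ^ d) (\<lambda>x d. x ^ d)"
proof
  show "\<exists>d. Poly_Mapping.single (Poly_Mapping.single X a) 1 = (poly_var X ^ d :: (idx, nat) gpoly) \<or>
    False \<and> Poly_Mapping.single (Poly_Mapping.single X a) 1 * poly_var X ^ d = (1 :: (idx, nat)
      gpoly)" for X a
    by (rule exI[of _ a]) (simp add: single_nat_power)
qed (use assms in \<open>simp_all add: power_add\<close>)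

lemma u_coordinates_laurent:
  assumes "dyck_path n D"
  shows "u_coordinates n D True (\<lambda>x (d::int). x powi d) (\<lambda>x d. x powi d)"
proof
  show "\<exists>d. Poly_Mapping.single (Poly_Mapping.single X a) 1 = (poly_var X ^ d :: (idx, int) gpoly) \<or>
    True \<and> Poly_Mapping.single (Poly_Mapping.single X a) 1 * poly_var X ^ d = (1 :: (idx, int)
      gpoly)" for X a
  proof (cases "a \<ge> 0")
    case True
    then show ?thesis using single_int_power[of X "nat a"] by (intro exI[of _ "nat a"]) simp
  next
    case False
    then have "Poly_Mapping.single (Poly_Mapping.single X a) 1 * poly_var X ^ nat (- a) = (1 ::
      (idx, int) gpoly)"
      unfolding single_int_power[symmetric] by (simp add: mult_single flip: single_add)
    then show ?thesis by blast
  qed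
  show "\<exists>a. Poly_Mapping.single (Poly_Mapping.single X a) 1 * poly_var X = (1 :: (idx, int)
    gpoly)" for X
    by (rule exI[of _ "-1"]) (simp add: poly_var_def mult_single flip: single_add)
qed (use assms in \<open>simp_all add: power_int_add\<close>)

theorem theorem4p2:
  fixes n :: nat and D :: "step list"
  assumes "dyck_path n D"
  shows
    "defines_iso
       (coord_ring_open n D) (\<lambda>c. coset_of n D (poly_const c))
       (R_alg_open n D) rat_const
       (index_set n D) (\<lambda>X. coset_of n D (poly_var X)) (f_elem n D)
     \<and> defines_iso
       (coord_ring n D) (\<lambda>c. coset_of n D (poly_const c))
       (R_alg n D) rat_const
       (index_set n D) (\<lambda>X. coset_of n D (poly_var X)) (f_elem n D)
     \<and> bij_betw (\<lambda>\<chi>. \<lambda>X \<in> index_set n D. \<chi> (f_elem n D X))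
         (C_points (R_alg_open n D) rat_const) (U_var_open n D)
     \<and> bij_betw (\<lambda>\<chi>. \<lambda>X \<in> index_set n D. \<chi> (f_elem n D X))
         (C_points (R_alg n D) rat_const) (U_var n D)"
proof -
  note A = u_coordinates_polynomial[OF assms] and B = u_coordinates_laurent[OF assms]
  show ?thesis
    using u_coordinates.coord_iso[OF A] u_coordinates.points_bij[OF A]
      u_coordinates.coord_iso[OF B] u_coordinates.points_bij[OF B]
    unfolding coord_ring_open_def coord_ring_def R_alg_open_def R_alg_def U_var_open_def U_var_def
    by simp
qed

end
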